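(* Let $\Bbbk$ be a field, $R:=\Bbbk[x]$ and $R_n:=R/(x^n)$. The two composable morphisms $$A:=R_3\xrightarrow{f:=x^1}B:=R_3\xrightarrow{g:=x^1}C:=R_3$$ can be extended to two non-isomorphic good octahedra in $\mathbf{D}^b_0(R\text{-}\mathrm{mod})$. The first octahedron is given by $$F=D=R_1[1]\oplus R_1,\qquad E=R_2[1]\oplus R_2,$$ $$f'=\begin{pmatrix} y \\ x^0 \end{pmatrix},\quad h'=\begin{pmatrix} y \\ x^0 \end{pmatrix},\quad g''=\begin{pmatrix}-x^2[1]& y\end{pmatrix},\quad h''=\begin{pmatrix}-x^1[1]& y\end{pmatrix},$$ and $$k=\begin{pmatrix} x^1[1] & 0 \\ 0 & x^1 \end{pmatrix},\qquad k'=\begin{pmatrix} x^0[1] & 0 \\ 0 & x^0 \end{pmatrix},$$ the other morphisms being determined by composition: $h=g\circ f$, $f''=h''\circ k$, $g'=k'\circ h'$, $k''=f'[1]\circ g''$, $l=h'\circ g$, $l'=f[1]\circ h''$. The second octahedron is given by the same $D,E,F,f',h',g'',h''$ but with $k,k'$ replaced by $$\tilde k=\begin{pmatrix} x^1[1] & y \\ 0 & x^1 \end{pmatrix},\qquad \tilde k'=\begin{pmatrix} x^0[1] & -y \\ 0 & x^0 \end{pmatrix}$$ (the other morphisms again determined by composition).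
   Context: $R\text{-}\mathrm{mod}$ is the category of finitely generated $R$-modules, and $\mathbf{D}^b_0(R\text{-}\mathrm{mod})$ is the full triangulated subcategory of $\mathbf{D}^b(R\text{-}\mathrm{mod})$ of complexes whose cohomology is annihilated by some power of $x$. For $i\ge\max\{0,n-m\}$, $x^i\colon R_m\to R_n$ denotes the $R$-linear map induced by multiplication by $x^i$. The symbol $y\colon R_m\to R_n[1]$ denotes the morphism of $\mathbf{D}^b(R\text{-}\mathrm{mod})$ corresponding to the isomorphism class of the short exact sequence $0\to R_n\xrightarrow{x^m}R_{n+m}\xrightarrow{x^0}R_m\to0$, with the sign convention that $R_n\xrightarrow{x^m}R_{n+m}\xrightarrow{x^0}R_m\xrightarrow{y}R_n[1]$ is distinguished (the distinguished triangles being those isomorphic to $X\xrightarrow{u}Y\to \mathsf C(u)\to X[1]$, where $\mathsf C(u)=X[1]\oplus Y$ has differential $\left(\begin{smallmatrix} -d_X & 0 \\ u & d_Y \end{smallmatrix}\right)$ and the last two maps are the inclusion and the projection). Octahedra. An octahedron in a triangulated category consists of objects $A,B,C,D,E,F$ and morphisms $f\colon A\to B$, $f'\colon B\to D$, $f''\colon D\to A[1]$, $g\colon B\to C$, $g'\colon C\to F$, $g''\colon F\to B[1]$, $h\colon A\to C$, $h'\colon C\to E$, $h''\colon E\to A[1]$, $k\colon D\to E$, $k'\colon E\to F$, $k''\colon F\to D[1]$, $l\colon B\to E$, $l'\colon E\to B[1]$ such that $h=g\circ f$, $k''=f'[1]\circ g''$, $f''=h''\circ k$, $g'=k'\circ h'$,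 $l=h'\circ g=k\circ f'$, $l'=f[1]\circ h''=g''\circ k'$, and the triangles $A\xrightarrow{f}B\xrightarrow{f'}D\xrightarrow{f''}A[1]$, $A\xrightarrow{h}C\xrightarrow{h'}E\xrightarrow{h''}A[1]$, $B\xrightarrow{g}C\xrightarrow{g'}F\xrightarrow{g''}B[1]$, $D\xrightarrow{k}E\xrightarrow{k'}F\xrightarrow{k''}D[1]$ are distinguished. One says it extends the pair $A\xrightarrow{f}B\xrightarrow{g}C$. It is good if moreover the triangles $$B\xrightarrow{l}E\xrightarrow{\left(\begin{smallmatrix} k' \\ -h'' \end{smallmatrix}\right)}F\oplus A[1]\xrightarrow{(g''\ \ f[1])}B[1],\qquad B\xrightarrow{\left(\begin{smallmatrix} g \\ f' \end{smallmatrix}\right)}C\oplus D\xrightarrow{(h'\ \ -k)}E\xrightarrow{l'}B[1]$$ are distinguished. Two octahedra (the second written with tildes) are isomorphic if there are isomorphisms $\phi_X\colon X\to\tilde X$ for $X\in\{A,B,C,D,E,F\}$ such that $\tilde x\circ\phi_Y=\phi_Z\circ x$ for each of the fourteen morphisms $x\colon Y\to Z$, where $\phi_{X[1]}:=\phi_X[1]$. *)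

theory Defs
  imports "HOL-Computational_Algebra.Polynomial" "HOL-Algebra.Ideal" "HOL-Algebra.Module"
begin

section \<open>Finitely generated modules over $R = k[x]$\<close>

definition kx :: "'k::field poly ring" where
  "kx = \<lparr>carrier = UNIV, monoid.mult = (*), one = 1, ring.zero = 0, add = (+)\<rparr>"

abbreviation xpow :: "nat \<Rightarrow> 'k::field poly" where
  "xpow i \<equiv> [:0, 1:] ^ i"

text \<open>
  The objects of a category have to have their elements in one HOL type.  The type below contains
  the cosets of all ideals of $R$ and is closed under pairing.  By the structure theorem over the
  principal ideal domain $R$, every finitely generated $R$-module is a finite direct sum of modules
  $R/(p)$, so every finitely generated $R$-module is isomorphic to one with elements in this type,
  and the modules with carrier in this type form a category equivalent to $R$-mod.
\<close>

datatype 'r elt = Coset (the_coset: "'r set") | Pr (pfst: "'r elt") (psnd: "'r elt")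

type_synonym 'r rmod = "('r, 'r elt) module"

definition fg_module :: "'k::field poly rmod \<Rightarrow> bool" where
  "fg_module M \<longleftrightarrow> module kx M \<and>
     (\<exists>S. finite S \<and> S \<subseteq> carrier M \<and> (\<forall>N. submodule N kx M \<and> S \<subseteq> N \<longrightarrow> N = carrier M))"

definition linear_map :: "'k::field poly rmod \<Rightarrow> 'k poly rmod \<Rightarrow> ('k poly elt \<Rightarrow> 'k poly elt) \<Rightarrow> bool" where
  "linear_map M N h \<longleftrightarrow> h \<in> hom (add_monoid M) (add_monoid N) \<and>
     (\<forall>r. \<forall>v \<in> carrier M. h (r \<odot>\<^bsub>M\<^esub> v) = r \<odot>\<^bsub>N\<^esub> h v)"

text \<open>The record type of modules extends that of rings; its multiplicative fields are never used.\<close>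

definition quot_module :: "('r, 'a) module \<Rightarrow> 'a set \<Rightarrow> ('r, 'a set) module" where
  "quot_module M N =
     \<lparr>carrier = a_rcosets\<^bsub>M\<^esub> N, monoid.mult = undefined, one = undefined,
      ring.zero = N, add = set_add M,
      module.smult = (\<lambda>r C. \<Union>c\<in>C. N +>\<^bsub>M\<^esub> (r \<odot>\<^bsub>M\<^esub> c))\<rparr>"

definition dsum_module :: "'k::field poly rmod \<Rightarrow> 'k poly rmod \<Rightarrow> 'k poly rmod" where
  "dsum_module M N =
     \<lparr>carrier = {Pr a b | a b. a \<in> carrier M \<and> b \<in> carrier N},
      monoid.mult = undefined, one = undefined,
      ring.zero = Pr \<zero>\<^bsub>M\<^esub> \<zero>\<^bsub>N\<^esub>,
      add = (\<lambda>u v. Pr (pfst u \<oplus>\<^bsub>M\<^esub> pfst v) (psnd u \<oplus>\<^bsub>N\<^esub> psnd v)),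
      module.smult = (\<lambda>r u. Pr (r \<odot>\<^bsub>M\<^esub> pfst u) (r \<odot>\<^bsub>N\<^esub> psnd u))\<rparr>"

definition regular_module :: "('k::field poly, 'k poly) module" where
  "regular_module = ring.extend kx \<lparr>module.smult = (*)\<rparr>"

definition xideal :: "nat \<Rightarrow> 'k::field poly set" where
  "xideal n = PIdl\<^bsub>kx\<^esub> (xpow n)"

text \<open>$R_n = R/(x^n)$, transported along the injection \<^const>\<open>Coset\<close>; \<open>Rmod 0\<close> is a zero module.\<close>

definition Rmod :: "nat \<Rightarrow> 'k::field poly rmod" where
  "Rmod n = (let Q = quot_module regular_module (xideal n) in
     \<lparr>carrier = Coset ` carrier Q, monoid.mult = undefined, one = undefined,
      ring.zero = Coset \<zero>\<^bsub>Q\<^esub>,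
      add = (\<lambda>u v. Coset (the_coset u \<oplus>\<^bsub>Q\<^esub> the_coset v)),
      module.smult = (\<lambda>r u. Coset (r \<odot>\<^bsub>Q\<^esub> the_coset u))\<rparr>)"

text \<open>$p + (x^m) \mapsto x^i p + (x^n)$, well defined on $R_m$ for $i \ge \max\{0, n-m\}$.\<close>

definition Rmap :: "nat \<Rightarrow> nat \<Rightarrow> 'k::field poly elt \<Rightarrow> 'k poly elt" where
  "Rmap n i u = Coset (\<Union>p \<in> the_coset u. xideal n +>\<^bsub>kx\<^esub> (xpow i * p))"


section \<open>Bounded complexes\<close>

record 'r cplx =
  obj :: "int \<Rightarrow> 'r rmod"
  diff :: "int \<Rightarrow> 'r elt \<Rightarrow> 'r elt"

type_synonym 'r gmap = "int \<Rightarrow> 'r elt \<Rightarrow> 'r elt"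

definition bounded_complex :: "'k::field poly cplx \<Rightarrow> bool" where
  "bounded_complex X \<longleftrightarrow>
     (\<forall>n. fg_module (obj X n)) \<and>
     (\<forall>n. linear_map (obj X n) (obj X (n + 1)) (diff X n)) \<and>
     (\<forall>n. \<forall>v \<in> carrier (obj X n). diff X (n + 1) (diff X n v) = \<zero>\<^bsub>obj X (n + 1 + 1)\<^esub>) \<and>
     (\<exists>N. \<forall>n. \<bar>n\<bar> > N \<longrightarrow> carrier (obj X n) = {\<zero>\<^bsub>obj X n\<^esub>})"

definition chain_map :: "'k::field poly cplx \<Rightarrow> 'k poly gmap \<Rightarrow> 'k poly cplx \<Rightarrow> bool" where
  "chain_map X f Y \<longleftrightarrow> bounded_complex X \<and> bounded_complex Y \<and>
     (\<forall>n. linear_map (obj X n) (obj Y n) (f n)) \<and>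
     (\<forall>n. \<forall>v \<in> carrier (obj X n). diff Y n (f n v) = f (n + 1) (diff X n v))"

definition homotopic :: "'k::field poly cplx \<Rightarrow> 'k poly cplx \<Rightarrow> 'k poly gmap \<Rightarrow> 'k poly gmap \<Rightarrow> bool" where
  "homotopic X Y f g \<longleftrightarrow> (\<exists>s.
     (\<forall>n. linear_map (obj X n) (obj Y (n - 1)) (s n)) \<and>
     (\<forall>n. \<forall>v \<in> carrier (obj X n).
        f n v = g n v \<oplus>\<^bsub>obj Y n\<^esub> (diff Y (n - 1) (s n v) \<oplus>\<^bsub>obj Y n\<^esub> s (n + 1) (diff X n v))))"

definition cocycles :: "'k::field poly cplx \<Rightarrow> int \<Rightarrow> 'k poly elt set" where
  "cocycles X n = {v \<in> carrier (obj X n). diff X n v = \<zero>\<^bsub>obj X (n + 1)\<^esub>}"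

definition coboundaries :: "'k::field poly cplx \<Rightarrow> int \<Rightarrow> 'k poly elt set" where
  "coboundaries X n = diff X (n - 1) ` carrier (obj X (n - 1))"

definition cohomology :: "'k::field poly cplx \<Rightarrow> int \<Rightarrow> ('k poly, 'k poly elt set) module" where
  "cohomology X n = quot_module ((obj X n)\<lparr>carrier := cocycles X n\<rparr>) (coboundaries X n)"

definition cohomology_map :: "'k::field poly cplx \<Rightarrow> 'k poly gmap \<Rightarrow> int \<Rightarrow> 'k poly elt set \<Rightarrow> 'k poly elt set" where
  "cohomology_map Y f n C = (\<Union>z\<in>C. coboundaries Y n +>\<^bsub>obj Y n\<^esub> f n z)"

definition quasi_iso :: "'k::field poly cplx \<Rightarrow> 'k poly gmap \<Rightarrow> 'k poly cplx \<Rightarrow> bool" where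
  "quasi_iso X f Y \<longleftrightarrow> chain_map X f Y \<and>
     (\<forall>n. bij_betw (cohomology_map Y f n) (carrier (cohomology X n)) (carrier (cohomology Y n)))"

text \<open>The objects of $D^b_0$, a full subcategory of $D^b$.\<close>

definition in_Db0 :: "'k::field poly cplx \<Rightarrow> bool" where
  "in_Db0 X \<longleftrightarrow> bounded_complex X \<and>
     (\<exists>N. \<forall>n. \<forall>c \<in> carrier (cohomology X n).
        xpow N \<odot>\<^bsub>cohomology X n\<^esub> c = \<zero>\<^bsub>cohomology X n\<^esub>)"

definition stalk :: "'k::field poly rmod \<Rightarrow> 'k poly cplx" where
  "stalk M = (let Z = (\<lambda>n::int. if n = 0 then M else Rmod 0) in
     \<lparr>obj = Z, diff = (\<lambda>n v. \<zero>\<^bsub>Z (n + 1)\<^esub>)\<rparr>)"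

definition stalk_map :: "('k::field poly elt \<Rightarrow> 'k poly elt) \<Rightarrow> 'k poly gmap" where
  "stalk_map h = (\<lambda>n. if n = 0 then h else (\<lambda>v. \<zero>\<^bsub>Rmod 0\<^esub>))"

definition shift :: "'k::field poly cplx \<Rightarrow> 'k poly cplx" where
  "shift X = \<lparr>obj = (\<lambda>n. obj X (n + 1)),
     diff = (\<lambda>n v. \<ominus>\<^bsub>obj X (n + 1 + 1)\<^esub> diff X (n + 1) v)\<rparr>"

definition shift_map :: "'k poly gmap \<Rightarrow> 'k poly gmap" where
  "shift_map f = (\<lambda>n. f (n + 1))"

definition dsum :: "'k::field poly cplx \<Rightarrow> 'k poly cplx \<Rightarrow> 'k poly cplx" where
  "dsum X Y = \<lparr>obj = (\<lambda>n. dsum_module (obj X n) (obj Y n)),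
     diff = (\<lambda>n v. Pr (diff X n (pfst v)) (diff Y n (psnd v)))\<rparr>"

definition cone :: "'k::field poly cplx \<Rightarrow> 'k poly gmap \<Rightarrow> 'k poly cplx \<Rightarrow> 'k poly cplx" where
  "cone X u Y = \<lparr>obj = (\<lambda>n. dsum_module (obj X (n + 1)) (obj Y n)),
     diff = (\<lambda>n v. Pr (\<ominus>\<^bsub>obj X (n + 1 + 1)\<^esub> diff X (n + 1) (pfst v))
                      (u (n + 1) (pfst v) \<oplus>\<^bsub>obj Y (n + 1)\<^esub> diff Y n (psnd v)))\<rparr>"


section \<open>The derived category\<close>

text \<open>
  $D^b(R\text{-mod})$ is the localization of the homotopy category of bounded complexes at the
  quasi-isomorphisms, in the construction of Gabriel and Zisman: morphisms are formal composites
  of chain maps and of formal inverses \<open>Inv X s Y\<close> (from \<open>Y\<close> to \<open>X\<close>) of quasi-isomorphisms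
  \<open>s : X \<rightarrow> Y\<close>, modulo the least congruence \<open>deq\<close> that makes this a category,
  that is compatible with composition of chain maps and identifies homotopic ones,
  and that makes the formal inverses inverse.
\<close>

datatype 'r dterm =
    Chain "'r cplx" "'r gmap" "'r cplx"
  | Inv "'r cplx" "'r gmap" "'r cplx"
  | Comp "'r dterm" "'r dterm"

primrec src :: "'k poly dterm \<Rightarrow> 'k poly cplx" where
  "src (Chain X f Y) = X"
| "src (Inv X s Y) = Y"
| "src (Comp b a) = src a"

primrec tgt :: "'k poly dterm \<Rightarrow> 'k poly cplx" where
  "tgt (Chain X f Y) = Y"
| "tgt (Inv X s Y) = X"
| "tgt (Comp b a) = tgt b"

primrec wf_term :: "'k::field poly dterm \<Rightarrow> bool" where
  "wf_term (Chain X f Y) \<longleftrightarrow> chain_map X f Y"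
| "wf_term (Inv X s Y) \<longleftrightarrow> quasi_iso X s Y"
| "wf_term (Comp b a) \<longleftrightarrow> wf_term b \<and> wf_term a \<and> src b = tgt a"

inductive deq :: "'k::field poly dterm \<Rightarrow> 'k poly dterm \<Rightarrow> bool" where
  refl: "wf_term a \<Longrightarrow> deq a a"
| sym: "deq a b \<Longrightarrow> deq b a"
| trans: "deq a b \<Longrightarrow> deq b c \<Longrightarrow> deq a c"
| cong: "deq b b' \<Longrightarrow> deq a a' \<Longrightarrow> src b = tgt a \<Longrightarrow> deq (Comp b a) (Comp b' a')"
| assoc: "wf_term (Comp c (Comp b a)) \<Longrightarrow> deq (Comp (Comp c b) a) (Comp c (Comp b a))"
| id_left: "wf_term a \<Longrightarrow> deq (Comp (Chain (tgt a) (\<lambda>n. id) (tgt a)) a) a"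
| id_right: "wf_term a \<Longrightarrow> deq (Comp a (Chain (src a) (\<lambda>n. id) (src a))) a"
| chain_comp: "chain_map X f Y \<Longrightarrow> chain_map Y g Z \<Longrightarrow>
    deq (Comp (Chain Y g Z) (Chain X f Y)) (Chain X (\<lambda>n. g n \<circ> f n) Z)"
| chain_homotopic: "chain_map X f Y \<Longrightarrow> chain_map X g Y \<Longrightarrow> homotopic X Y f g \<Longrightarrow>
    deq (Chain X f Y) (Chain X g Y)"
| inv_left: "quasi_iso X s Y \<Longrightarrow> deq (Comp (Inv X s Y) (Chain X s Y)) (Chain X (\<lambda>n. id) X)"
| inv_right: "quasi_iso X s Y \<Longrightarrow> deq (Comp (Chain X s Y) (Inv X s Y)) (Chain Y (\<lambda>n. id) Y)"

type_synonym 'r dmor = "'r dterm set"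

definition dclass :: "'k::field poly dterm \<Rightarrow> 'k poly dmor" where
  "dclass a = {b. deq a b}"

definition dhom :: "'k::field poly cplx \<Rightarrow> 'k poly cplx \<Rightarrow> 'k poly dmor set" where
  "dhom X Y = {dclass a | a. wf_term a \<and> src a = X \<and> tgt a = Y}"

definition dcomp :: "'k::field poly dmor \<Rightarrow> 'k poly dmor \<Rightarrow> 'k poly dmor" (infixr \<open>\<cdot>\<close> 75) where
  "\<psi> \<cdot> \<phi> = {c. \<exists>b \<in> \<psi>. \<exists>a \<in> \<phi>. deq (Comp b a) c}"

abbreviation dmap :: "'k::field poly cplx \<Rightarrow> 'k poly gmap \<Rightarrow> 'k poly cplx \<Rightarrow> 'k poly dmor" where
  "dmap X f Y \<equiv> dclass (Chain X f Y)"

abbreviation did :: "'k::field poly cplx \<Rightarrow> 'k poly dmor" where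
  "did X \<equiv> dmap X (\<lambda>n. id) X"

definition diso :: "'k::field poly cplx \<Rightarrow> 'k poly dmor \<Rightarrow> 'k poly cplx \<Rightarrow> bool" where
  "diso X \<phi> Y \<longleftrightarrow> \<phi> \<in> dhom X Y \<and> (\<exists>\<psi> \<in> dhom Y X. \<psi> \<cdot> \<phi> = did X \<and> \<phi> \<cdot> \<psi> = did Y)"

primrec shift_term :: "'k::field poly dterm \<Rightarrow> 'k poly dterm" where
  "shift_term (Chain X f Y) = Chain (shift X) (shift_map f) (shift Y)"
| "shift_term (Inv X s Y) = Inv (shift X) (shift_map s) (shift Y)"
| "shift_term (Comp b a) = Comp (shift_term b) (shift_term a)"

text \<open>The shift functor on morphisms, written $\phi[1]$ in the mathematical notation.\<close>

definition dshift :: "'k::field poly dmor \<Rightarrow> 'k poly dmor" (\<open>_\<langle>1\<rangle>\<close> [1000] 1000) where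
  "\<phi>\<langle>1\<rangle> = {b. \<exists>a \<in> \<phi>. deq (shift_term a) b}"

text \<open>The additive inverse of a morphism is its composite with $-\mathrm{id}$ of the target.\<close>

definition dneg :: "'k::field poly dmor \<Rightarrow> 'k poly dmor" where
  "dneg \<phi> = {b. \<exists>a \<in> \<phi>.
     deq (Comp (Chain (tgt a) (\<lambda>n v. \<ominus>\<^bsub>obj (tgt a) n\<^esub> v) (tgt a)) a) b}"

definition dzero :: "'k::field poly cplx \<Rightarrow> 'k poly cplx \<Rightarrow> 'k poly dmor" where
  "dzero X Y = dmap X (\<lambda>n v. \<zero>\<^bsub>obj Y n\<^esub>) Y"

definition din1 :: "'k::field poly cplx \<Rightarrow> 'k poly cplx \<Rightarrow> 'k poly dmor" where
  "din1 X Y = dmap X (\<lambda>n v. Pr v \<zero>\<^bsub>obj Y n\<^esub>) (dsum X Y)"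

definition din2 :: "'k::field poly cplx \<Rightarrow> 'k poly cplx \<Rightarrow> 'k poly dmor" where
  "din2 X Y = dmap Y (\<lambda>n v. Pr \<zero>\<^bsub>obj X n\<^esub> v) (dsum X Y)"

definition dpr1 :: "'k::field poly cplx \<Rightarrow> 'k poly cplx \<Rightarrow> 'k poly dmor" where
  "dpr1 X Y = dmap (dsum X Y) (\<lambda>n. pfst) X"

definition dpr2 :: "'k::field poly cplx \<Rightarrow> 'k poly cplx \<Rightarrow> 'k poly dmor" where
  "dpr2 X Y = dmap (dsum X Y) (\<lambda>n. psnd) Y"

text \<open>
  Matrix notation: the morphism between direct sums with the given entries.  The direct sum of
  complexes is a biproduct in the derived category, so there is exactly one.
\<close>

definition dcol :: "'k::field poly cplx \<Rightarrow> 'k poly cplx \<Rightarrow> 'k poly cplx \<Rightarrow> 'k poly dmor \<Rightarrow> 'k poly dmor \<Rightarrow> 'k poly dmor" where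
  "dcol X Y1 Y2 a b =
     (THE m. m \<in> dhom X (dsum Y1 Y2) \<and> dpr1 Y1 Y2 \<cdot> m = a \<and> dpr2 Y1 Y2 \<cdot> m = b)"

definition drow :: "'k::field poly cplx \<Rightarrow> 'k poly cplx \<Rightarrow> 'k poly cplx \<Rightarrow> 'k poly dmor \<Rightarrow> 'k poly dmor \<Rightarrow> 'k poly dmor" where
  "drow X1 X2 Y a b =
     (THE m. m \<in> dhom (dsum X1 X2) Y \<and> m \<cdot> din1 X1 X2 = a \<and> m \<cdot> din2 X1 X2 = b)"

definition dmat :: "'k::field poly cplx \<Rightarrow> 'k poly cplx \<Rightarrow> 'k poly cplx \<Rightarrow> 'k poly cplx \<Rightarrow>
    'k poly dmor \<Rightarrow> 'k poly dmor \<Rightarrow> 'k poly dmor \<Rightarrow> 'k poly dmor \<Rightarrow> 'k poly dmor" where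
  "dmat X1 X2 Y1 Y2 a b c d =
     (THE m. m \<in> dhom (dsum X1 X2) (dsum Y1 Y2) \<and>
        dpr1 Y1 Y2 \<cdot> m \<cdot> din1 X1 X2 = a \<and> dpr1 Y1 Y2 \<cdot> m \<cdot> din2 X1 X2 = b \<and>
        dpr2 Y1 Y2 \<cdot> m \<cdot> din1 X1 X2 = c \<and> dpr2 Y1 Y2 \<cdot> m \<cdot> din2 X1 X2 = d)"


section \<open>Distinguished triangles and octahedra\<close>

definition cone_in :: "'k::field poly cplx \<Rightarrow> 'k poly gmap \<Rightarrow> 'k poly cplx \<Rightarrow> 'k poly dmor" where
  "cone_in X u Y = dmap Y (\<lambda>n v. Pr \<zero>\<^bsub>obj X (n + 1)\<^esub> v) (cone X u Y)"

definition cone_out :: "'k::field poly cplx \<Rightarrow> 'k poly gmap \<Rightarrow> 'k poly cplx \<Rightarrow> 'k poly dmor" where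
  "cone_out X u Y = dmap (cone X u Y) (\<lambda>n. pfst) (shift X)"

definition distinguished :: "'k::field poly cplx \<Rightarrow> 'k poly dmor \<Rightarrow> 'k poly cplx \<Rightarrow> 'k poly dmor \<Rightarrow> 'k poly cplx \<Rightarrow> 'k poly dmor \<Rightarrow> bool"
  where
  "distinguished X u Y v Z w \<longleftrightarrow>
     u \<in> dhom X Y \<and> v \<in> dhom Y Z \<and> w \<in> dhom Z (shift X) \<and>
     (\<exists>X' t Y' \<alpha> \<beta> \<gamma>. chain_map X' t Y' \<and>
        diso X \<alpha> X' \<and> diso Y \<beta> Y' \<and> diso Z \<gamma> (cone X' t Y') \<and>
        \<beta> \<cdot> u = dmap X' t Y' \<cdot> \<alpha> \<and>
        \<gamma> \<cdot> v = cone_in X' t Y' \<cdot> \<beta> \<and>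
        \<alpha>\<langle>1\<rangle> \<cdot> w = cone_out X' t Y' \<cdot> \<gamma>)"

record 'r octahedron =
  oA :: "'r cplx"  oB :: "'r cplx"  oC :: "'r cplx"
  oD :: "'r cplx"  oE :: "'r cplx"  oF :: "'r cplx"
  mf :: "'r dmor"  mf' :: "'r dmor"  mf'' :: "'r dmor"
  mg :: "'r dmor"  mg' :: "'r dmor"  mg'' :: "'r dmor"
  mh :: "'r dmor"  mh' :: "'r dmor"  mh'' :: "'r dmor"
  mk :: "'r dmor"  mk' :: "'r dmor"  mk'' :: "'r dmor"
  ml :: "'r dmor"  ml' :: "'r dmor"

text \<open>
  An octahedron in $D^b_0$: as $D^b_0$ is a full triangulated subcategory of $D^b$, only the objects
  are restricted.
\<close>

definition is_octahedron :: "'k::field poly octahedron \<Rightarrow> bool" where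
  "is_octahedron T \<longleftrightarrow>
     in_Db0 (oA T) \<and> in_Db0 (oB T) \<and> in_Db0 (oC T) \<and>
     in_Db0 (oD T) \<and> in_Db0 (oE T) \<and> in_Db0 (oF T) \<and>
     ml T \<in> dhom (oB T) (oE T) \<and> ml' T \<in> dhom (oE T) (shift (oB T)) \<and>
     mh T = mg T \<cdot> mf T \<and>
     mk'' T = (mf' T)\<langle>1\<rangle> \<cdot> mg'' T \<and>
     mf'' T = mh'' T \<cdot> mk T \<and>
     mg' T = mk' T \<cdot> mh' T \<and>
     ml T = mh' T \<cdot> mg T \<and> ml T = mk T \<cdot> mf' T \<and>
     ml' T = (mf T)\<langle>1\<rangle> \<cdot> mh'' T \<and> ml' T = mg'' T \<cdot> mk' T \<and>
     distinguished (oA T) (mf T) (oB T) (mf' T) (oD T) (mf'' T) \<and>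
     distinguished (oA T) (mh T) (oC T) (mh' T) (oE T) (mh'' T) \<and>
     distinguished (oB T) (mg T) (oC T) (mg' T) (oF T) (mg'' T) \<and>
     distinguished (oD T) (mk T) (oE T) (mk' T) (oF T) (mk'' T)"

definition good_octahedron :: "'k::field poly octahedron \<Rightarrow> bool" where
  "good_octahedron T \<longleftrightarrow> is_octahedron T \<and>
     distinguished (oB T) (ml T) (oE T)
       (dcol (oE T) (oF T) (shift (oA T)) (mk' T) (dneg (mh'' T)))
       (dsum (oF T) (shift (oA T)))
       (drow (oF T) (shift (oA T)) (shift (oB T)) (mg'' T) ((mf T)\<langle>1\<rangle>)) \<and>
     distinguished (oB T)
       (dcol (oB T) (oC T) (oD T) (mg T) (mf' T))
       (dsum (oC T) (oD T))
       (drow (oC T) (oD T) (oE T) (mh' T) (dneg (mk T)))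
       (oE T) (ml' T)"

definition octahedron_extends ::
  "'k::field poly octahedron \<Rightarrow> 'k poly cplx \<Rightarrow> 'k poly dmor \<Rightarrow> 'k poly cplx \<Rightarrow> 'k poly dmor \<Rightarrow> 'k poly cplx \<Rightarrow> bool" where
  "octahedron_extends T A f B g C \<longleftrightarrow> oA T = A \<and> mf T = f \<and> oB T = B \<and> mg T = g \<and> oC T = C"

definition octahedron_iso :: "'k::field poly octahedron \<Rightarrow> 'k poly octahedron \<Rightarrow> bool" where
  "octahedron_iso S T \<longleftrightarrow> (\<exists>\<phi>A \<phi>B \<phi>C \<phi>D \<phi>E \<phi>F.
     diso (oA S) \<phi>A (oA T) \<and> diso (oB S) \<phi>B (oB T) \<and> diso (oC S) \<phi>C (oC T) \<and>
     diso (oD S) \<phi>D (oD T) \<and> diso (oE S) \<phi>E (oE T) \<and> diso (oF S) \<phi>F (oF T) \<and>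
     mf T \<cdot> \<phi>A = \<phi>B \<cdot> mf S \<and> mf' T \<cdot> \<phi>B = \<phi>D \<cdot> mf' S \<and> mf'' T \<cdot> \<phi>D = \<phi>A\<langle>1\<rangle> \<cdot> mf'' S \<and>
     mg T \<cdot> \<phi>B = \<phi>C \<cdot> mg S \<and> mg' T \<cdot> \<phi>C = \<phi>F \<cdot> mg' S \<and> mg'' T \<cdot> \<phi>F = \<phi>B\<langle>1\<rangle> \<cdot> mg'' S \<and>
     mh T \<cdot> \<phi>A = \<phi>C \<cdot> mh S \<and> mh' T \<cdot> \<phi>C = \<phi>E \<cdot> mh' S \<and> mh'' T \<cdot> \<phi>E = \<phi>A\<langle>1\<rangle> \<cdot> mh'' S \<and>
     mk T \<cdot> \<phi>D = \<phi>E \<cdot> mk S \<and> mk' T \<cdot> \<phi>E = \<phi>F \<cdot> mk' S \<and> mk'' T \<cdot> \<phi>F = \<phi>D\<langle>1\<rangle> \<cdot> mk'' S \<and>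
     ml T \<cdot> \<phi>B = \<phi>E \<cdot> ml S \<and> ml' T \<cdot> \<phi>E = \<phi>B\<langle>1\<rangle> \<cdot> ml' S)"

definition octahedron_of ::
  "'k::field poly cplx \<Rightarrow> 'k poly dmor \<Rightarrow> 'k poly cplx \<Rightarrow> 'k poly dmor \<Rightarrow> 'k poly cplx \<Rightarrow> 'k poly cplx \<Rightarrow> 'k poly cplx \<Rightarrow> 'k poly cplx \<Rightarrow>
   'k poly dmor \<Rightarrow> 'k poly dmor \<Rightarrow> 'k poly dmor \<Rightarrow> 'k poly dmor \<Rightarrow> 'k poly dmor \<Rightarrow> 'k poly dmor \<Rightarrow> 'k poly octahedron" where
  "octahedron_of A f B g C D E F f' h' g'' h'' k k' =
     \<lparr>oA = A, oB = B, oC = C, oD = D, oE = E, oF = F,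
      mf = f, mf' = f', mf'' = h'' \<cdot> k,
      mg = g, mg' = k' \<cdot> h', mg'' = g'',
      mh = g \<cdot> f, mh' = h', mh'' = h'',
      mk = k, mk' = k', mk'' = f'\<langle>1\<rangle> \<cdot> g'',
      ml = h' \<cdot> g, ml' = f\<langle>1\<rangle> \<cdot> h''\<rparr>"


section \<open>The morphisms $x^i : R_m \to R_n$ and $y : R_m \to R_n[1]$\<close>

definition Rn :: "nat \<Rightarrow> 'k::field poly cplx" where
  "Rn n = stalk (Rmod n)"

definition xmor :: "nat \<Rightarrow> nat \<Rightarrow> nat \<Rightarrow> 'k::field poly dmor" where
  "xmor m n i = dmap (Rn m) (stalk_map (Rmap n i)) (Rn n)"

text \<open>
  The short exact sequence $0 \to R_n \xrightarrow{x^m} R_{n+m} \xrightarrow{x^0} R_m \to 0$ gives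
  a quasi-isomorphism $(0\ x^0)$ from the cone of $x^m$ to $R_m$, and its class is the
  roof $R_m \leftarrow C(x^m) \to R_n[1]$.  Here the second leg is the projection of the cone,
  without a sign, so $R_n \to R_{n+m} \to R_m \to R_n[1]$ is distinguished.
\<close>

definition ymor :: "nat \<Rightarrow> nat \<Rightarrow> 'k::field poly dmor" where
  "ymor m n = (let u = stalk_map (Rmap (n + m) m); v = stalk_map (Rmap m 0) in
     cone_out (Rn n) u (Rn (n + m)) \<cdot>
     dclass (Inv (cone (Rn n) u (Rn (n + m))) (\<lambda>i w. v i (psnd w)) (Rn m)))"

end

theory Submission
  imports Defs
begin

text \<open>
  All objects that occur have resolutions by bounded complexes of free modules with chosen bases,
  built from $k[x] \xrightarrow{x^n} k[x]$.  Homotopy classes of chain maps out of such a complex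
  form a functor on the derived category, because they lift along quasi-isomorphisms, uniquely up
  to homotopy.  Hence the morphisms between the objects in question are matrices over $k[x]$ modulo
  homotopy, and every identity and every distinguished triangle becomes an explicit matrix
  computation.  Both octahedra belong to the family in which the entries $y$ of $\tilde k$ and
  $\tilde k'$ are multiplied by a scalar $e$; an isomorphism between them would force an
  automorphism of $D$ to be divisible by $x$ on its summand $R_1$.
\<close>

section \<open>Modules and complexes\<close>

text \<open>The obstacle is that a morphism is a class of formal words modulo a least congruence:
  such a presentation yields equalities but no inequality. The functor on homotopy classes is the
  invariant that separates morphisms, and through it an assumed isomorphism of octahedra becomes a
  set of congruences between polynomials. Every object here is a sum of shifts of modules R_n, so
  homotopical projectivity is only established for two-term complexes of rank one modules, their
  shifts and their sums. The given entries have a source: in the cone of x^i on R_3, with basis e0,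
  e1, e2, e3 in degrees -1, -2, 0, -1, the cocycles of degree -1 are generated by e3 - x^(3-i) e0.
  Taking this element as a basis vector splits the cone into R_i[1] and R_i, whence the entries -x^2
  of g'' and -x^1 of h''. The scalar e does no harm to the faces because each composite of the new
  entry e y with f', h', g'' or h'' is a multiple of x with R_1 at one end, or of x^2 with R_2 at
  one end, hence null-homotopic.\<close>

lemma kx_simps [simp]:
  "carrier kx = UNIV" "a \<otimes>\<^bsub>kx\<^esub> b = a * b" "a \<oplus>\<^bsub>kx\<^esub> b = a + b" "\<one>\<^bsub>kx\<^esub> = 1" "\<zero>\<^bsub>kx\<^esub> = 0"
  by (simp_all add: kx_def)

lemma cring_kx: "cring (kx :: 'k::field poly ring)"
proof (rule cringI)
  show "abelian_group (kx :: 'k poly ring)"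
  proof (rule abelian_groupI)
    fix x :: "'k poly" assume "x \<in> carrier kx"
    show "\<exists>y\<in>carrier kx. y \<oplus>\<^bsub>kx\<^esub> x = \<zero>\<^bsub>kx\<^esub>"
      by (rule bexI[of _ "-x"]) simp_all
  qed (simp_all add: algebra_simps)
  show "comm_monoid (kx :: 'k poly ring)"
    by (rule comm_monoidI) (simp_all add: algebra_simps)
qed (simp_all add: algebra_simps)

lemma a_inv_kx [simp]: "\<ominus>\<^bsub>kx\<^esub> a = - a"
proof -
  interpret cring kx by (rule cring_kx)
  show ?thesis by (rule minus_equality) simp_all
qed

section \<open>Arithmetic of linear combinations in a module\<close>

named_theorems km "normal form of linear combinations in a module"

context
  fixes M :: "'k::field poly rmod"
  assumes M: "module kx M"
begin

interpretation A: module kx M by (rule M)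

lemma mod_closed [simp]:
  "\<zero>\<^bsub>M\<^esub> \<in> carrier M"
  "a \<in> carrier M \<Longrightarrow> b \<in> carrier M \<Longrightarrow> a \<oplus>\<^bsub>M\<^esub> b \<in> carrier M"
  "a \<in> carrier M \<Longrightarrow> \<ominus>\<^bsub>M\<^esub> a \<in> carrier M"
  "a \<in> carrier M \<Longrightarrow> p \<odot>\<^bsub>M\<^esub> a \<in> carrier M"
  by simp_all

lemma mod_simps [simp]:
  "a \<in> carrier M \<Longrightarrow> \<zero>\<^bsub>M\<^esub> \<oplus>\<^bsub>M\<^esub> a = a"
  "a \<in> carrier M \<Longrightarrow> a \<oplus>\<^bsub>M\<^esub> \<zero>\<^bsub>M\<^esub> = a"
  "\<ominus>\<^bsub>M\<^esub> \<zero>\<^bsub>M\<^esub> = \<zero>\<^bsub>M\<^esub>"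
  "a \<in> carrier M \<Longrightarrow> \<ominus>\<^bsub>M\<^esub> (\<ominus>\<^bsub>M\<^esub> a) = a"
  "a \<in> carrier M \<Longrightarrow> a \<oplus>\<^bsub>M\<^esub> \<ominus>\<^bsub>M\<^esub> a = \<zero>\<^bsub>M\<^esub>"
  "a \<in> carrier M \<Longrightarrow> \<ominus>\<^bsub>M\<^esub> a \<oplus>\<^bsub>M\<^esub> a = \<zero>\<^bsub>M\<^esub>"
  "a \<in> carrier M \<Longrightarrow> 0 \<odot>\<^bsub>M\<^esub> a = \<zero>\<^bsub>M\<^esub>"
  "a \<in> carrier M \<Longrightarrow> 1 \<odot>\<^bsub>M\<^esub> a = a"
  "p \<odot>\<^bsub>M\<^esub> \<zero>\<^bsub>M\<^esub> = \<zero>\<^bsub>M\<^esub>"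
  using A.smult_l_null A.smult_one by (auto simp: A.r_neg A.l_neg)

lemma mod_ac [km]:
  "a \<in> carrier M \<Longrightarrow> b \<in> carrier M \<Longrightarrow> c \<in> carrier M \<Longrightarrow> (a \<oplus>\<^bsub>M\<^esub> b) \<oplus>\<^bsub>M\<^esub> c = a \<oplus>\<^bsub>M\<^esub> (b \<oplus>\<^bsub>M\<^esub> c)"
  "a \<in> carrier M \<Longrightarrow> b \<in> carrier M \<Longrightarrow> a \<oplus>\<^bsub>M\<^esub> b = b \<oplus>\<^bsub>M\<^esub> a"
  "a \<in> carrier M \<Longrightarrow> b \<in> carrier M \<Longrightarrow> c \<in> carrier M \<Longrightarrow> a \<oplus>\<^bsub>M\<^esub> (b \<oplus>\<^bsub>M\<^esub> c) = b \<oplus>\<^bsub>M\<^esub> (a \<oplus>\<^bsub>M\<^esub> c)"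
  "a \<in> carrier M \<Longrightarrow> b \<in> carrier M \<Longrightarrow> a \<oplus>\<^bsub>M\<^esub> (\<ominus>\<^bsub>M\<^esub> a \<oplus>\<^bsub>M\<^esub> b) = b"
  "a \<in> carrier M \<Longrightarrow> b \<in> carrier M \<Longrightarrow> \<ominus>\<^bsub>M\<^esub> a \<oplus>\<^bsub>M\<^esub> (a \<oplus>\<^bsub>M\<^esub> b) = b"
  "a \<in> carrier M \<Longrightarrow> b \<in> carrier M \<Longrightarrow> \<ominus>\<^bsub>M\<^esub> (a \<oplus>\<^bsub>M\<^esub> b) = \<ominus>\<^bsub>M\<^esub> a \<oplus>\<^bsub>M\<^esub> \<ominus>\<^bsub>M\<^esub> b"
  using A.r_neg1 A.r_neg2 by (simp_all add: A.a_assoc A.a_comm A.a_lcomm A.minus_add)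

text \<open>Ordered rewriting with associativity and commutativity can leave a summand and its
  negative separated by one other term; these equations cancel such pairs.\<close>

lemma mod_cancel_km [km]:
  "a \<in> carrier M \<Longrightarrow> b \<in> carrier M \<Longrightarrow> a \<oplus>\<^bsub>M\<^esub> (b \<oplus>\<^bsub>M\<^esub> \<ominus>\<^bsub>M\<^esub> a) = b"
  "a \<in> carrier M \<Longrightarrow> b \<in> carrier M \<Longrightarrow> \<ominus>\<^bsub>M\<^esub> a \<oplus>\<^bsub>M\<^esub> (b \<oplus>\<^bsub>M\<^esub> a) = b"
  "a \<in> carrier M \<Longrightarrow> b \<in> carrier M \<Longrightarrow> c \<in> carrier M \<Longrightarrow>
     a \<oplus>\<^bsub>M\<^esub> (b \<oplus>\<^bsub>M\<^esub> (\<ominus>\<^bsub>M\<^esub> a \<oplus>\<^bsub>M\<^esub> c)) = b \<oplus>\<^bsub>M\<^esub> c"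
  "a \<in> carrier M \<Longrightarrow> b \<in> carrier M \<Longrightarrow> c \<in> carrier M \<Longrightarrow>
     \<ominus>\<^bsub>M\<^esub> a \<oplus>\<^bsub>M\<^esub> (b \<oplus>\<^bsub>M\<^esub> (a \<oplus>\<^bsub>M\<^esub> c)) = b \<oplus>\<^bsub>M\<^esub> c"
  by (metis mod_closed(2,3) mod_ac(2-5))+

lemma mod_smult [km]:
  "a \<in> carrier M \<Longrightarrow> b \<in> carrier M \<Longrightarrow> p \<odot>\<^bsub>M\<^esub> (a \<oplus>\<^bsub>M\<^esub> b) = p \<odot>\<^bsub>M\<^esub> a \<oplus>\<^bsub>M\<^esub> p \<odot>\<^bsub>M\<^esub> b"
  "a \<in> carrier M \<Longrightarrow> p \<odot>\<^bsub>M\<^esub> (\<ominus>\<^bsub>M\<^esub> a) = \<ominus>\<^bsub>M\<^esub> (p \<odot>\<^bsub>M\<^esub> a)"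
  "a \<in> carrier M \<Longrightarrow> (- p) \<odot>\<^bsub>M\<^esub> a = \<ominus>\<^bsub>M\<^esub> (p \<odot>\<^bsub>M\<^esub> a)"
  "a \<in> carrier M \<Longrightarrow> (p + q) \<odot>\<^bsub>M\<^esub> a = p \<odot>\<^bsub>M\<^esub> a \<oplus>\<^bsub>M\<^esub> q \<odot>\<^bsub>M\<^esub> a"
  "a \<in> carrier M \<Longrightarrow> (p * q) \<odot>\<^bsub>M\<^esub> a = p \<odot>\<^bsub>M\<^esub> (q \<odot>\<^bsub>M\<^esub> a)"
  using A.smult_r_distr A.smult_r_minus A.smult_l_minus[of p] A.smult_l_distr A.smult_assoc1 by auto

lemma mod_a_inv_unique:
  "a \<in> carrier M \<Longrightarrow> b \<in> carrier M \<Longrightarrow> b \<oplus>\<^bsub>M\<^esub> a = \<zero>\<^bsub>M\<^esub> \<Longrightarrow> \<ominus>\<^bsub>M\<^esub> a = b"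
  by (rule A.minus_equality)

end

lemma fg_moduleD: "fg_module M \<Longrightarrow> module kx M"
  by (simp add: fg_module_def)

section \<open>Linear maps\<close>

lemma linear_mapI:
  assumes "\<And>v. v \<in> carrier M \<Longrightarrow> h v \<in> carrier N"
    and "\<And>v w. v \<in> carrier M \<Longrightarrow> w \<in> carrier M \<Longrightarrow> h (v \<oplus>\<^bsub>M\<^esub> w) = h v \<oplus>\<^bsub>N\<^esub> h w"
    and "\<And>p v. v \<in> carrier M \<Longrightarrow> h (p \<odot>\<^bsub>M\<^esub> v) = p \<odot>\<^bsub>N\<^esub> h v"
  shows "linear_map M N h"
  using assms by (auto simp: linear_map_def hom_def)

lemma lin_closed: "linear_map M N h \<Longrightarrow> v \<in> carrier M \<Longrightarrow> h v \<in> carrier N"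
  by (auto simp: linear_map_def hom_def)

lemma lin_add:
  "linear_map M N h \<Longrightarrow> v \<in> carrier M \<Longrightarrow> w \<in> carrier M \<Longrightarrow> h (v \<oplus>\<^bsub>M\<^esub> w) = h v \<oplus>\<^bsub>N\<^esub> h w"
  by (auto simp: linear_map_def hom_def)

lemma lin_smult: "linear_map M N h \<Longrightarrow> v \<in> carrier M \<Longrightarrow> h (p \<odot>\<^bsub>M\<^esub> v) = p \<odot>\<^bsub>N\<^esub> h v"
  by (auto simp: linear_map_def)

lemma lin_zero:
  assumes "linear_map M N h" "module kx M" "module kx N" shows "h \<zero>\<^bsub>M\<^esub> = \<zero>\<^bsub>N\<^esub>"
  using lin_smult[OF assms(1), of "\<zero>\<^bsub>M\<^esub>" 0] lin_closed[OF assms(1)] assms(2,3) by simp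

lemma lin_neg:
  assumes "linear_map M N h" "module kx M" "module kx N" "v \<in> carrier M"
  shows "h (\<ominus>\<^bsub>M\<^esub> v) = \<ominus>\<^bsub>N\<^esub> h v"
  using lin_smult[OF assms(1,4), of "-1"] lin_closed[OF assms(1)] assms(2-4)
  by (simp add: mod_smult)

lemma linear_map_id: "linear_map M M id"
  by (rule linear_mapI) simp_all

lemma linear_map_comp: "linear_map M N h \<Longrightarrow> linear_map N K h' \<Longrightarrow> linear_map M K (h' \<circ> h)"
  by (rule linear_mapI) (simp_all add: lin_closed lin_add lin_smult)

lemma linear_map_zero: "module kx N \<Longrightarrow> linear_map M N (\<lambda>v. \<zero>\<^bsub>N\<^esub>)"
  by (rule linear_mapI) simp_all

lemma linear_map_plus:
  assumes "module kx N" "linear_map M N h" "linear_map M N h'"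
  shows "linear_map M N (\<lambda>v. h v \<oplus>\<^bsub>N\<^esub> h' v)"
  using assms by (intro linear_mapI) (simp_all add: lin_closed lin_add lin_smult km)

lemma linear_map_neg:
  assumes "module kx N" "linear_map M N h"
  shows "linear_map M N (\<lambda>v. \<ominus>\<^bsub>N\<^esub> h v)"
  using assms by (intro linear_mapI) (simp_all add: lin_closed lin_add lin_smult km)

section \<open>Elementwise rules for bounded complexes\<close>

abbreviation el :: "'k::field poly cplx \<Rightarrow> int \<Rightarrow> 'k poly elt set" where
  "el X n \<equiv> carrier (obj X n)"

lemma bc_mod [simp]: "bounded_complex X \<Longrightarrow> module kx (obj X n)"
  by (simp add: bounded_complex_def fg_moduleD)

lemma bc_lin: "bounded_complex X \<Longrightarrow> linear_map (obj X n) (obj X (n + 1)) (diff X n)"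
  by (simp add: bounded_complex_def)

lemma bc_dd: "bounded_complex X \<Longrightarrow> v \<in> el X n \<Longrightarrow>
    diff X (n + 1) (diff X n v) = \<zero>\<^bsub>obj X (n + 1 + 1)\<^esub>"
  by (simp add: bounded_complex_def)

lemma bc_closed [simp]:
  "bounded_complex X \<Longrightarrow> v \<in> el X n \<Longrightarrow> diff X n v \<in> el X (n + 1)"
  by (rule lin_closed[OF bc_lin])

lemma bc_closed' [simp]:
  "bounded_complex X \<Longrightarrow> v \<in> el X n \<Longrightarrow> m = n + 1 \<Longrightarrow> diff X n v \<in> el X m"
  by simp

lemma bc_dd':
  "bounded_complex X \<Longrightarrow> v \<in> el X n \<Longrightarrow> m = n + 1 \<Longrightarrow>
    diff X m (diff X n v) = \<zero>\<^bsub>obj X (m + 1)\<^esub>"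
  using bc_dd by blast

lemma bc_zero [simp]: "bounded_complex X \<Longrightarrow> diff X n \<zero>\<^bsub>obj X n\<^esub> = \<zero>\<^bsub>obj X (n + 1)\<^esub>"
  by (rule lin_zero[OF bc_lin]) simp_all

lemma bc_neg: "bounded_complex X \<Longrightarrow> v \<in> el X n \<Longrightarrow>
    diff X n (\<ominus>\<^bsub>obj X n\<^esub> v) = \<ominus>\<^bsub>obj X (n + 1)\<^esub> diff X n v"
  by (rule lin_neg[OF bc_lin]) simp_all

lemma bc_add: "bounded_complex X \<Longrightarrow> v \<in> el X n \<Longrightarrow> w \<in> el X n \<Longrightarrow>
    diff X n (v \<oplus>\<^bsub>obj X n\<^esub> w) = diff X n v \<oplus>\<^bsub>obj X (n + 1)\<^esub> diff X n w"
  by (rule lin_add[OF bc_lin])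

lemma bc_smult: "bounded_complex X \<Longrightarrow> v \<in> el X n \<Longrightarrow>
    diff X n (p \<odot>\<^bsub>obj X n\<^esub> v) = p \<odot>\<^bsub>obj X (n + 1)\<^esub> diff X n v"
  by (rule lin_smult[OF bc_lin])

text \<open>The cyclic case, which covers the terms of the resolutions and the modules R_n: a
  submodule containing the generator contains all its multiples.\<close>

lemma fg_moduleI:
  assumes M: "module kx M" and g: "g \<in> carrier M" and "\<And>v. v \<in> carrier M \<Longrightarrow> \<exists>p. v = p \<odot>\<^bsub>M\<^esub> g"
  shows "fg_module M"
  unfolding fg_module_def
proof (intro conjI M exI[of _ "{g}"] allI impI)
  interpret A: module kx M by (rule M)
  fix N assume N: "submodule N kx M \<and> {g} \<subseteq> N"
  show "N = carrier M"
    using A.submoduleE(1,4)[of N] N assms(3) by fastforce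
qed (use g in auto)

subsection \<open>Direct sums\<close>

lemma dsum_module_simps [simp]:
  "\<zero>\<^bsub>dsum_module M N\<^esub> = Pr \<zero>\<^bsub>M\<^esub> \<zero>\<^bsub>N\<^esub>"
  "u \<oplus>\<^bsub>dsum_module M N\<^esub> v = Pr (pfst u \<oplus>\<^bsub>M\<^esub> pfst v) (psnd u \<oplus>\<^bsub>N\<^esub> psnd v)"
  "r \<odot>\<^bsub>dsum_module M N\<^esub> u = Pr (r \<odot>\<^bsub>M\<^esub> pfst u) (r \<odot>\<^bsub>N\<^esub> psnd u)"
  by (simp_all add: dsum_module_def)

lemma dsum_carrier:
  "u \<in> carrier (dsum_module M N) \<longleftrightarrow>
     pfst u \<in> carrier M \<and> psnd u \<in> carrier N \<and> u = Pr (pfst u) (psnd u)"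
  by (cases u) (auto simp: dsum_module_def)

lemma Pr_in_dsum [simp]: "Pr a b \<in> carrier (dsum_module M N) \<longleftrightarrow> a \<in> carrier M \<and> b \<in> carrier N"
  by (simp add: dsum_carrier)

lemma dsum_cases:
  assumes "u \<in> carrier (dsum_module M N)"
  obtains a b where "u = Pr a b" "a \<in> carrier M" "b \<in> carrier N"
  using assms dsum_carrier by blast

lemma module_dsum [simp]:
  assumes M: "module kx M" and N: "module kx N"
  shows "module kx (dsum_module M N)"
proof (rule moduleI)
  show "abelian_group (dsum_module M N)"
  proof (rule abelian_groupI)
    fix x assume "x \<in> carrier (dsum_module M N)"
    then show "\<exists>y\<in>carrier (dsum_module M N). y \<oplus>\<^bsub>dsum_module M N\<^esub> x = \<zero>\<^bsub>dsum_module M N\<^esub>"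
      using assms by (intro bexI[of _ "Pr (\<ominus>\<^bsub>M\<^esub> pfst x) (\<ominus>\<^bsub>N\<^esub> psnd x)"]) (auto simp: dsum_carrier)
  qed (use assms in \<open>auto elim!: dsum_cases simp: km\<close>)
qed (use assms in \<open>auto elim!: dsum_cases simp: km cring_kx\<close>)

lemma dsum_neg [simp]:
  assumes M: "module kx M" and N: "module kx N" and u: "u \<in> carrier (dsum_module M N)"
  shows "\<ominus>\<^bsub>dsum_module M N\<^esub> u = Pr (\<ominus>\<^bsub>M\<^esub> pfst u) (\<ominus>\<^bsub>N\<^esub> psnd u)"
  using assms by (intro mod_a_inv_unique) (auto elim!: dsum_cases)

text \<open>Allows a submodule of a direct sum to be tested on each summand separately.\<close>

lemma submodule_preimage:
  assumes M: "module kx M" and N: "module kx N" and h: "linear_map M N h" and K: "submodule K kx N"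
  shows "submodule {a \<in> carrier M. h a \<in> K} kx M"
proof -
  interpret M: module kx M by (rule M)
  interpret N: module kx N by (rule N)
  note KE = N.submoduleE[OF K]
  obtain u where "u \<in> K" using KE(2) by auto
  then have "\<zero>\<^bsub>N\<^esub> \<in> K" using KE(1) KE(4)[of 0 u] N by auto
  then show ?thesis
    using KE(3-5) lin_zero[OF h M N] lin_neg[OF h M N] lin_add[OF h] lin_smult[OF h] M
    by (intro M.submoduleI) auto
qed

text \<open>A submodule containing the generators of both summands has full preimage under each
  inclusion, and every pair is a sum of two elements coming from the summands.\<close>

lemma fg_dsum:
  assumes "fg_module M" and "fg_module N"
  shows "fg_module (dsum_module M N)"
proof -
  have M: "module kx M" and N: "module kx N" using assms by (simp_all add: fg_moduleD)
  obtain S where S: "finite S" "S \<subseteq> carrier M" "\<And>K. submodule K kx M \<Longrightarrow> S \<subseteq> K \<Longrightarrow> K = carrier M"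
    using assms(1) by (auto simp: fg_module_def)
  obtain T where T: "finite T" "T \<subseteq> carrier N" "\<And>K. submodule K kx N \<Longrightarrow> T \<subseteq> K \<Longrightarrow> K = carrier N"
    using assms(2) by (auto simp: fg_module_def)
  let ?D = "dsum_module M N" and ?i = "\<lambda>a. Pr a \<zero>\<^bsub>N\<^esub>" and ?j = "\<lambda>b. Pr \<zero>\<^bsub>M\<^esub> b"
  have D: "module kx ?D" using M N by simp
  have i: "linear_map M ?D ?i" and j: "linear_map N ?D ?j" using M N by (auto intro!: linear_mapI)
  show ?thesis
    unfolding fg_module_def
  proof (intro conjI D exI[of _ "?i ` S \<union> ?j ` T"] allI impI)
    show "finite (?i ` S \<union> ?j ` T)" using S T by simp
    show "?i ` S \<union> ?j ` T \<subseteq> carrier ?D" using S T M N by auto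
    fix K assume K: "submodule K kx ?D \<and> ?i ` S \<union> ?j ` T \<subseteq> K"
    interpret D: module kx ?D by (rule D)
    note KE = D.submoduleE[of K, OF conjunct1[OF K]]
    have "{a \<in> carrier M. ?i a \<in> K} = carrier M"
      using S K by (intro S(3) submodule_preimage[OF M D i]) auto
    moreover have "{b \<in> carrier N. ?j b \<in> K} = carrier N"
      using T K by (intro T(3) submodule_preimage[OF N D j]) auto
    ultimately have "Pr a b \<in> K" if "a \<in> carrier M" "b \<in> carrier N" for a b
      using KE(5)[of "?i a" "?j b"] that M N by auto
    then show "K = carrier ?D" using KE(1) by (auto elim!: dsum_cases)
  qed
qed

subsection \<open>Shifts, direct sums and cones of complexes\<close>

lemma shift_simps [simp]:
  "obj (shift X) n = obj X (n + 1)"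
  "diff (shift X) n v = \<ominus>\<^bsub>obj X (n + 1 + 1)\<^esub> diff X (n + 1) v"
  by (simp_all add: shift_def)

lemma dsum_simps [simp]:
  "obj (dsum X Y) n = dsum_module (obj X n) (obj Y n)"
  "diff (dsum X Y) n v = Pr (diff X n (pfst v)) (diff Y n (psnd v))"
  by (simp_all add: dsum_def)

lemma cone_simps [simp]:
  "obj (cone X u Y) n = dsum_module (obj X (n + 1)) (obj Y n)"
  "diff (cone X u Y) n v = Pr (\<ominus>\<^bsub>obj X (n + 1 + 1)\<^esub> diff X (n + 1) (pfst v))
                      (u (n + 1) (pfst v) \<oplus>\<^bsub>obj Y (n + 1)\<^esub> diff Y n (psnd v))"
  by (simp_all add: cone_def)

lemma bc_bounded:
  assumes "bounded_complex X"
  obtains N where "N \<ge> 0" "\<And>n. \<bar>n\<bar> > N \<Longrightarrow> el X n = {\<zero>\<^bsub>obj X n\<^esub>}"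
proof -
  obtain N where "\<forall>n. \<bar>n\<bar> > N \<longrightarrow> el X n = {\<zero>\<^bsub>obj X n\<^esub>}"
    using assms by (auto simp: bounded_complex_def)
  then show ?thesis by (intro that[of "max N 0"]) auto
qed

lemma bounded_complexI:
  assumes "\<And>n. fg_module (obj X n)"
    and "\<And>n. linear_map (obj X n) (obj X (n + 1)) (diff X n)"
    and "\<And>n v. v \<in> el X n \<Longrightarrow> diff X (n + 1) (diff X n v) = \<zero>\<^bsub>obj X (n + 1 + 1)\<^esub>"
    and "\<And>n. \<bar>n\<bar> > N \<Longrightarrow> el X n = {\<zero>\<^bsub>obj X n\<^esub>}"
  shows "bounded_complex X"
  using assms unfolding bounded_complex_def by blast

lemma bc_fg: "bounded_complex X \<Longrightarrow> fg_module (obj X n)"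
  by (simp add: bounded_complex_def)

lemma bc_shift [simp]: "bounded_complex X \<Longrightarrow> bounded_complex (shift X)"
proof -
  assume X: "bounded_complex X"
  obtain N where N: "N \<ge> 0" "\<And>n. \<bar>n\<bar> > N \<Longrightarrow> el X n = {\<zero>\<^bsub>obj X n\<^esub>}"
    using bc_bounded[OF X] by blast
  show ?thesis
  \<comment> \<open>Degree n of the shift is degree n + 1 of X, so the range of nonzero degrees
    moves by one.\<close>
  proof (rule bounded_complexI[where N = "N + 1"])
    show "linear_map (obj (shift X) n) (obj (shift X) (n + 1)) (diff (shift X) n)" for n
      using X bc_lin[OF X, of "n + 1"] by (simp add: linear_map_neg shift_def)
    show "diff (shift X) (n + 1) (diff (shift X) n v) = \<zero>\<^bsub>obj (shift X) (n + 1 + 1)\<^esub>"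
      if "v \<in> el (shift X) n" for n v
      using X that by (simp add: bc_dd' bc_neg)
    show "el (shift X) n = {\<zero>\<^bsub>obj (shift X) n\<^esub>}" if "\<bar>n\<bar> > N + 1" for n
      using N(2)[of "n + 1"] that by auto
  qed (use X in \<open>simp add: bc_fg\<close>)
qed

lemma linear_map_dsum:
  assumes "linear_map M K f" "linear_map N L g"
  shows "linear_map (dsum_module M N) (dsum_module K L) (\<lambda>v. Pr (f (pfst v)) (g (psnd v)))"
  using assms by (intro linear_mapI) (auto elim!: dsum_cases simp: lin_closed lin_add lin_smult)

lemma linear_map_row:
  assumes "module kx K" "linear_map M K f" "linear_map N K g"
  shows "linear_map (dsum_module M N) K (\<lambda>v. f (pfst v) \<oplus>\<^bsub>K\<^esub> g (psnd v))"
  using assms by (intro linear_mapI) (auto elim!: dsum_cases simp: lin_closed lin_add lin_smult km)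

lemma linear_map_col:
  assumes "linear_map M K f" "linear_map M L g"
  shows "linear_map M (dsum_module K L) (\<lambda>v. Pr (f v) (g v))"
  using assms by (intro linear_mapI) (auto simp: lin_closed lin_add lin_smult)

lemma linear_map_pfst: "linear_map (dsum_module M N) M pfst"
  by (intro linear_mapI) (auto elim!: dsum_cases)

lemma linear_map_psnd: "linear_map (dsum_module M N) N psnd"
  by (intro linear_mapI) (auto elim!: dsum_cases)

lemma dsum_zero_carrier:
  "carrier M = {\<zero>\<^bsub>M\<^esub>} \<Longrightarrow> carrier N = {\<zero>\<^bsub>N\<^esub>} \<Longrightarrow>
    carrier (dsum_module M N) = {\<zero>\<^bsub>dsum_module M N\<^esub>}"
  by (auto elim!: dsum_cases)

lemma bc_dsum [simp]:
  assumes X: "bounded_complex X" and Y: "bounded_complex Y"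
  shows "bounded_complex (dsum X Y)"
proof -
  obtain N where N: "N \<ge> 0" "\<And>n. \<bar>n\<bar> > N \<Longrightarrow> el X n = {\<zero>\<^bsub>obj X n\<^esub>}"
    using bc_bounded[OF X] by blast
  obtain N' where N': "N' \<ge> 0" "\<And>n. \<bar>n\<bar> > N' \<Longrightarrow> el Y n = {\<zero>\<^bsub>obj Y n\<^esub>}"
    using bc_bounded[OF Y] by blast
  show ?thesis
  proof (rule bounded_complexI[where N = "N + N'"])
    show "linear_map (obj (dsum X Y) n) (obj (dsum X Y) (n + 1)) (diff (dsum X Y) n)" for n
      using linear_map_dsum[OF bc_lin[OF X, of n] bc_lin[OF Y, of n]] by (simp add: dsum_def)
    show "el (dsum X Y) n = {\<zero>\<^bsub>obj (dsum X Y) n\<^esub>}" if "\<bar>n\<bar> > N + N'" for n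
      unfolding dsum_simps using that N N' by (intro dsum_zero_carrier) auto
  qed (use X Y in \<open>auto simp: bc_fg fg_dsum bc_dd elim!: dsum_cases\<close>)
qed

lemma chain_mapD:
  assumes "chain_map X f Y"
  shows "bounded_complex X" "bounded_complex Y" "linear_map (obj X n) (obj Y n) (f n)"
    "v \<in> el X n \<Longrightarrow> diff Y n (f n v) = f (n + 1) (diff X n v)"
    "v \<in> el X n \<Longrightarrow> f n v \<in> el Y n"
    "v \<in> el X n \<Longrightarrow> w \<in> el X n \<Longrightarrow>
       f n (v \<oplus>\<^bsub>obj X n\<^esub> w) = f n v \<oplus>\<^bsub>obj Y n\<^esub> f n w"
    "v \<in> el X n \<Longrightarrow> f n (p \<odot>\<^bsub>obj X n\<^esub> v) = p \<odot>\<^bsub>obj Y n\<^esub> f n v"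
    "f n \<zero>\<^bsub>obj X n\<^esub> = \<zero>\<^bsub>obj Y n\<^esub>"
    "v \<in> el X n \<Longrightarrow> f n (\<ominus>\<^bsub>obj X n\<^esub> v) = \<ominus>\<^bsub>obj Y n\<^esub> f n v"
  using assms lin_closed[of "obj X n" "obj Y n" "f n"] lin_add[of "obj X n" "obj Y n" "f n"]
    lin_smult[of "obj X n" "obj Y n" "f n"] lin_zero[of "obj X n" "obj Y n" "f n"]
    lin_neg[of "obj X n" "obj Y n" "f n"]
  unfolding chain_map_def by auto

lemma chain_mapI:
  assumes "bounded_complex X" "bounded_complex Y" "\<And>n. linear_map (obj X n) (obj Y n) (f n)"
    and "\<And>n v. v \<in> el X n \<Longrightarrow> diff Y n (f n v) = f (n + 1) (diff X n v)"
  shows "chain_map X f Y"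
  using assms by (simp add: chain_map_def)

lemma bc_cone [simp]:
  assumes u: "chain_map X u Y"
  shows "bounded_complex (cone X u Y)"
proof -
  note D = chain_mapD[OF u]
  obtain N where N: "N \<ge> 0" "\<And>n. \<bar>n\<bar> > N \<Longrightarrow> el X n = {\<zero>\<^bsub>obj X n\<^esub>}"
    using bc_bounded[OF D(1)] by blast
  obtain N' where N': "N' \<ge> 0" "\<And>n. \<bar>n\<bar> > N' \<Longrightarrow> el Y n = {\<zero>\<^bsub>obj Y n\<^esub>}"
    using bc_bounded[OF D(2)] by blast
  show ?thesis
  proof (rule bounded_complexI[where N = "N + N' + 1"])
    fix n
    have l1: "linear_map (obj X (n+1)) (obj X (n + 1 + 1)) (\<lambda>v. \<ominus>\<^bsub>obj X (n + 1 + 1)\<^esub> diff X (n + 1) v)"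
      using D bc_lin[OF D(1), of "n + 1"] by (simp add: linear_map_neg del: add.assoc)
    have l2: "linear_map (dsum_module (obj X (n+1)) (obj Y n)) (obj Y (n+1))
        (\<lambda>v. u (n + 1) (pfst v) \<oplus>\<^bsub>obj Y (n + 1)\<^esub> diff Y n (psnd v))"
      using D(2) D(3)[of "n + 1"] bc_lin[OF D(2), of n] by (intro linear_map_row) auto
    show "linear_map (obj (cone X u Y) n) (obj (cone X u Y) (n + 1)) (diff (cone X u Y) n)"
      using linear_map_col[OF linear_map_comp[OF linear_map_pfst l1] l2]
      by (simp add: cone_def comp_def)
    \<comment> \<open>The sign of the differential on the part coming from X makes the two mixed
      terms cancel.\<close>
    show "diff (cone X u Y) (n + 1) (diff (cone X u Y) n v) = \<zero>\<^bsub>obj (cone X u Y) (n + 1 + 1)\<^esub>"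
      if "v \<in> el (cone X u Y) n" for v
      using that D(1,2) D(5)[of _ "n+1"] D(5)[of _ "n+1+1"] D(9)[of _ "n+1+1"] D(4)[of _ "n+1"]
      by (auto elim!: dsum_cases simp: bc_dd' bc_neg bc_add km)
    show "el (cone X u Y) n = {\<zero>\<^bsub>obj (cone X u Y) n\<^esub>}" if "\<bar>n\<bar> > N + N' + 1"
      unfolding cone_simps using that N(1) N(2)[of "n+1"] N' by (intro dsum_zero_carrier) auto
  qed (use D in \<open>auto simp: bc_fg fg_dsum\<close>)
qed

subsection \<open>Chain maps, homotopies and quasi-isomorphisms\<close>

lemma chain_map_id [simp]: "bounded_complex X \<Longrightarrow> chain_map X (\<lambda>n. id) X"
  by (rule chain_mapI) (simp_all add: linear_map_id)

lemma chain_map_comp: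
  assumes "chain_map X f Y" "chain_map Y g Z" shows "chain_map X (\<lambda>n. g n \<circ> f n) Z"
  using assms
  by (intro chain_mapI) (simp_all add: chain_mapD[OF assms(1)] chain_mapD[OF assms(2)]
      linear_map_comp[OF chain_mapD(3)[OF assms(1)] chain_mapD(3)[OF assms(2)]])

lemma chain_map_zero: "bounded_complex X \<Longrightarrow> bounded_complex Y \<Longrightarrow> chain_map X (\<lambda>n v. \<zero>\<^bsub>obj Y n\<^esub>) Y"
  by (rule chain_mapI) (simp_all add: linear_map_zero)

lemma chain_map_neg: "bounded_complex X \<Longrightarrow> chain_map X (\<lambda>n v. \<ominus>\<^bsub>obj X n\<^esub> v) X"
  using linear_map_neg[OF _ linear_map_id, of "obj X _"]
  by (intro chain_mapI) (simp_all add: bc_neg)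

text \<open>Homotopies and coboundaries involve differentials arriving in degree n, where n - 1 + 1
  is not syntactically n. This rule and the next are the forms indexed by the target.\<close>

lemma chain_pred:
  "chain_map X f Y \<Longrightarrow> v \<in> el X (n - 1) \<Longrightarrow>
    f n (diff X (n - 1) v) = diff Y (n - 1) (f (n - 1) v)"
  using chain_mapD(4)[of X f Y v "n - 1"] by simp

lemma bc_pred_lin:
  assumes "bounded_complex X" "v \<in> el X (n - 1)"
  shows "diff X (n - 1) (\<ominus>\<^bsub>obj X (n - 1)\<^esub> v) = \<ominus>\<^bsub>obj X n\<^esub> diff X (n - 1) v"
    "w \<in> el X (n - 1) \<Longrightarrow> diff X (n - 1) (v \<oplus>\<^bsub>obj X (n - 1)\<^esub> w) = diff X (n - 1) v \<oplus>\<^bsub>obj X n\<^esub> diff X (n - 1) w"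
    "diff X (n - 1) (p \<odot>\<^bsub>obj X (n - 1)\<^esub> v) = p \<odot>\<^bsub>obj X n\<^esub> diff X (n - 1) v"
    "diff X (n - 1) \<zero>\<^bsub>obj X (n - 1)\<^esub> = \<zero>\<^bsub>obj X n\<^esub>"
  using bc_neg[OF assms] bc_add[OF assms] bc_smult[OF assms] bc_zero[OF assms(1), of "n - 1"] by simp_all

definition homotopy :: "'k::field poly cplx \<Rightarrow> 'k poly cplx \<Rightarrow> 'k poly gmap \<Rightarrow> bool" where
  "homotopy X Y s \<longleftrightarrow> (\<forall>n. linear_map (obj X n) (obj Y (n - 1)) (s n))"

lemma homotopyD:
  assumes "homotopy X Y s"
  shows "linear_map (obj X n) (obj Y (n - 1)) (s n)"
    "v \<in> el X n \<Longrightarrow> s n v \<in> el Y (n - 1)"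
    "v \<in> el X (n + 1) \<Longrightarrow> s (n + 1) v \<in> el Y n"
    "bounded_complex X \<Longrightarrow> bounded_complex Y \<Longrightarrow> v \<in> el X n \<Longrightarrow>
       s n (\<ominus>\<^bsub>obj X n\<^esub> v) = \<ominus>\<^bsub>obj Y (n - 1)\<^esub> s n v"
    "v \<in> el X n \<Longrightarrow> w \<in> el X n \<Longrightarrow>
       s n (v \<oplus>\<^bsub>obj X n\<^esub> w) = s n v \<oplus>\<^bsub>obj Y (n - 1)\<^esub> s n w"
    "v \<in> el X n \<Longrightarrow> s n (p \<odot>\<^bsub>obj X n\<^esub> v) = p \<odot>\<^bsub>obj Y (n - 1)\<^esub> s n v"
  using assms lin_closed[of "obj X n" "obj Y (n - 1)" "s n"] lin_closed[of "obj X (n + 1)" "obj Y n" "s (n + 1)"]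
    lin_neg[of "obj X n" "obj Y (n - 1)" "s n"] lin_add[of "obj X n" "obj Y (n - 1)" "s n"]
    lin_smult[of "obj X n" "obj Y (n - 1)" "s n"]
  unfolding homotopy_def by (auto dest: spec[of _ "n + 1"])

lemma homotopic_iff: "homotopic X Y f g \<longleftrightarrow> (\<exists>s. homotopy X Y s \<and>
     (\<forall>n. \<forall>v \<in> el X n.
        f n v = g n v \<oplus>\<^bsub>obj Y n\<^esub> (diff Y (n - 1) (s n v) \<oplus>\<^bsub>obj Y n\<^esub> s (n + 1) (diff X n v))))"
  by (simp add: homotopic_def homotopy_def)

lemma homotopicI:
  "homotopy X Y s \<Longrightarrow> (\<And>n v. v \<in> el X n \<Longrightarrow>
        f n v = g n v \<oplus>\<^bsub>obj Y n\<^esub> (diff Y (n - 1) (s n v) \<oplus>\<^bsub>obj Y n\<^esub> s (n + 1) (diff X n v))) \<Longrightarrow>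
   homotopic X Y f g"
  unfolding homotopic_iff by blast

lemma homotopicE:
  assumes "homotopic X Y f g"
  obtains s where "homotopy X Y s" "\<And>n v. v \<in> el X n \<Longrightarrow>
        f n v = g n v \<oplus>\<^bsub>obj Y n\<^esub> (diff Y (n - 1) (s n v) \<oplus>\<^bsub>obj Y n\<^esub> s (n + 1) (diff X n v))"
  using assms unfolding homotopic_iff by blast

text \<open>Chain maps are total functions with arbitrary values outside the carriers, so maps that
  agree mathematically can differ as functions. The zero homotopy identifies them in the derived
  category.\<close>

lemma homotopic_eq:
  assumes "chain_map X f Y" and eq: "\<And>n v. v \<in> el X n \<Longrightarrow> f n v = g n v"
  shows "homotopic X Y f g"
proof (rule homotopicI[where s = "\<lambda>n v. \<zero>\<^bsub>obj Y (n - 1)\<^esub>"])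
  note D = chain_mapD[OF assms(1)]
  show "homotopy X Y (\<lambda>n v. \<zero>\<^bsub>obj Y (n - 1)\<^esub>)"
    using D by (simp add: homotopy_def linear_map_zero)
  show "f n v = g n v \<oplus>\<^bsub>obj Y n\<^esub> (diff Y (n - 1) \<zero>\<^bsub>obj Y (n - 1)\<^esub> \<oplus>\<^bsub>obj Y n\<^esub> \<zero>\<^bsub>obj Y (n + 1 - 1)\<^esub>)"
    if "v \<in> el X n" for n v
    using D(2) D(5)[OF that] eq[OF that] bc_zero[OF D(2), of "n - 1"] by simp
qed

lemma homotopic_refl: "chain_map X f Y \<Longrightarrow> homotopic X Y f f"
  by (rule homotopic_eq) auto

lemma homotopic_sym:
  assumes f: "chain_map X f Y" and g: "chain_map X g Y" and "homotopic X Y f g"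
  shows "homotopic X Y g f"
proof -
  note F = chain_mapD[OF f] and G = chain_mapD[OF g]
  obtain s where s: "homotopy X Y s" and e: "\<And>n v. v \<in> el X n \<Longrightarrow>
        f n v = g n v \<oplus>\<^bsub>obj Y n\<^esub> (diff Y (n - 1) (s n v) \<oplus>\<^bsub>obj Y n\<^esub> s (n + 1) (diff X n v))"
    using homotopicE[OF assms(3)] by blast
  show ?thesis
  proof (rule homotopicI[where s = "\<lambda>n v. \<ominus>\<^bsub>obj Y (n - 1)\<^esub> s n v"])
    show "homotopy X Y (\<lambda>n v. \<ominus>\<^bsub>obj Y (n - 1)\<^esub> s n v)"
      using homotopyD(1)[OF s] F by (simp add: homotopy_def linear_map_neg)
    show "g n v = f n v \<oplus>\<^bsub>obj Y n\<^esub> (diff Y (n - 1) (\<ominus>\<^bsub>obj Y (n - 1)\<^esub> s n v) \<oplus>\<^bsub>obj Y n\<^esub> \<ominus>\<^bsub>obj Y (n + 1 - 1)\<^esub> s (n + 1) (diff X n v))"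
      if "v \<in> el X n" for n v
      using F(1,2) G(5) that e[OF that] homotopyD(2,3)[OF s] by (simp add: bc_pred_lin km)
  qed
qed

lemma homotopic_trans:
  assumes f: "chain_map X f Y" and g: "chain_map X g Y" and h: "chain_map X h Y"
    and "homotopic X Y f g" "homotopic X Y g h"
  shows "homotopic X Y f h"
proof -
  note F = chain_mapD[OF f] and G = chain_mapD[OF g] and H = chain_mapD[OF h]
  obtain s where s: "homotopy X Y s" and e: "\<And>n v. v \<in> el X n \<Longrightarrow>
        f n v = g n v \<oplus>\<^bsub>obj Y n\<^esub> (diff Y (n - 1) (s n v) \<oplus>\<^bsub>obj Y n\<^esub> s (n + 1) (diff X n v))"
    using homotopicE[OF assms(4)] by blast
  obtain t where t: "homotopy X Y t" and e': "\<And>n v. v \<in> el X n \<Longrightarrow>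
        g n v = h n v \<oplus>\<^bsub>obj Y n\<^esub> (diff Y (n - 1) (t n v) \<oplus>\<^bsub>obj Y n\<^esub> t (n + 1) (diff X n v))"
    using homotopicE[OF assms(5)] by blast
  show ?thesis
  proof (rule homotopicI[where s = "\<lambda>n v. s n v \<oplus>\<^bsub>obj Y (n - 1)\<^esub> t n v"])
    show "homotopy X Y (\<lambda>n v. s n v \<oplus>\<^bsub>obj Y (n - 1)\<^esub> t n v)"
      using homotopyD(1)[OF s] homotopyD(1)[OF t] F by (simp add: homotopy_def linear_map_plus)
    show "f n v = h n v \<oplus>\<^bsub>obj Y n\<^esub> (diff Y (n - 1) (s n v \<oplus>\<^bsub>obj Y (n - 1)\<^esub> t n v) \<oplus>\<^bsub>obj Y n\<^esub>
        (s (n + 1) (diff X n v) \<oplus>\<^bsub>obj Y (n + 1 - 1)\<^esub> t (n + 1) (diff X n v)))"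
      if "v \<in> el X n" for n v
      using F(1,2) H(5) that e[OF that] e'[OF that] homotopyD(2,3)[OF s] homotopyD(2,3)[OF t]
      by (simp add: bc_pred_lin km)
  qed
qed

lemma homotopic_comp_left:
  assumes f: "chain_map X f Y" and g: "chain_map X g Y" and h: "chain_map Y h Z"
    and "homotopic X Y f g"
  shows "homotopic X Z (\<lambda>n. h n \<circ> f n) (\<lambda>n. h n \<circ> g n)"
proof -
  note F = chain_mapD[OF f] and G = chain_mapD[OF g] and H = chain_mapD[OF h]
  obtain s where s: "homotopy X Y s" and e: "\<And>n v. v \<in> el X n \<Longrightarrow>
        f n v = g n v \<oplus>\<^bsub>obj Y n\<^esub> (diff Y (n - 1) (s n v) \<oplus>\<^bsub>obj Y n\<^esub> s (n + 1) (diff X n v))"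
    using homotopicE[OF assms(4)] by blast
  show ?thesis
  proof (rule homotopicI[where s = "\<lambda>n. h (n - 1) \<circ> s n"])
    show "homotopy X Z (\<lambda>n. h (n - 1) \<circ> s n)"
      using linear_map_comp[OF homotopyD(1)[OF s] H(3)] by (simp add: homotopy_def)
    show "(h n \<circ> f n) v = (h n \<circ> g n) v \<oplus>\<^bsub>obj Z n\<^esub> (diff Z (n - 1) ((h (n - 1) \<circ> s n) v) \<oplus>\<^bsub>obj Z n\<^esub>
        (h (n + 1 - 1) \<circ> s (n + 1)) (diff X n v))"
      if "v \<in> el X n" for n v
      using F(1,2) H(2) G(5) that e[OF that] homotopyD(2,3)[OF s]
      by (simp add: H(5,6) chain_pred[OF h])
  qed
qed

lemma homotopic_comp_right:
  assumes f: "chain_map X f Y" and g: "chain_map X g Y" and h: "chain_map W h X"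
    and "homotopic X Y f g"
  shows "homotopic W Y (\<lambda>n. f n \<circ> h n) (\<lambda>n. g n \<circ> h n)"
proof -
  note F = chain_mapD[OF f] and G = chain_mapD[OF g] and H = chain_mapD[OF h]
  obtain s where s: "homotopy X Y s" and e: "\<And>n v. v \<in> el X n \<Longrightarrow>
        f n v = g n v \<oplus>\<^bsub>obj Y n\<^esub> (diff Y (n - 1) (s n v) \<oplus>\<^bsub>obj Y n\<^esub> s (n + 1) (diff X n v))"
    using homotopicE[OF assms(4)] by blast
  show ?thesis
  proof (rule homotopicI[where s = "\<lambda>n. s n \<circ> h n"])
    show "homotopy W Y (\<lambda>n. s n \<circ> h n)"
      using linear_map_comp[OF H(3) homotopyD(1)[OF s]] by (simp add: homotopy_def)
    show "(f n \<circ> h n) v = (g n \<circ> h n) v \<oplus>\<^bsub>obj Y n\<^esub> (diff Y (n - 1) ((s n \<circ> h n) v) \<oplus>\<^bsub>obj Y n\<^esub>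
        (s (n + 1) \<circ> h (n + 1)) (diff W n v))"
      if "v \<in> el W n" for n v
      using that e[OF H(5)[OF that]] H(4)[OF that] by simp
  qed
qed

section \<open>Cohomology classes as cosets, and an elementwise criterion for
  quasi-isomorphisms\<close>

lemma in_cocycles: "v \<in> cocycles X n \<longleftrightarrow> v \<in> el X n \<and> diff X n v = \<zero>\<^bsub>obj X (n + 1)\<^esub>"
  by (simp add: cocycles_def)

definition coset :: "'k::field poly cplx \<Rightarrow> int \<Rightarrow> 'k poly elt \<Rightarrow> 'k poly elt set" where
  "coset X n z = coboundaries X n +>\<^bsub>obj X n\<^esub> z"

lemma in_coset:
  "w \<in> coset X n z \<longleftrightarrow> (\<exists>a\<in>el X (n - 1). w = diff X (n - 1) a \<oplus>\<^bsub>obj X n\<^esub> z)"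
  by (auto simp: coset_def a_r_coset_def' coboundaries_def)

lemma coset_eq_iff:
  assumes X: "bounded_complex X" and z: "z \<in> el X n" "z' \<in> el X n"
  shows "coset X n z = coset X n z' \<longleftrightarrow>
    (\<exists>a\<in>el X (n - 1). z = z' \<oplus>\<^bsub>obj X n\<^esub> diff X (n - 1) a)"
proof
  have "z \<in> coset X n z"
    unfolding in_coset using X z by (intro bexI[of _ "\<zero>\<^bsub>obj X (n - 1)\<^esub>"]) (simp_all add: bc_pred_lin)
  moreover assume "coset X n z = coset X n z'"
  ultimately show "\<exists>a\<in>el X (n - 1). z = z' \<oplus>\<^bsub>obj X n\<^esub> diff X (n - 1) a"
    using X z by (auto simp: in_coset km)
next
  assume "\<exists>a\<in>el X (n - 1). z = z' \<oplus>\<^bsub>obj X n\<^esub> diff X (n - 1) a"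
  then obtain a where a: "a \<in> el X (n - 1)" "z = z' \<oplus>\<^bsub>obj X n\<^esub> diff X (n - 1) a" by blast
  show "coset X n z = coset X n z'"
  proof (rule Set.set_eqI)
    fix w
    show "w \<in> coset X n z \<longleftrightarrow> w \<in> coset X n z'"
    proof
      assume "w \<in> coset X n z"
      then obtain b where b: "b \<in> el X (n - 1)" "w = diff X (n - 1) b \<oplus>\<^bsub>obj X n\<^esub> z"
        by (auto simp: in_coset)
      then show "w \<in> coset X n z'"
        unfolding in_coset using X z a
        by (intro bexI[of _ "b \<oplus>\<^bsub>obj X (n - 1)\<^esub> a"]) (simp_all add: bc_pred_lin km)
    next
      assume "w \<in> coset X n z'"
      then obtain b where b: "b \<in> el X (n - 1)" "w = diff X (n - 1) b \<oplus>\<^bsub>obj X n\<^esub> z'"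
        by (auto simp: in_coset)
      then show "w \<in> coset X n z"
        unfolding in_coset using X z a
        by (intro bexI[of _ "b \<oplus>\<^bsub>obj X (n - 1)\<^esub> \<ominus>\<^bsub>obj X (n - 1)\<^esub> a"]) (simp_all add: bc_pred_lin km)
    qed
  qed
qed

lemma carrier_cohomology: "carrier (cohomology X n) = coset X n ` cocycles X n"
  by (auto simp: cohomology_def quot_module_def A_RCOSETS_def' coset_def a_r_coset_def')

text \<open>The images of two members of a class differ by a coboundary because f commutes with the
  differentials, so the union defining the induced map collapses to one coset.\<close>

lemma cohomology_map_coset:
  assumes f: "chain_map X f Y" and z: "z \<in> el X n"
  shows "cohomology_map Y f n (coset X n z) = coset Y n (f n z)"
proof -
  note F = chain_mapD[OF f]
  have "coset Y n (f n w) = coset Y n (f n z)" if w: "w \<in> coset X n z" for w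
  proof -
    obtain a where a: "a \<in> el X (n - 1)" "w = diff X (n - 1) a \<oplus>\<^bsub>obj X n\<^esub> z"
      using w by (auto simp: in_coset)
    then have "f n w = f n z \<oplus>\<^bsub>obj Y n\<^esub> diff Y (n - 1) (f (n - 1) a)"
      using F(1,2) z by (simp add: F(5,6) chain_pred[OF f] km)
    then show ?thesis
      using a z F(1,2) by (subst coset_eq_iff) (auto simp: F(5))
  qed
  moreover have "z \<in> coset X n z"
    unfolding in_coset using F(1) z by (intro bexI[of _ "\<zero>\<^bsub>obj X (n - 1)\<^esub>"]) (simp_all add: bc_pred_lin)
  ultimately show ?thesis
    unfolding cohomology_map_def coset_def[symmetric] by blast
qed

lemma chain_map_cocycle: "chain_map X f Y \<Longrightarrow> z \<in> cocycles X n \<Longrightarrow> f n z \<in> cocycles Y n"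
  by (simp add: in_cocycles chain_mapD)

text \<open>Additivity reduces injectivity on cohomology to the zero class, and surjectivity is an
  equality of cosets. This removes the quotient modules: the lifting arguments below solve equations
  between elements of the complexes.\<close>

lemma quasi_iso_iff:
  "quasi_iso X f Y \<longleftrightarrow> chain_map X f Y \<and>
    (\<forall>n. \<forall>z\<in>cocycles X n. \<forall>b\<in>el Y (n - 1). f n z = diff Y (n - 1) b \<longrightarrow>
       (\<exists>a\<in>el X (n - 1). z = diff X (n - 1) a)) \<and>
    (\<forall>n. \<forall>w\<in>cocycles Y n. \<exists>z\<in>cocycles X n. \<exists>b\<in>el Y (n - 1).
       w = f n z \<oplus>\<^bsub>obj Y n\<^esub> diff Y (n - 1) b)"
  (is "_ \<longleftrightarrow> _ \<and> (\<forall>n. ?I n) \<and> (\<forall>n. ?S n)")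
proof (cases "chain_map X f Y")
  case True
  note F = chain_mapD[OF True]
  have "bij_betw (cohomology_map Y f n) (carrier (cohomology X n)) (carrier (cohomology Y n)) \<longleftrightarrow> ?I n \<and> ?S n"
    for n
  proof -
    have map: "cohomology_map Y f n (coset X n z) = coset Y n (f n z)" if "z \<in> cocycles X n" for z
      using that by (simp add: cohomology_map_coset[OF True] in_cocycles)
    have inj: "inj_on (cohomology_map Y f n) (carrier (cohomology X n)) \<longleftrightarrow> ?I n"
    proof
      assume L: "inj_on (cohomology_map Y f n) (carrier (cohomology X n))"
      show "?I n"
      proof (intro ballI impI)
        fix z b assume z: "z \<in> cocycles X n" and b: "b \<in> el Y (n - 1)" "f n z = diff Y (n - 1) b"
        have 0: "\<zero>\<^bsub>obj X n\<^esub> \<in> cocycles X n" using F(1) by (simp add: in_cocycles)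
        have "coset Y n (f n z) = coset Y n (f n \<zero>\<^bsub>obj X n\<^esub>)"
          using z b F(1,2) by (subst coset_eq_iff) (auto simp: F(5,8) in_cocycles)
        then have "cohomology_map Y f n (coset X n z) = cohomology_map Y f n (coset X n \<zero>\<^bsub>obj X n\<^esub>)"
          using map[OF z] map[OF 0] by simp
        then have "coset X n z = coset X n \<zero>\<^bsub>obj X n\<^esub>"
          using inj_onD[OF L, of "coset X n z" "coset X n \<zero>\<^bsub>obj X n\<^esub>"] z 0 by (simp add: carrier_cohomology)
        then show "\<exists>a\<in>el X (n - 1). z = diff X (n - 1) a"
          using z F(1) by (subst (asm) coset_eq_iff) (auto simp: in_cocycles)
      qed
    next
      assume I: "?I n"
      show "inj_on (cohomology_map Y f n) (carrier (cohomology X n))"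
      proof (rule inj_onI, unfold carrier_cohomology, elim imageE)
        fix c c' z z' assume c: "c = coset X n z" "c' = coset X n z'" and z: "z \<in> cocycles X n" "z' \<in> cocycles X n"
          and e: "cohomology_map Y f n c = cohomology_map Y f n c'"
        have "coset Y n (f n z) = coset Y n (f n z')" using e c z by (simp add: map)
        then obtain b where b: "b \<in> el Y (n - 1)" "f n z = f n z' \<oplus>\<^bsub>obj Y n\<^esub> diff Y (n - 1) b"
          using z F(1,2) by (subst (asm) coset_eq_iff) (auto simp: in_cocycles F(5))
        \<comment> \<open>The difference of the two representatives is a cocycle mapped to a
          coboundary, so the criterion for the zero class applies to it.\<close>
        let ?w = "z \<oplus>\<^bsub>obj X n\<^esub> \<ominus>\<^bsub>obj X n\<^esub> z'"
        have "?w \<in> cocycles X n" using z F(1) by (simp add: in_cocycles bc_add bc_neg)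
        moreover have "f n ?w = diff Y (n - 1) b" using z b F(1,2) by (simp add: F(5,6,9) in_cocycles km)
        ultimately obtain a where "a \<in> el X (n - 1)" "?w = diff X (n - 1) a"
          using I b(1) by blast
        then have "z = z' \<oplus>\<^bsub>obj X n\<^esub> diff X (n - 1) a" 
          using z F(1) by (metis (no_types, lifting) bc_mod in_cocycles mod_ac(1,2,4) mod_closed(3) mod_closed(2))
        then show "c = c'"
          unfolding c using z F(1) \<open>a \<in> _\<close> by (subst coset_eq_iff) (auto simp: in_cocycles)
      qed
    qed
    have surj: "cohomology_map Y f n ` carrier (cohomology X n) = carrier (cohomology Y n) \<longleftrightarrow> ?S n"
    proof -
      have "cohomology_map Y f n ` carrier (cohomology X n) = carrier (cohomology Y n) \<longleftrightarrow>
        (\<forall>w\<in>cocycles Y n. \<exists>z\<in>cocycles X n. coset Y n w = coset Y n (f n z))"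
        unfolding carrier_cohomology image_image using chain_map_cocycle[OF True]
        by (auto simp: map image_iff set_eq_iff[of "_ ` _" "_ ` _"])
      also have "\<dots> \<longleftrightarrow> ?S n"
        using F(2) by (simp add: coset_eq_iff in_cocycles F(5))
      finally show ?thesis .
    qed
    show ?thesis unfolding bij_betw_def using inj surj by blast
  qed
  then show ?thesis using True unfolding quasi_iso_def by blast
qed (simp add: quasi_iso_def)

lemma quasi_isoD:
  assumes "quasi_iso X f Y"
  shows "chain_map X f Y"
    "z \<in> el X n \<Longrightarrow> diff X n z = \<zero>\<^bsub>obj X (n + 1)\<^esub> \<Longrightarrow> b \<in> el Y (n - 1) \<Longrightarrow> f n z = diff Y (n - 1) b \<Longrightarrow>
       \<exists>a\<in>el X (n - 1). z = diff X (n - 1) a"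
    "w \<in> el Y n \<Longrightarrow> diff Y n w = \<zero>\<^bsub>obj Y (n + 1)\<^esub> \<Longrightarrow>
      \<exists>z\<in>el X n. diff X n z = \<zero>\<^bsub>obj X (n + 1)\<^esub> \<and>
        (\<exists>b\<in>el Y (n - 1). w = f n z \<oplus>\<^bsub>obj Y n\<^esub> diff Y (n - 1) b)"
  using assms unfolding quasi_iso_iff Ball_def Bex_def in_cocycles by blast+

lemma quasi_isoI:
  assumes "chain_map X f Y"
    "\<And>n z b. z \<in> el X n \<Longrightarrow> diff X n z = \<zero>\<^bsub>obj X (n + 1)\<^esub> \<Longrightarrow> b \<in> el Y (n - 1) \<Longrightarrow> f n z = diff Y (n - 1) b \<Longrightarrow>
       \<exists>a\<in>el X (n - 1). z = diff X (n - 1) a"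
    "\<And>n w. w \<in> el Y n \<Longrightarrow> diff Y n w = \<zero>\<^bsub>obj Y (n + 1)\<^esub> \<Longrightarrow>
      \<exists>z\<in>el X n. diff X n z = \<zero>\<^bsub>obj X (n + 1)\<^esub> \<and>
        (\<exists>b\<in>el Y (n - 1). w = f n z \<oplus>\<^bsub>obj Y n\<^esub> diff Y (n - 1) b)"
  shows "quasi_iso X f Y"
  using assms unfolding quasi_iso_iff Ball_def Bex_def in_cocycles by blast

subsection \<open>The shift functor on complexes\<close>

lemma shift_id [simp]: "shift_map (\<lambda>n. id) = (\<lambda>n. id)"
  unfolding shift_map_def ..

lemma shift_map_apply [simp]: "shift_map f n = f (n + 1)"
  by (simp add: shift_map_def)

lemma chain_map_shift:
  assumes "chain_map X f Y" shows "chain_map (shift X) (shift_map f) (shift Y)"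
  using chain_mapD[OF assms] by (intro chain_mapI) simp_all

text \<open>The differential of the shift carries a sign, so the shifted homotopy has to be negated
  to compensate.\<close>

lemma homotopic_shift:
  assumes f: "chain_map X f Y" and g: "chain_map X g Y" and "homotopic X Y f g"
  shows "homotopic (shift X) (shift Y) (shift_map f) (shift_map g)"
proof -
  note F = chain_mapD[OF f] and G = chain_mapD[OF g]
  obtain s where s: "homotopy X Y s" and e: "\<And>n v. v \<in> el X n \<Longrightarrow>
        f n v = g n v \<oplus>\<^bsub>obj Y n\<^esub> (diff Y (n - 1) (s n v) \<oplus>\<^bsub>obj Y n\<^esub> s (n + 1) (diff X n v))"
    using homotopicE[OF assms(3)] by blast
  have s1: "linear_map (obj X (n + 1)) (obj Y n) (s (n + 1))" for n
    using homotopyD(1)[OF s, of "n + 1"] by simp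
  have s2: "s (n + 1) v \<in> el Y n" if "v \<in> el X (n + 1)" for n v
    using lin_closed[OF s1 that] .
  show ?thesis
  proof (rule homotopicI[where s = "\<lambda>n v. \<ominus>\<^bsub>obj Y n\<^esub> s (n + 1) v"])
    show "homotopy (shift X) (shift Y) (\<lambda>n v. \<ominus>\<^bsub>obj Y n\<^esub> s (n + 1) v)"
      using s1 F by (simp add: homotopy_def linear_map_neg)
    show "shift_map f n v = shift_map g n v \<oplus>\<^bsub>obj (shift Y) n\<^esub> (diff (shift Y) (n - 1) (\<ominus>\<^bsub>obj Y n\<^esub> s (n + 1) v) \<oplus>\<^bsub>obj (shift Y) n\<^esub>
        \<ominus>\<^bsub>obj Y (n + 1)\<^esub> s (n + 1 + 1) (diff (shift X) n v))"
      if v: "v \<in> el (shift X) n" for n v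
    proof -
      have v': "v \<in> el X (n + 1)" using v by simp
      have d: "diff X (n + 1) v \<in> el X (n + 1 + 1)" using F(1) v' by simp
      have "s (n + 1 + 1) (\<ominus>\<^bsub>obj X (n + 1 + 1)\<^esub> diff X (n + 1) v) = \<ominus>\<^bsub>obj Y (n + 1)\<^esub> s (n + 1 + 1) (diff X (n + 1) v)"
        using lin_neg[OF s1 _ _ d] F(1,2) by simp
      then show ?thesis
        using e[OF v'] v' s2[OF v'] s2[OF d] F(1,2) by (simp add: bc_neg)
    qed
  qed
qed

text \<open>Cocycles and coboundaries are unaffected by the sign of the shifted differential; only
  the elements whose differentials are taken change sign, which is why the witnesses are
  negated.\<close>

lemma quasi_iso_shift:
  assumes "quasi_iso X f Y" shows "quasi_iso (shift X) (shift_map f) (shift Y)"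
proof -
  note Q = quasi_isoD[OF assms]
  note F = chain_mapD[OF Q(1)]
  have neg: "\<ominus>\<^bsub>obj Z k\<^esub> u = \<zero>\<^bsub>obj Z k\<^esub> \<longleftrightarrow> u = \<zero>\<^bsub>obj Z k\<^esub>"
    if "bounded_complex Z" "u \<in> el Z k" for Z k u
    using mod_simps(3,4)[OF bc_mod[OF that(1), of k]] that by metis
  show ?thesis
  proof (rule quasi_isoI)
    show "chain_map (shift X) (shift_map f) (shift Y)" using Q(1) by (rule chain_map_shift)
  next
    fix n z b
    assume z: "z \<in> el (shift X) n" "diff (shift X) n z = \<zero>\<^bsub>obj (shift X) (n + 1)\<^esub>"
      and b: "b \<in> el (shift Y) (n - 1)" "shift_map f n z = diff (shift Y) (n - 1) b"
    have z': "z \<in> el X (n + 1)" "diff X (n + 1) z = \<zero>\<^bsub>obj X (n + 1 + 1)\<^esub>"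
      using z neg[OF F(1), of "diff X (n + 1) z" "n + 1 + 1"] F(1) by auto
    obtain a where "a \<in> el X n" "z = diff X n a"
      using Q(2)[OF z', of "\<ominus>\<^bsub>obj Y n\<^esub> b"] b F(1,2) by (auto simp: bc_neg)
    then show "\<exists>a\<in>el (shift X) (n - 1). z = diff (shift X) (n - 1) a"
      using F(1) by (intro bexI[of _ "\<ominus>\<^bsub>obj X n\<^esub> a"]) (simp_all add: bc_neg)
  next
    fix n w
    assume w: "w \<in> el (shift Y) n" "diff (shift Y) n w = \<zero>\<^bsub>obj (shift Y) (n + 1)\<^esub>"
    have w': "w \<in> el Y (n + 1)" "diff Y (n + 1) w = \<zero>\<^bsub>obj Y (n + 1 + 1)\<^esub>"
      using w neg[OF F(2), of "diff Y (n + 1) w" "n + 1 + 1"] F(2) by auto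
    obtain z b where z: "z \<in> el X (n + 1)" "diff X (n + 1) z = \<zero>\<^bsub>obj X (n + 1 + 1)\<^esub>"
      and b: "b \<in> el Y n" "w = f (n + 1) z \<oplus>\<^bsub>obj Y (n + 1)\<^esub> diff Y n b"
      using Q(3)[OF w'] by auto
    show "\<exists>z\<in>el (shift X) n. diff (shift X) n z = \<zero>\<^bsub>obj (shift X) (n + 1)\<^esub> \<and>
        (\<exists>b\<in>el (shift Y) (n - 1). w = shift_map f n z \<oplus>\<^bsub>obj (shift Y) n\<^esub> diff (shift Y) (n - 1) b)"
      using z b F(1,2)
      by (intro bexI[of _ z] conjI bexI[of _ "\<ominus>\<^bsub>obj Y n\<^esub> b"]) (simp_all add: bc_neg)
  qed
qed

subsection \<open>Direct sums of chain maps\<close>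

definition dsum_map :: "'k::field poly gmap \<Rightarrow> 'k poly gmap \<Rightarrow> 'k poly gmap" where
  "dsum_map f g = (\<lambda>n v. Pr (f n (pfst v)) (g n (psnd v)))"

lemma dsum_map_apply [simp]: "dsum_map f g n v = Pr (f n (pfst v)) (g n (psnd v))"
  by (simp add: dsum_map_def)

lemma chain_map_dsum:
  assumes f: "chain_map X f X'" and g: "chain_map Y g Y'"
  shows "chain_map (dsum X Y) (dsum_map f g) (dsum X' Y')"
proof (rule chain_mapI)
  show "linear_map (obj (dsum X Y) n) (obj (dsum X' Y') n) (dsum_map f g n)" for n
    using linear_map_dsum[OF chain_mapD(3)[OF f] chain_mapD(3)[OF g]] by (simp add: dsum_map_def)
qed (use chain_mapD[OF f] chain_mapD[OF g] in \<open>auto elim!: dsum_cases\<close>)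

lemma quasi_iso_dsum:
  assumes "quasi_iso X f X'" "quasi_iso Y g Y'"
  shows "quasi_iso (dsum X Y) (dsum_map f g) (dsum X' Y')"
proof -
  note Q = quasi_isoD[OF assms(1)] and R = quasi_isoD[OF assms(2)]
  show ?thesis
  proof (rule quasi_isoI)
    show "chain_map (dsum X Y) (dsum_map f g) (dsum X' Y')" using Q(1) R(1) by (rule chain_map_dsum)
  next
    fix n z b
    assume z: "z \<in> el (dsum X Y) n" "diff (dsum X Y) n z = \<zero>\<^bsub>obj (dsum X Y) (n + 1)\<^esub>"
      and b: "b \<in> el (dsum X' Y') (n - 1)" "dsum_map f g n z = diff (dsum X' Y') (n - 1) b"
    obtain x y where x: "x \<in> el X (n - 1)" "pfst z = diff X (n - 1) x"
      and y: "y \<in> el Y (n - 1)" "psnd z = diff Y (n - 1) y"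
      using Q(2)[of "pfst z" n "pfst b"] R(2)[of "psnd z" n "psnd b"] z b by (auto elim!: dsum_cases)
    then show "\<exists>a\<in>el (dsum X Y) (n - 1). z = diff (dsum X Y) (n - 1) a"
      using z by (intro bexI[of _ "Pr x y"]) (auto elim!: dsum_cases)
  next
    fix n w
    assume w: "w \<in> el (dsum X' Y') n" "diff (dsum X' Y') n w = \<zero>\<^bsub>obj (dsum X' Y') (n + 1)\<^esub>"
    obtain z b where z: "z \<in> el X n" "diff X n z = \<zero>\<^bsub>obj X (n + 1)\<^esub>"
      "b \<in> el X' (n - 1)" "pfst w = f n z \<oplus>\<^bsub>obj X' n\<^esub> diff X' (n - 1) b"
      using Q(3)[of "pfst w" n] w by (auto elim!: dsum_cases)
    obtain y c where y: "y \<in> el Y n" "diff Y n y = \<zero>\<^bsub>obj Y (n + 1)\<^esub>"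
      "c \<in> el Y' (n - 1)" "psnd w = g n y \<oplus>\<^bsub>obj Y' n\<^esub> diff Y' (n - 1) c"
      using R(3)[of "psnd w" n] w by (auto elim!: dsum_cases)
    show "\<exists>z\<in>el (dsum X Y) n. diff (dsum X Y) n z = \<zero>\<^bsub>obj (dsum X Y) (n + 1)\<^esub> \<and>
        (\<exists>b\<in>el (dsum X' Y') (n - 1). w = dsum_map f g n z \<oplus>\<^bsub>obj (dsum X' Y') n\<^esub> diff (dsum X' Y') (n - 1) b)"
      using w z y by (intro bexI[of _ "Pr z y"] conjI bexI[of _ "Pr b c"]) (auto elim!: dsum_cases)
  qed
qed

section \<open>Morphisms of the derived category\<close>

lemma wf_term_bc:
  "wf_term a \<Longrightarrow> bounded_complex (src a) \<and> bounded_complex (tgt a)"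
  by (induction a) (auto dest: chain_mapD(1,2) quasi_isoD(1))

lemma quasi_iso_bc: "quasi_iso X s Y \<Longrightarrow> bounded_complex X \<and> bounded_complex Y"
  using quasi_isoD(1) chain_mapD(1,2) by blast

text \<open>Endpoints are an invariant of the class, so source and target may be read from any
  representative.\<close>

lemma deq_wf: "deq a b \<Longrightarrow> wf_term a \<and> wf_term b \<and> src a = src b \<and> tgt a = tgt b"
  by (induction rule: deq.induct) (auto simp: wf_term_bc chain_map_comp quasi_iso_bc dest: quasi_isoD(1))

text \<open>Well-formedness supplies reflexivity; the class of an ill-formed term is empty.\<close>

lemma dclass_eq_iff: "wf_term a \<Longrightarrow> dclass a = dclass b \<longleftrightarrow> deq a b"
  unfolding dclass_def using deq.refl deq.sym deq.trans by blast

lemma dhomI: "wf_term a \<Longrightarrow> src a = X \<Longrightarrow> tgt a = Y \<Longrightarrow> dclass a \<in> dhom X Y"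
  unfolding dhom_def by blast

lemma dhomE:
  assumes "\<phi> \<in> dhom X Y"
  obtains a where "\<phi> = dclass a" "wf_term a" "src a = X" "tgt a = Y"
  using assms unfolding dhom_def by blast

text \<open>The set of composites over all representatives is a single class because
  \<open>deq\<close> is a congruence.\<close>

lemma dcomp_dclass:
  assumes "wf_term b" "wf_term a" "src b = tgt a"
  shows "dclass b \<cdot> dclass a = dclass (Comp b a)"
proof (rule Set.set_eqI)
  fix c
  have "deq (Comp b a) c" if "deq b b'" "deq a a'" "deq (Comp b' a') c" for b' a'
    using deq.cong[OF that(1,2)] assms(3) that(3) deq.trans by blast
  then show "c \<in> dclass b \<cdot> dclass a \<longleftrightarrow> c \<in> dclass (Comp b a)"
    using assms deq.refl unfolding dcomp_def dclass_def by blast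
qed

lemma dcomp_hom: "\<phi> \<in> dhom X Y \<Longrightarrow> \<psi> \<in> dhom Y Z \<Longrightarrow> \<psi> \<cdot> \<phi> \<in> dhom X Z"
  by (elim dhomE) (auto simp: dcomp_dclass intro!: dhomI)

lemma dcomp_assoc:
  assumes "\<phi> \<in> dhom X Y" "\<psi> \<in> dhom Y Z" "\<chi> \<in> dhom Z W"
  shows "(\<chi> \<cdot> \<psi>) \<cdot> \<phi> = \<chi> \<cdot> \<psi> \<cdot> \<phi>"
  using assms by (elim dhomE) (simp add: dcomp_dclass dclass_eq_iff deq.assoc)

lemma dmap_hom: "chain_map X f Y \<Longrightarrow> dmap X f Y \<in> dhom X Y"
  by (rule dhomI) simp_all

lemma did_hom: "bounded_complex X \<Longrightarrow> did X \<in> dhom X X"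
  by (simp add: dmap_hom)

lemma did_left: "\<phi> \<in> dhom X Y \<Longrightarrow> did Y \<cdot> \<phi> = \<phi>"
  by (elim dhomE, hypsubst) (simp add: dcomp_dclass dclass_eq_iff wf_term_bc deq.id_left)

lemma did_right: "\<phi> \<in> dhom X Y \<Longrightarrow> \<phi> \<cdot> did X = \<phi>"
  by (elim dhomE, hypsubst) (simp add: dcomp_dclass dclass_eq_iff wf_term_bc deq.id_right)

lemma dmap_comp:
  "chain_map X f Y \<Longrightarrow> chain_map Y g Z \<Longrightarrow> dmap Y g Z \<cdot> dmap X f Y = dmap X (\<lambda>n. g n \<circ> f n) Z"
  by (simp add: dcomp_dclass dclass_eq_iff deq.chain_comp)

lemma dmap_homotopic:
  "chain_map X f Y \<Longrightarrow> chain_map X g Y \<Longrightarrow> homotopic X Y f g \<Longrightarrow> dmap X f Y = dmap X g Y"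
  by (simp add: dclass_eq_iff deq.chain_homotopic)

lemma dmap_eq:
  "chain_map X f Y \<Longrightarrow> chain_map X g Y \<Longrightarrow> (\<And>n v. v \<in> el X n \<Longrightarrow> f n v = g n v) \<Longrightarrow>
    dmap X f Y = dmap X g Y"
  by (intro dmap_homotopic homotopic_eq)

section \<open>Formal inverses and isomorphisms\<close>

definition dinv :: "'k::field poly cplx \<Rightarrow> 'k poly gmap \<Rightarrow> 'k poly cplx \<Rightarrow> 'k poly dmor" where
  "dinv X s Y = dclass (Inv X s Y)"

lemma dinv_hom: "quasi_iso X s Y \<Longrightarrow> dinv X s Y \<in> dhom Y X"
  unfolding dinv_def by (rule dhomI) simp_all

lemma dinv_left: "quasi_iso X s Y \<Longrightarrow> dinv X s Y \<cdot> dmap X s Y = did X"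
  unfolding dinv_def by (simp add: quasi_isoD(1) dcomp_dclass dclass_eq_iff deq.inv_left)

lemma dinv_right: "quasi_iso X s Y \<Longrightarrow> dmap X s Y \<cdot> dinv X s Y = did Y"
  unfolding dinv_def by (simp add: quasi_isoD(1) dcomp_dclass dclass_eq_iff deq.inv_right)

lemma dcomp_cancel:
  assumes "\<phi> \<in> dhom X Y" "\<psi> \<in> dhom Y X" "\<psi> \<cdot> \<phi> = did X" "\<alpha> \<in> dhom W X"
  shows "\<psi> \<cdot> \<phi> \<cdot> \<alpha> = \<alpha>"
  using dcomp_assoc[OF assms(4,1,2)] did_left[OF assms(4)] assms(3) by simp

lemma diso_dinv: "quasi_iso X s Y \<Longrightarrow> diso Y (dinv X s Y) X"
  unfolding diso_def using dinv_hom dinv_left dinv_right quasi_isoD(1) dmap_hom by blast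

lemma diso_comp:
  assumes "diso X \<phi> Y" "diso Y \<psi> Z"
  shows "diso X (\<psi> \<cdot> \<phi>) Z"
proof -
  obtain \<phi>' where p: "\<phi> \<in> dhom X Y" "\<phi>' \<in> dhom Y X" "\<phi>' \<cdot> \<phi> = did X" "\<phi> \<cdot> \<phi>' = did Y"
    using assms(1) unfolding diso_def by blast
  obtain \<psi>' where q: "\<psi> \<in> dhom Y Z" "\<psi>' \<in> dhom Z Y" "\<psi>' \<cdot> \<psi> = did Y" "\<psi> \<cdot> \<psi>' = did Z"
    using assms(2) unfolding diso_def by blast
  have "(\<phi>' \<cdot> \<psi>') \<cdot> \<psi> \<cdot> \<phi> = did X"
    using dcomp_assoc[OF dcomp_hom[OF p(1) q(1)] q(2) p(2)] dcomp_cancel[OF q(1,2,3) p(1)] p(3) by simp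
  moreover have "(\<psi> \<cdot> \<phi>) \<cdot> \<phi>' \<cdot> \<psi>' = did Z"
    using dcomp_assoc[OF dcomp_hom[OF q(2) p(2)] p(1) q(1)] dcomp_cancel[OF p(2,1,4) q(2)] q(4) by simp
  ultimately show ?thesis
    unfolding diso_def using dcomp_hom[OF p(1) q(1)] dcomp_hom[OF q(2) p(2)] by blast
qed

section \<open>Shift and negation of morphisms\<close>

lemma src_tgt_shift [simp]: "src (shift_term a) = shift (src a)" "tgt (shift_term a) = shift (tgt a)"
  by (induction a) simp_all

lemma wf_shift: "wf_term a \<Longrightarrow> wf_term (shift_term a)"
  by (induction a) (simp_all add: chain_map_shift quasi_iso_shift)

text \<open>Makes the shift well defined on classes: it preserves chain maps, homotopies and
  quasi-isomorphisms, so each generating relation goes to a relation of the same kind.\<close>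

lemma deq_shift: "deq a b \<Longrightarrow> deq (shift_term a) (shift_term b)"
proof (induction rule: deq.induct)
  case (chain_comp X f Y g Z)
  have "(\<lambda>n. shift_map g n \<circ> shift_map f n) = shift_map (\<lambda>n. g n \<circ> f n)" by (simp add: fun_eq_iff)
  then show ?case
    using deq.chain_comp[OF chain_map_shift[OF chain_comp(1)] chain_map_shift[OF chain_comp(2)]] by simp
next
  case (id_left a)
  then show ?case using deq.id_left[OF wf_shift[OF id_left]] by simp
next
  case (id_right a)
  then show ?case using deq.id_right[OF wf_shift[OF id_right]] by simp
next
  case (trans a b c)
  then show ?case using deq.trans by blast
next
  case (assoc c b a)
  then show ?case using deq.assoc[of "shift_term c" "shift_term b" "shift_term a"] by (simp add: wf_shift)
next
  case (inv_left X s Y)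
  then show ?case using deq.inv_left[OF quasi_iso_shift[OF inv_left]] by simp
next
  case (inv_right X s Y)
  then show ?case using deq.inv_right[OF quasi_iso_shift[OF inv_right]] by simp
qed (auto simp: wf_shift chain_map_shift homotopic_shift intro: deq.intros)

lemma dshift_dclass: "wf_term a \<Longrightarrow> (dclass a)\<langle>1\<rangle> = dclass (shift_term a)"
  unfolding dshift_def dclass_def using deq_shift deq.refl deq.trans by blast

lemma dshift_hom: "\<phi> \<in> dhom X Y \<Longrightarrow> \<phi>\<langle>1\<rangle> \<in> dhom (shift X) (shift Y)"
  by (elim dhomE) (auto simp: dshift_dclass wf_shift intro!: dhomI)

lemma dshift_comp: "\<phi> \<in> dhom X Y \<Longrightarrow> \<psi> \<in> dhom Y Z \<Longrightarrow> (\<psi> \<cdot> \<phi>)\<langle>1\<rangle> = \<psi>\<langle>1\<rangle> \<cdot> \<phi>\<langle>1\<rangle>"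
  by (elim dhomE) (simp add: dshift_dclass dcomp_dclass wf_shift)

lemma dshift_dmap: "chain_map X f Y \<Longrightarrow> (dmap X f Y)\<langle>1\<rangle> = dmap (shift X) (shift_map f) (shift Y)"
  by (simp add: dshift_dclass)

text \<open>The definition takes the target from the representative; since \<open>deq\<close>
  preserves targets, the same chain map -id is composed with every representative.\<close>

lemma dneg_eq:
  assumes "\<phi> \<in> dhom X Y"
  shows "dneg \<phi> = dmap Y (\<lambda>n v. \<ominus>\<^bsub>obj Y n\<^esub> v) Y \<cdot> \<phi>"
proof -
  obtain a where a: "\<phi> = dclass a" "wf_term a" "src a = X" "tgt a = Y" using assms by (rule dhomE)
  have c: "chain_map Y (\<lambda>n v. \<ominus>\<^bsub>obj Y n\<^esub> v) Y" using a wf_term_bc chain_map_neg by blast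
  let ?N = "Chain Y (\<lambda>n v. \<ominus>\<^bsub>obj Y n\<^esub> v) Y"
  have 1: "deq (Comp ?N a) b" if "deq a a'" "deq (Comp ?N a') b" for a' b
    using deq.cong[OF deq.refl that(1), of ?N] that(2) c a deq.trans by auto
  have t: "tgt a' = Y" if "deq a a'" for a' using deq_wf[OF that] a by simp
  have "dneg \<phi> = dclass (Comp ?N a)"
  proof (rule Set.set_eqI)
    fix b
    have "b \<in> dneg \<phi> \<longleftrightarrow> (\<exists>a'. deq a a' \<and> deq (Comp ?N a') b)"
      unfolding dneg_def a(1) dclass_def using t by auto
    then show "b \<in> dneg \<phi> \<longleftrightarrow> b \<in> dclass (Comp ?N a)"
      unfolding dclass_def using 1 deq.refl[OF a(2)] by blast
  qed
  then show ?thesis using a c by (simp add: dcomp_dclass)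
qed

subsection \<open>Morphisms out of homotopically projective complexes\<close>

text \<open>The formula \<open>homotopic\<close> makes sense for arbitrary families of functions,
  while its symmetry and transitivity are available for chain maps; bundling the three conditions
  gives a relation that can be chained freely.\<close>

definition hq :: "'k::field poly cplx \<Rightarrow> 'k poly cplx \<Rightarrow> 'k poly gmap \<Rightarrow> 'k poly gmap \<Rightarrow> bool" where
  "hq X Y f g \<longleftrightarrow> chain_map X f Y \<and> chain_map X g Y \<and> homotopic X Y f g"

lemma hq_refl: "chain_map X f Y \<Longrightarrow> hq X Y f f"
  by (simp add: hq_def homotopic_refl)

lemma hq_sym: "hq X Y f g \<Longrightarrow> hq X Y g f"
  unfolding hq_def using homotopic_sym by blast

lemma hq_trans: "hq X Y f g \<Longrightarrow> hq X Y g h \<Longrightarrow> hq X Y f h"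
  unfolding hq_def using homotopic_trans by blast

lemma hq_comp_left: "hq X Y f g \<Longrightarrow> chain_map Y h Z \<Longrightarrow> hq X Z (\<lambda>n. h n \<circ> f n) (\<lambda>n. h n \<circ> g n)"
  unfolding hq_def using homotopic_comp_left chain_map_comp by blast

lemma hq_comp_right: "hq X Y f g \<Longrightarrow> chain_map W h X \<Longrightarrow> hq W Y (\<lambda>n. f n \<circ> h n) (\<lambda>n. g n \<circ> h n)"
  unfolding hq_def using homotopic_comp_right chain_map_comp by blast

lemma hq_chain: "hq X Y f g \<Longrightarrow> chain_map X f Y" "hq X Y f g \<Longrightarrow> chain_map X g Y"
  by (simp_all add: hq_def)

text \<open>The two clauses are surjectivity and injectivity of composition with s on homotopy
  classes of maps out of P, for every quasi-isomorphism s of bounded complexes.\<close>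

definition kproj :: "'k::field poly cplx \<Rightarrow> bool" where
  "kproj P \<longleftrightarrow> bounded_complex P \<and> (\<forall>X s Y. quasi_iso X s Y \<longrightarrow>
     (\<forall>u. chain_map P u Y \<longrightarrow> (\<exists>v. chain_map P v X \<and> hq P Y (\<lambda>n. s n \<circ> v n) u)) \<and>
     (\<forall>v v'. chain_map P v X \<longrightarrow> chain_map P v' X \<longrightarrow> hq P Y (\<lambda>n. s n \<circ> v n) (\<lambda>n. s n \<circ> v' n) \<longrightarrow> hq P X v v'))"

lemma kproj_bc: "kproj P \<Longrightarrow> bounded_complex P"
  by (simp add: kproj_def)

lemma kproj_lift:
  assumes "kproj P" "quasi_iso X s Y" "chain_map P u Y"
  obtains v where "chain_map P v X" "hq P Y (\<lambda>n. s n \<circ> v n) u"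
  using assms unfolding kproj_def by blast

lemma kproj_inj:
  assumes "kproj P" "quasi_iso X s Y" "chain_map P v X" "chain_map P v' X"
    "hq P Y (\<lambda>n. s n \<circ> v n) (\<lambda>n. s n \<circ> v' n)"
  shows "hq P X v v'"
  using assms unfolding kproj_def by blast

text \<open>
  For homotopically projective \<open>P\<close>, homotopy classes of chain maps out of \<open>P\<close> form a functor on the
  derived category: a formal inverse of a quasi-isomorphism acts by lifting along it.
\<close>

primrec act :: "'k::field poly cplx \<Rightarrow> 'k poly dterm \<Rightarrow> 'k poly gmap \<Rightarrow> 'k poly gmap \<Rightarrow> bool" where
  "act P (Chain X f Y) u v \<longleftrightarrow> chain_map P u X \<and> hq P Y (\<lambda>n. f n \<circ> u n) v"
| "act P (Inv X s Y) u v \<longleftrightarrow> chain_map P v X \<and> hq P Y (\<lambda>n. s n \<circ> v n) u"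
| "act P (Comp b a) u v \<longleftrightarrow> (\<exists>w. act P a u w \<and> act P b w v)"

lemma act_chain:
  "act P a u v \<Longrightarrow> chain_map P u (src a) \<and> chain_map P v (tgt a)"
  by (induction a arbitrary: u v) (auto dest: hq_chain)

text \<open>Lifts are only unique up to homotopy, so \<open>act\<close> is a relation. Closure under
  homotopy in both arguments makes it a relation between homotopy classes.\<close>

lemma act_closed:
  "wf_term a \<Longrightarrow> act P a u v \<Longrightarrow> hq P (src a) u' u \<Longrightarrow> hq P (tgt a) v v' \<Longrightarrow> act P a u' v'"
proof (induction a arbitrary: u v u' v')
  case (Chain X f Y)
  then show ?case
    using hq_comp_left[of P X u' u f Y] by (auto intro: hq_trans hq_chain)
next
  case (Inv X s Y)
  then show ?case
    using hq_comp_left[OF hq_sym, of P X v v' s Y] quasi_isoD(1)[of X s Y]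
    by (auto intro: hq_trans hq_chain hq_sym)
next
  case (Comp b a)
  then obtain w where w: "act P a u w" "act P b w v" by auto
  have "hq P (tgt a) w w" using act_chain[OF w(1)] by (simp add: hq_refl)
  then have "act P a u' w" "act P b w v'" using Comp w by auto
  then show ?case by auto
qed

lemma act_total:
  assumes P: "kproj P"
  shows "wf_term a \<Longrightarrow> chain_map P u (src a) \<Longrightarrow> \<exists>v. act P a u v"
proof (induction a arbitrary: u)
  case (Chain X f Y)
  then show ?case using chain_map_comp[of P u X f Y] by (auto intro: hq_refl)
next
  case (Inv X s Y)
  then show ?case using kproj_lift[OF P, of X s Y u] by auto
next
  case (Comp b a)
  then obtain w where w: "act P a u w" by auto
  moreover obtain v where "act P b w v" using Comp act_chain[OF w] by fastforce
  ultimately show ?case by auto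
qed

text \<open>The invariant that makes inequalities provable: each generating relation of
  \<open>deq\<close> is checked against the action. The rule \<open>inv_left\<close> rests on
  uniqueness of lifts along s, the rule \<open>inv_right\<close> on their existence, and the
  remaining cases on stability of homotopy under composition.\<close>

lemma act_deq:
  assumes P: "kproj P"
  shows "deq a b \<Longrightarrow> act P a u v \<longleftrightarrow> act P b u v"
proof (induction arbitrary: u v rule: deq.induct)
  case (id_left a)
  show ?case
  proof
    assume "act P (Comp (Chain (tgt a) (\<lambda>n. id) (tgt a)) a) u v"
    then obtain w where "act P a u w" "hq P (tgt a) w v" by auto
    then show "act P a u v" using act_closed[OF id_left, of P u w u v] act_chain[of P a u w] hq_refl by blast
  next
    assume "act P a u v"
    then show "act P (Comp (Chain (tgt a) (\<lambda>n. id) (tgt a)) a) u v"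
      using act_chain[of P a u v] hq_refl[of P v "tgt a"] by auto
  qed
next
  case (id_right a)
  show ?case
  proof
    assume "act P (Comp a (Chain (src a) (\<lambda>n. id) (src a))) u v"
    then obtain w where "act P a w v" "hq P (src a) u w" by auto
    then show "act P a u v" using act_closed[OF id_right, of P w v u v] act_chain[of P a w v] hq_refl by blast
  next
    assume "act P a u v"
    then show "act P (Comp a (Chain (src a) (\<lambda>n. id) (src a))) u v"
      using act_chain[of P a u v] hq_refl[of P u "src a"] by auto
  qed
next
  case (chain_comp X f Y g Z)
  show ?case
  proof
    assume "act P (Comp (Chain Y g Z) (Chain X f Y)) u v"
    then obtain w where w: "chain_map P u X" "hq P Y (\<lambda>n. f n \<circ> u n) w" "hq P Z (\<lambda>n. g n \<circ> w n) v" by auto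
    then show "act P (Chain X (\<lambda>n. g n \<circ> f n) Z) u v"
      using hq_trans[OF hq_comp_left[OF w(2) chain_comp(2)] w(3)] by (simp add: comp_assoc)
  next
    assume "act P (Chain X (\<lambda>n. g n \<circ> f n) Z) u v"
    then have v: "chain_map P u X" "hq P Z (\<lambda>n. g n \<circ> (f n \<circ> u n)) v" by (auto simp: comp_assoc)
    have c: "chain_map P (\<lambda>n. f n \<circ> u n) Y" using chain_map_comp[OF v(1) chain_comp(1)] .
    show "act P (Comp (Chain Y g Z) (Chain X f Y)) u v"
      using v c hq_refl[OF c] by auto
  qed
next
  case (chain_homotopic X f Y g)
  then have e: "hq X Y f g" by (simp add: hq_def)
  show ?case
    using hq_comp_right[OF e, of P u] by (auto intro: hq_trans hq_sym)
next
  case (inv_left X s Y)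
  have s: "chain_map X s Y" using quasi_isoD(1)[OF inv_left] .
  show ?case
  proof
    assume "act P (Comp (Inv X s Y) (Chain X s Y)) u v"
    then obtain w where w: "chain_map P u X" "hq P Y (\<lambda>n. s n \<circ> u n) w" "chain_map P v X" "hq P Y (\<lambda>n. s n \<circ> v n) w"
      by auto
    then have "hq P X u v" using kproj_inj[OF P inv_left w(1,3) hq_trans[OF w(2) hq_sym[OF w(4)]]] by blast
    then show "act P (Chain X (\<lambda>n. id) X) u v" using w by simp
  next
    assume "act P (Chain X (\<lambda>n. id) X) u v"
    then have w: "chain_map P u X" "hq P X u v" by auto
    show "act P (Comp (Inv X s Y) (Chain X s Y)) u v"
      using w hq_chain[OF w(2)] hq_comp_left[OF hq_sym[OF w(2)] s] hq_refl[OF chain_map_comp[OF w(1) s]] by auto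
  qed
next
  case (inv_right X s Y)
  show ?case
  proof
    assume "act P (Comp (Chain X s Y) (Inv X s Y)) u v"
    then obtain w where w: "hq P Y (\<lambda>n. s n \<circ> w n) u" "hq P Y (\<lambda>n. s n \<circ> w n) v" by auto
    then show "act P (Chain Y (\<lambda>n. id) Y) u v"
      using hq_chain[OF w(1)] hq_trans[OF hq_sym[OF w(1)] w(2)] by simp
  next
    assume "act P (Chain Y (\<lambda>n. id) Y) u v"
    then have w: "chain_map P u Y" "hq P Y u v" by auto
    obtain w' where "chain_map P w' X" "hq P Y (\<lambda>n. s n \<circ> w' n) u"
      using kproj_lift[OF P inv_right w(1)] by blast
    then show "act P (Comp (Chain X s Y) (Inv X s Y)) u v" using hq_trans[OF _ w(2)] by auto
  qed
qed auto

text \<open>Both chain maps are recovered, up to homotopy, by letting their classes act on the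
  identity of P.\<close>

lemma dmap_faithful:
  assumes P: "kproj P" and f: "chain_map P f Y" and g: "chain_map P g Y"
    and e: "dmap P f Y = dmap P g Y"
  shows "hq P Y f g"
proof -
  have "deq (Chain P g Y) (Chain P f Y)" using e g f by (simp add: dclass_eq_iff[symmetric])
  moreover have "act P (Chain P g Y) (\<lambda>n. id) g"
    using P g by (auto simp: kproj_bc intro: hq_refl)
  ultimately have "act P (Chain P f Y) (\<lambda>n. id) g" using act_deq[OF P] by blast
  then show ?thesis by simp
qed

text \<open>The action is composition in the derived category: lifting along s agrees with composing
  with the inverse of s, because s becomes invertible there.\<close>

lemma act_dcomp:
  "wf_term a \<Longrightarrow> act P a u v \<Longrightarrow> dclass a \<cdot> dmap P u (src a) = dmap P v (tgt a)"
proof (induction a arbitrary: u v)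
  case (Chain X f Y)
  then have c: "chain_map P u X" "chain_map X f Y" "hq P Y (\<lambda>n. f n \<circ> u n) v" by auto
  then show ?case
    using dmap_comp[OF c(1,2)] dmap_homotopic[of P "\<lambda>n. f n \<circ> u n" Y v] by (simp add: hq_def)
next
  case (Inv X s Y)
  then have q: "quasi_iso X s Y" and c: "chain_map P v X" "hq P Y (\<lambda>n. s n \<circ> v n) u" by auto
  have "dmap P u Y = dmap X s Y \<cdot> dmap P v X"
    using dmap_comp[OF c(1) quasi_isoD(1)[OF q]] dmap_homotopic[of P "\<lambda>n. s n \<circ> v n" Y u] c(2)
    by (simp add: hq_def)
  then show ?case
    using dcomp_cancel[OF dmap_hom[OF quasi_isoD(1)[OF q]] dinv_hom[OF q] dinv_left[OF q] dmap_hom[OF c(1)]]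
    by (simp add: dinv_def)
next
  case (Comp b a)
  then obtain w where w: "act P a u w" "act P b w v" by auto
  have u: "chain_map P u (src a)" using act_chain[OF w(1)] by simp
  have "dclass (Comp b a) \<cdot> dmap P u (src a) = dclass b \<cdot> dclass a \<cdot> dmap P u (src a)"
    using Comp.prems(1) dcomp_assoc[OF dmap_hom[OF u] dhomI[of a] dhomI[of b], of "tgt a" "tgt b"]
    by (simp add: dcomp_dclass)
  then show ?case using Comp w by auto
qed

text \<open>Any word, however many formal inverses it contains, becomes an honest chain map after
  composition with a chain map out of P.\<close>

lemma dmap_full:
  assumes P: "kproj P" and "\<phi> \<in> dhom X Y" and u: "chain_map P u X"
  obtains v where "chain_map P v Y" "\<phi> \<cdot> dmap P u X = dmap P v Y"
proof -
  obtain a where a: "\<phi> = dclass a" "wf_term a" "src a = X" "tgt a = Y" using assms(2) by (rule dhomE)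
  obtain v where "act P a u v" using act_total[OF P a(2)] u a(3) by blast
  then show ?thesis using act_dcomp[OF a(2)] act_chain[of P a u v] a that by auto
qed

section \<open>Based complexes and matrices\<close>

text \<open>
  A complex of free modules with a chosen homogeneous basis: \<open>dg j\<close> is the degree of the \<open>j\<close>-th basis
  element, \<open>df\<close> the matrix of the differential, \<open>cd n v\<close> the coordinates of \<open>v\<close> in degree \<open>n\<close>
  (zero at the basis elements of other degrees), and \<open>cmb n\<close> the linear combination with given
  coordinates.
\<close>

record (overloaded) ('k::field) based =
  cx :: "'k poly cplx"
  rk :: nat
  dg :: "nat \<Rightarrow> int"
  df :: "nat \<Rightarrow> nat \<Rightarrow> 'k poly"
  cd :: "int \<Rightarrow> 'k poly elt \<Rightarrow> nat \<Rightarrow> 'k poly"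
  cmb :: "int \<Rightarrow> (nat \<Rightarrow> 'k poly) \<Rightarrow> 'k poly elt"

text \<open>All degrees share one index set, so that a graded map is a single matrix rather than a
  family of matrices. Coordinates in degree n vanish at indices of other degrees, and
  \<open>cmb\<close> discards such coefficients.\<close>

definition is_based :: "'k::field based \<Rightarrow> bool" where
  "is_based P \<longleftrightarrow> bounded_complex (cx P) \<and>
    (\<forall>n. \<forall>v\<in>el (cx P) n. \<forall>w\<in>el (cx P) n. \<forall>i.
       cd P n (v \<oplus>\<^bsub>obj (cx P) n\<^esub> w) i = cd P n v i + cd P n w i) \<and>
    (\<forall>n. \<forall>v\<in>el (cx P) n. \<forall>p i. cd P n (p \<odot>\<^bsub>obj (cx P) n\<^esub> v) i = p * cd P n v i) \<and>
    (\<forall>n c. cmb P n c \<in> el (cx P) n) \<and>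
    (\<forall>n c i. cd P n (cmb P n c) i = (if i < rk P \<and> dg P i = n then c i else 0)) \<and>
    (\<forall>n. \<forall>v\<in>el (cx P) n. cmb P n (cd P n v) = v) \<and>
    (\<forall>n. \<forall>v\<in>el (cx P) n. \<forall>i<rk P.
       cd P (n + 1) (diff (cx P) n v) i = (\<Sum>j<rk P. df P i j * cd P n v j))"

lemma basedD:
  assumes "is_based P"
  shows "bounded_complex (cx P)"
    "v \<in> el (cx P) n \<Longrightarrow> w \<in> el (cx P) n \<Longrightarrow>
       cd P n (v \<oplus>\<^bsub>obj (cx P) n\<^esub> w) i = cd P n v i + cd P n w i"
    "v \<in> el (cx P) n \<Longrightarrow> cd P n (p \<odot>\<^bsub>obj (cx P) n\<^esub> v) i = p * cd P n v i"
    "cmb P n c \<in> el (cx P) n"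
    "cd P n (cmb P n c) i = (if i < rk P \<and> dg P i = n then c i else 0)"
    "v \<in> el (cx P) n \<Longrightarrow> cmb P n (cd P n v) = v"
    "v \<in> el (cx P) n \<Longrightarrow> i < rk P \<Longrightarrow>
       cd P (n + 1) (diff (cx P) n v) i = (\<Sum>j<rk P. df P i j * cd P n v j)"
  using assms unfolding is_based_def by blast+

lemma cd_supp:
  assumes "is_based P" "v \<in> el (cx P) n" "\<not> (i < rk P \<and> dg P i = n)"
  shows "cd P n v i = 0"
  using basedD(5)[OF assms(1), of n "cd P n v" i] basedD(6)[OF assms(1,2)] assms(3) by simp

lemma cd_zero:
  assumes "is_based P" shows "cd P n \<zero>\<^bsub>obj (cx P) n\<^esub> i = 0"
  using basedD(3)[OF assms, of "\<zero>\<^bsub>obj (cx P) n\<^esub>" n 0 i] basedD(1)[OF assms] by simp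

lemma cd_neg:
  assumes "is_based P" "v \<in> el (cx P) n"
  shows "cd P n (\<ominus>\<^bsub>obj (cx P) n\<^esub> v) i = - cd P n v i"
  using basedD(3)[OF assms, of "-1" i] basedD(1)[OF assms(1)] assms(2) by (simp add: mod_smult)

lemma cd_inj:
  assumes "is_based P" "v \<in> el (cx P) n" "w \<in> el (cx P) n"
    and "\<And>i. i < rk P \<Longrightarrow> dg P i = n \<Longrightarrow> cd P n v i = cd P n w i"
  shows "v = w"
proof -
  have "cd P n v i = cd P n w i" for i
    using assms(4)[of i] cd_supp[OF assms(1,2), of i] cd_supp[OF assms(1,3), of i] by argo
  then have "cd P n v = cd P n w" by blast
  then show ?thesis using basedD(6)[OF assms(1,2)] basedD(6)[OF assms(1,3)] by metis
qed

definition unit_vec :: "nat \<Rightarrow> nat \<Rightarrow> 'k::field poly" where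
  "unit_vec j i = (if i = j then 1 else 0)"

text \<open>Induction on the number of coordinates kept: passing from m to m + 1 adds a multiple of
  one unit vector. The hypothesis \<open>cong\<close> says that coordinates from r on have no
  influence.\<close>

lemma linear_functional:
  fixes g :: "(nat \<Rightarrow> 'k::field poly) \<Rightarrow> 'k poly"
  assumes add: "\<And>c c'. g (\<lambda>i. c i + c' i) = g c + g c'"
    and mult: "\<And>p c. g (\<lambda>i. p * c i) = p * g c"
    and cong: "\<And>c c'. (\<And>i. i < r \<Longrightarrow> c i = c' i) \<Longrightarrow> g c = g c'"
  shows "g c = (\<Sum>j<r. c j * g (unit_vec j))"
proof -
  have "g (\<lambda>i. if i < m then c i else 0) = (\<Sum>j<m. c j * g (unit_vec j))" for m
  proof (induction m)
    case 0
    show ?case using mult[of 0 c] by simp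
  next
    case (Suc m)
    have "(\<lambda>i. if i < Suc m then c i else 0) = (\<lambda>i. (if i < m then c i else 0) + c m * unit_vec m i)"
      by (auto simp: unit_vec_def fun_eq_iff less_Suc_eq)
    then show ?case using Suc by (simp add: add mult)
  qed
  moreover have "g c = g (\<lambda>i. if i < r then c i else 0)" by (rule cong) simp
  ultimately show ?thesis by simp
qed

lemma cmb_add:
  assumes "is_based P"
  shows "cmb P n (\<lambda>i. c i + c' i) = cmb P n c \<oplus>\<^bsub>obj (cx P) n\<^esub> cmb P n c'"
  using basedD(1,4)[OF assms]
  by (intro cd_inj[where n = n, OF assms]) (simp_all add: basedD(2,5)[OF assms])

lemma cmb_mult:
  assumes "is_based P"
  shows "cmb P n (\<lambda>i. p * c i) = p \<odot>\<^bsub>obj (cx P) n\<^esub> cmb P n c"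
  using basedD(1,4)[OF assms]
  by (intro cd_inj[where n = n, OF assms]) (simp_all add: basedD(3,5)[OF assms])

lemma cmb_cong:
  assumes "is_based P" "\<And>i. i < rk P \<Longrightarrow> c i = c' i"
  shows "cmb P n c = cmb P n c'"
  using assms(2) by (intro cd_inj[where n = n, OF assms(1)]) (simp_all add: basedD(4,5)[OF assms(1)])

lemma linear_coords:
  assumes P: "is_based P" and Q: "is_based Q"
    and F: "linear_map (obj (cx P) n) (obj (cx Q) m) F" and v: "v \<in> el (cx P) n"
  shows "cd Q m (F v) i = (\<Sum>j<rk P. cd P n v j * cd Q m (F (cmb P n (unit_vec j))) i)"
proof -
  have "cd Q m (F (cmb P n c)) i = (\<Sum>j<rk P. c j * cd Q m (F (cmb P n (unit_vec j))) i)" for c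
  proof (rule linear_functional[where g = "\<lambda>c. cd Q m (F (cmb P n c)) i"])
    show "cd Q m (F (cmb P n (\<lambda>i. c i + c' i))) i = cd Q m (F (cmb P n c)) i + cd Q m (F (cmb P n c')) i" for c c'
      using lin_closed[OF F] by (simp add: cmb_add[OF P] lin_add[OF F] basedD(4)[OF P] basedD(2)[OF Q])
    show "cd Q m (F (cmb P n (\<lambda>i. p * c i))) i = p * cd Q m (F (cmb P n c)) i" for p c
      using lin_closed[OF F] by (simp add: cmb_mult[OF P] lin_smult[OF F] basedD(4)[OF P] basedD(3)[OF Q])
  qed (use cmb_cong[OF P] in metis)
  from this[of "cd P n v"] show ?thesis by (simp add: basedD(6)[OF P v])
qed

text \<open>The arguments \<open>m\<close> and \<open>n\<close> are the degrees of the target and the source.\<close>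

definition mxm :: "'k::field based \<Rightarrow> 'k based \<Rightarrow> (nat \<Rightarrow> nat \<Rightarrow> 'k poly) \<Rightarrow> int \<Rightarrow> int \<Rightarrow> 'k poly elt \<Rightarrow> 'k poly elt" where
  "mxm P Q M m n v = cmb Q m (\<lambda>i. \<Sum>j<rk P. M i j * cd P n v j)"

definition mx :: "'k::field based \<Rightarrow> 'k based \<Rightarrow> (nat \<Rightarrow> nat \<Rightarrow> 'k poly) \<Rightarrow> 'k poly gmap" where
  "mx P Q M n = mxm P Q M n n"

text \<open>Since \<open>cmb\<close> discards coefficients of the wrong degree, only matrices
  supported in one degree shift k are faithful pictures of graded maps; under this condition
  products of matrices correspond to composites of maps.\<close>

definition dcond :: "int \<Rightarrow> 'k::field based \<Rightarrow> 'k based \<Rightarrow> (nat \<Rightarrow> nat \<Rightarrow> 'k poly) \<Rightarrow> bool" where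
  "dcond k P Q M \<longleftrightarrow> (\<forall>i<rk Q. \<forall>j<rk P. M i j \<noteq> 0 \<longrightarrow> dg Q i = dg P j + k)"

definition mm :: "nat \<Rightarrow> (nat \<Rightarrow> nat \<Rightarrow> 'k::field poly) \<Rightarrow> (nat \<Rightarrow> nat \<Rightarrow> 'k poly) \<Rightarrow> nat \<Rightarrow> nat \<Rightarrow> 'k poly" where
  "mm r N M i j = (\<Sum>k<r. N i k * M k j)"

definition chainmat :: "'k::field based \<Rightarrow> 'k based \<Rightarrow> (nat \<Rightarrow> nat \<Rightarrow> 'k poly) \<Rightarrow> bool" where
  "chainmat P Q M \<longleftrightarrow> dcond 0 P Q M \<and>
    (\<forall>i<rk Q. \<forall>j<rk P. mm (rk Q) (df Q) M i j = mm (rk P) M (df P) i j)"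

definition mhtp :: "'k::field based \<Rightarrow> 'k based \<Rightarrow> (nat \<Rightarrow> nat \<Rightarrow> 'k poly) \<Rightarrow> (nat \<Rightarrow> nat \<Rightarrow> 'k poly) \<Rightarrow> bool" where
  "mhtp P Q M N \<longleftrightarrow> (\<exists>H. dcond (-1) P Q H \<and>
    (\<forall>i<rk Q. \<forall>j<rk P. M i j = N i j + (mm (rk Q) (df Q) H i j + mm (rk P) H (df P) i j)))"

lemma mxm_closed [simp]: "is_based Q \<Longrightarrow> mxm P Q M m n v \<in> el (cx Q) m"
  by (simp add: mxm_def basedD(4))

lemma linear_mxm:
  assumes P: "is_based P" and Q: "is_based Q"
  shows "linear_map (obj (cx P) n) (obj (cx Q) m) (mxm P Q M m n)"
  unfolding mxm_def
  by (intro linear_mapI)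
    (simp_all add: basedD(4)[OF Q] basedD(2,3)[OF P] cmb_add[OF Q, symmetric] cmb_mult[OF Q, symmetric]
      distrib_left sum.distrib sum_distrib_left mult.left_commute)

lemma cd_mxm:
  assumes P: "is_based P" and Q: "is_based Q" and M: "dcond k P Q M" and v: "v \<in> el (cx P) n"
    and m: "m = n + k" and i: "i < rk Q"
  shows "cd Q m (mxm P Q M m n v) i = (\<Sum>j<rk P. M i j * cd P n v j)"
proof (cases "dg Q i = m")
  case True
  then show ?thesis using i by (simp add: mxm_def basedD(5)[OF Q])
next
  case False
  have "M i j * cd P n v j = 0" if "j < rk P" for j
    using M i that False m cd_supp[OF P v, of j] by (auto simp: dcond_def)
  then have "(\<Sum>j<rk P. M i j * cd P n v j) = 0" by (intro sum.neutral) auto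
  then show ?thesis using False by (simp add: mxm_def basedD(5)[OF Q])
qed

lemma cd_mxm_unit:
  assumes P: "is_based P" and Q: "is_based Q" and M: "dcond k P Q M"
    and i: "i < rk Q" and j: "j < rk P" and m: "m = dg P j + k"
  shows "cd Q m (mxm P Q M m (dg P j) (cmb P (dg P j) (unit_vec j))) i = M i j"
proof -
  have "(\<Sum>l<rk P. M i l * cd P (dg P j) (cmb P (dg P j) (unit_vec j)) l) = (\<Sum>l<rk P. if l = j then M i l else 0)"
    using j by (intro sum.cong) (auto simp: basedD(5)[OF P] unit_vec_def)
  then show ?thesis using j by (simp add: cd_mxm[OF P Q M basedD(4)[OF P] m i])
qed

lemma mxm_eq_iff:
  assumes P: "is_based P" and Q: "is_based Q" and M: "dcond k P Q M" and N: "dcond k P Q N"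
    and eq: "\<And>i j. i < rk Q \<Longrightarrow> j < rk P \<Longrightarrow> M i j = N i j" and v: "v \<in> el (cx P) n" and m: "m = n + k"
  shows "mxm P Q M m n v = mxm P Q N m n v"
  by (rule cd_inj[where n = m, OF Q]) (simp_all add: Q cd_mxm[OF P Q M v m] cd_mxm[OF P Q N v m] eq)

lemma sum_mm:
  fixes N M :: "nat \<Rightarrow> nat \<Rightarrow> 'k::field poly"
  shows "(\<Sum>k<r. N i k * (\<Sum>j<s. M k j * c j)) = (\<Sum>j<s. mm r N M i j * c j)"
  unfolding mm_def sum_distrib_left sum_distrib_right
  by (subst sum.swap) (simp add: mult.assoc)

lemma dcond_mm:
  assumes "dcond k P Q M" "dcond l Q S N" shows "dcond (k + l) P S (mm (rk Q) N M)"
  unfolding dcond_def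
proof (intro allI impI)
  fix i j assume i: "i < rk S" and j: "j < rk P" and "mm (rk Q) N M i j \<noteq> 0"
  then obtain q where "q < rk Q" "N i q * M q j \<noteq> 0"
    unfolding mm_def by (meson lessThan_iff sum.not_neutral_contains_not_neutral)
  then have "dg Q q = dg P j + k" "dg S i = dg Q q + l" using assms i j by (auto simp: dcond_def)
  then show "dg S i = dg P j + (k + l)" by simp
qed

lemma mxm_comp:
  assumes P: "is_based P" and Q: "is_based Q" and S: "is_based S"
    and M: "dcond k P Q M" and N: "dcond l Q S N" and v: "v \<in> el (cx P) n"
    and m: "m = n + k" and m': "m' = m + l"
  shows "mxm Q S N m' m (mxm P Q M m n v) = mxm P S (mm (rk Q) N M) m' n v"
proof (rule cd_inj[OF S])
  fix i assume i: "i < rk S"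
  have v': "mxm P Q M m n v \<in> el (cx Q) m" using Q by simp
  have "cd S m' (mxm Q S N m' m (mxm P Q M m n v)) i = (\<Sum>q<rk Q. N i q * (\<Sum>j<rk P. M q j * cd P n v j))"
    by (simp add: cd_mxm[OF Q S N v' m' i] cd_mxm[OF P Q M v m])
  also have "\<dots> = cd S m' (mxm P S (mm (rk Q) N M) m' n v) i"
    using m m' by (subst cd_mxm[OF P S dcond_mm[OF M N] v _ i]) (simp_all add: sum_mm)
  finally show "cd S m' (mxm Q S N m' m (mxm P Q M m n v)) i = cd S m' (mxm P S (mm (rk Q) N M) m' n v) i" .
qed (use S in simp_all)

text \<open>The entry in row i and column j is the i-th coordinate of the differential of the j-th
  basis element, taken in degree \<open>dg P j + 1\<close>, and this coordinate is zero unless i has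
  that degree.\<close>

lemma df_dcond:
  assumes P: "is_based P" shows "dcond 1 P P (df P)"
  unfolding dcond_def
proof (intro allI impI)
  fix i j assume i: "i < rk P" and j: "j < rk P" and ne: "df P i j \<noteq> 0"
  let ?v = "cmb P (dg P j) (unit_vec j)"
  have "cd P (dg P j + 1) (diff (cx P) (dg P j) ?v) i = (\<Sum>l<rk P. if l = j then df P i l else 0)"
    using j by (subst basedD(7)[OF P basedD(4)[OF P] i], intro sum.cong) (auto simp: basedD(5)[OF P] unit_vec_def)
  then have "cd P (dg P j + 1) (diff (cx P) (dg P j) ?v) i \<noteq> 0" using ne j by simp
  then show "dg P i = dg P j + 1"
    using cd_supp[OF P, of _ "dg P j + 1" i] i basedD(1,4)[OF P] bc_closed by blast
qed

lemma diff_mxm: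
  assumes P: "is_based P" and v: "v \<in> el (cx P) n"
  shows "diff (cx P) n v = mxm P P (df P) (n + 1) n v"
  using basedD(1)[OF P] v
  by (intro cd_inj[where n = "n + 1", OF P])
    (simp_all add: P basedD(7)[OF P v] cd_mxm[OF P P df_dcond[OF P] v])

lemma diff_mxm':
  assumes P: "is_based P" and v: "v \<in> el (cx P) n" and "m = n + 1"
  shows "diff (cx P) n v = mxm P P (df P) m n v"
  using diff_mxm[OF P v] assms by simp

lemma chain_mx:
  assumes P: "is_based P" and Q: "is_based Q" and M: "chainmat P Q M"
  shows "chain_map (cx P) (mx P Q M) (cx Q)"
proof (rule chain_mapI)
  fix n v assume v: "v \<in> el (cx P) n"
  have d: "dcond 0 P Q M" and e: "\<And>i j. i < rk Q \<Longrightarrow> j < rk P \<Longrightarrow> mm (rk Q) (df Q) M i j = mm (rk P) M (df P) i j"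
    using M by (auto simp: chainmat_def)
  have "diff (cx Q) n (mx P Q M n v) = mxm Q Q (df Q) (n + 1) n (mxm P Q M n n v)"
    using Q by (simp add: mx_def diff_mxm)
  also have "\<dots> = mxm P Q (mm (rk Q) (df Q) M) (n + 1) n v"
    by (rule mxm_comp[OF P Q Q d df_dcond[OF Q] v]) simp_all
  also have "\<dots> = mxm P Q (mm (rk P) M (df P)) (n + 1) n v"
    using dcond_mm[OF d df_dcond[OF Q]] dcond_mm[OF df_dcond[OF P] d] e v
    by (intro mxm_eq_iff[OF P Q, where k = 1]) simp_all
  also have "\<dots> = mxm P Q M (n + 1) (n + 1) (mxm P P (df P) (n + 1) n v)"
    by (rule mxm_comp[OF P P Q df_dcond[OF P] d v, symmetric]) simp_all
  finally show "diff (cx Q) n (mx P Q M n v) = mx P Q M (n + 1) (diff (cx P) n v)"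
    using P v by (simp add: mx_def diff_mxm)
qed (use P Q in \<open>simp_all add: basedD(1) mx_def linear_mxm\<close>)

lemma matrix_of_linear:
  assumes P: "is_based P" and Q: "is_based Q"
    and F: "\<And>n. linear_map (obj (cx P) n) (obj (cx Q) (n + k)) (F n)"
  obtains M where "dcond k P Q M"
    "\<And>n m v. v \<in> el (cx P) n \<Longrightarrow> m = n + k \<Longrightarrow> F n v = mxm P Q M m n v"
proof -
  \<comment> \<open>Column j is computed in the one degree in which the j-th basis element lives; in
    every other degree its coordinate is zero, so the same matrix serves all degrees.\<close>
  define M where "M i j = cd Q (dg P j + k) (F (dg P j) (cmb P (dg P j) (unit_vec j))) i" for i j
  have M: "dcond k P Q M"
    unfolding dcond_def M_def using lin_closed[OF F] basedD(4)[OF P] cd_supp[OF Q] by blast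
  moreover have "F n v = mxm P Q M m n v" if v: "v \<in> el (cx P) n" and m: "m = n + k" for n m v
  proof (rule cd_inj[OF Q])
    fix i assume i: "i < rk Q"
    have "cd P n v j * cd Q m (F n (cmb P n (unit_vec j))) i = M i j * cd P n v j" if "j < rk P" for j
      using cd_supp[OF P v, of j] m by (cases "dg P j = n") (auto simp: M_def)
    then show "cd Q m (F n v) i = cd Q m (mxm P Q M m n v) i"
      unfolding linear_coords[OF P Q F[of n, folded m] v] cd_mxm[OF P Q M v m i] by (intro sum.cong) simp_all
  qed (use lin_closed[OF F v] m Q in simp_all)
  ultimately show ?thesis using that by blast
qed

text \<open>Evaluation at the j-th basis element, in its own degree, returns the j-th
  column.\<close>

lemma mxm_inj:
  assumes P: "is_based P" and Q: "is_based Q" and M: "dcond k P Q M" and N: "dcond k P Q N"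
    and eq: "\<And>n m v. v \<in> el (cx P) n \<Longrightarrow> m = n + k \<Longrightarrow> mxm P Q M m n v = mxm P Q N m n v"
    and ij: "i < rk Q" "j < rk P"
  shows "M i j = N i j"
  using cd_mxm_unit[OF P Q M ij, of "dg P j + k"] cd_mxm_unit[OF P Q N ij, of "dg P j + k"]
    eq[OF basedD(4)[OF P], of "dg P j + k"] by simp

lemma matrix_of_chain:
  assumes P: "is_based P" and Q: "is_based Q" and F: "chain_map (cx P) F (cx Q)"
  obtains M where "chainmat P Q M" "\<And>n v. v \<in> el (cx P) n \<Longrightarrow> F n v = mx P Q M n v"
proof -
  note D = chain_mapD[OF F]
  obtain M where M: "dcond 0 P Q M"
    and e: "\<And>n m v. v \<in> el (cx P) n \<Longrightarrow> m = n + 0 \<Longrightarrow> F n v = mxm P Q M m n v"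
    using matrix_of_linear[OF P Q, of 0 F] D(3) by auto
  have "mm (rk Q) (df Q) M i j = mm (rk P) M (df P) i j" if ij: "i < rk Q" "j < rk P" for i j
  proof (rule mxm_inj[OF P Q _ _ _ ij, where k = 1])
    show "dcond 1 P Q (mm (rk Q) (df Q) M)" using dcond_mm[OF M df_dcond[OF Q]] by simp
    show "dcond 1 P Q (mm (rk P) M (df P))" using dcond_mm[OF df_dcond[OF P] M] by simp
    fix n m v assume v: "v \<in> el (cx P) n" and m: "m = n + (1::int)"
    have "mxm P Q (mm (rk Q) (df Q) M) m n v = mxm Q Q (df Q) m n (mxm P Q M n n v)"
      using mxm_comp[OF P Q Q M df_dcond[OF Q] v] m by simp
    also have "\<dots> = diff (cx Q) n (F n v)"
      using e[OF v] diff_mxm'[OF Q _ m] Q by simp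
    also have "\<dots> = F m (diff (cx P) n v)" using D(4)[OF v] m by simp
    also have "\<dots> = mxm P Q M m m (mxm P P (df P) m n v)"
      using e[of "diff (cx P) n v" m] m D(1) v diff_mxm'[OF P v m] P by simp
    also have "\<dots> = mxm P Q (mm (rk P) M (df P)) m n v"
      using mxm_comp[OF P P Q df_dcond[OF P] M v] m by simp
    finally show "mxm P Q (mm (rk Q) (df Q) M) m n v = mxm P Q (mm (rk P) M (df P)) m n v" .
  qed
  then show ?thesis using that[of M] M e by (simp add: chainmat_def mx_def)
qed

lemma dcond_plus:
  assumes "dcond k P Q M" "dcond k P Q N" shows "dcond k P Q (\<lambda>i j. M i j + N i j)"
  unfolding dcond_def
proof (intro allI impI)
  fix i j assume "i < rk Q" "j < rk P" "M i j + N i j \<noteq> 0"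
  moreover from this have "M i j \<noteq> 0 \<or> N i j \<noteq> 0" by auto
  ultimately show "dg Q i = dg P j + k" using assms unfolding dcond_def by blast
qed

lemma mxm_plus:
  assumes P: "is_based P" and Q: "is_based Q"
    and M: "dcond k P Q M" and N: "dcond k P Q N" and v: "v \<in> el (cx P) n" and m: "m = n + k"
  shows "mxm P Q (\<lambda>i j. M i j + N i j) m n v = mxm P Q M m n v \<oplus>\<^bsub>obj (cx Q) m\<^esub> mxm P Q N m n v"
proof (rule cd_inj[OF Q])
  have MN: "dcond k P Q (\<lambda>i j. M i j + N i j)" using M N by (rule dcond_plus)
  show "cd Q m (mxm P Q (\<lambda>i j. M i j + N i j) m n v) i = cd Q m (mxm P Q M m n v \<oplus>\<^bsub>obj (cx Q) m\<^esub> mxm P Q N m n v) i"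
    if "i < rk Q" for i
    using that Q
    by (simp add: cd_mxm[OF P Q MN v m] cd_mxm[OF P Q M v m] cd_mxm[OF P Q N v m] basedD(2)[OF Q]
        distrib_right sum.distrib)
qed (use basedD(1)[OF Q] Q in simp_all)

text \<open>Differentials are matrix maps too, so the right side of the homotopy equation is the map
  of one matrix of degree 0; comparing maps and comparing entries are then the same.\<close>

lemma homotopic_mxm:
  assumes P: "is_based P" and Q: "is_based Q" and M: "chainmat P Q M" and N: "chainmat P Q N"
    and H: "dcond (-1) P Q H"
  shows "(\<forall>n. \<forall>v\<in>el (cx P) n. mx P Q M n v = mx P Q N n v \<oplus>\<^bsub>obj (cx Q) n\<^esub>
       (diff (cx Q) (n - 1) (mxm P Q H (n - 1) n v) \<oplus>\<^bsub>obj (cx Q) n\<^esub> mxm P Q H n (n + 1) (diff (cx P) n v))) \<longleftrightarrow>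
    (\<forall>i<rk Q. \<forall>j<rk P. M i j = N i j + (mm (rk Q) (df Q) H i j + mm (rk P) H (df P) i j))"
proof -
  let ?A = "mm (rk Q) (df Q) H" and ?B = "mm (rk P) H (df P)"
  have dM: "dcond 0 P Q M" and dN: "dcond 0 P Q N" using M N by (simp_all add: chainmat_def)
  have dA: "dcond 0 P Q ?A" using dcond_mm[OF H df_dcond[OF Q]] by simp
  have dB: "dcond 0 P Q ?B" using dcond_mm[OF df_dcond[OF P] H] by simp
  have dAB: "dcond 0 P Q (\<lambda>i j. ?A i j + ?B i j)" using dA dB by (rule dcond_plus)
  have dNAB: "dcond 0 P Q (\<lambda>i j. N i j + (?A i j + ?B i j))" using dN dAB by (rule dcond_plus)
  have r: "mx P Q N n v \<oplus>\<^bsub>obj (cx Q) n\<^esub>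
       (diff (cx Q) (n - 1) (mxm P Q H (n - 1) n v) \<oplus>\<^bsub>obj (cx Q) n\<^esub> mxm P Q H n (n + 1) (diff (cx P) n v)) =
      mxm P Q (\<lambda>i j. N i j + (?A i j + ?B i j)) n n v" if v: "v \<in> el (cx P) n" for n v
  proof -
    have "diff (cx Q) (n - 1) (mxm P Q H (n - 1) n v) = mxm P Q ?A n n v"
      using diff_mxm'[OF Q mxm_closed[OF Q], of n "n - 1"] mxm_comp[OF P Q Q H df_dcond[OF Q] v, of "n - 1" n] by simp
    moreover have "mxm P Q H n (n + 1) (diff (cx P) n v) = mxm P Q ?B n n v"
      using diff_mxm[OF P v] mxm_comp[OF P P Q df_dcond[OF P] H v, of "n + 1" n] by simp
    ultimately show ?thesis
      using mxm_plus[OF P Q dN dAB v, of n] mxm_plus[OF P Q dA dB v, of n] by (simp add: mx_def)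
  qed
  show ?thesis
  proof
    assume L: "\<forall>n. \<forall>v\<in>el (cx P) n. mx P Q M n v = mx P Q N n v \<oplus>\<^bsub>obj (cx Q) n\<^esub>
       (diff (cx Q) (n - 1) (mxm P Q H (n - 1) n v) \<oplus>\<^bsub>obj (cx Q) n\<^esub> mxm P Q H n (n + 1) (diff (cx P) n v))"
    show "\<forall>i<rk Q. \<forall>j<rk P. M i j = N i j + (?A i j + ?B i j)"
    proof (intro allI impI)
      fix i j assume ij: "i < rk Q" "j < rk P"
      have "mxm P Q M n n v = mxm P Q (\<lambda>i j. N i j + (?A i j + ?B i j)) n n v"
        if v: "v \<in> el (cx P) n" for n v
        using L[rule_format, OF v] unfolding r[OF v] by (simp add: mx_def)
      then show "M i j = N i j + (?A i j + ?B i j)"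
        by (intro mxm_inj[OF P Q dM dNAB _ ij]) simp
    qed
  next
    assume R: "\<forall>i<rk Q. \<forall>j<rk P. M i j = N i j + (?A i j + ?B i j)"
    show "\<forall>n. \<forall>v\<in>el (cx P) n. mx P Q M n v = mx P Q N n v \<oplus>\<^bsub>obj (cx Q) n\<^esub>
       (diff (cx Q) (n - 1) (mxm P Q H (n - 1) n v) \<oplus>\<^bsub>obj (cx Q) n\<^esub> mxm P Q H n (n + 1) (diff (cx P) n v))"
    proof (intro allI ballI)
      fix n v assume v: "v \<in> el (cx P) n"
      show "mx P Q M n v = mx P Q N n v \<oplus>\<^bsub>obj (cx Q) n\<^esub>
       (diff (cx Q) (n - 1) (mxm P Q H (n - 1) n v) \<oplus>\<^bsub>obj (cx Q) n\<^esub> mxm P Q H n (n + 1) (diff (cx P) n v))"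
        unfolding r[OF v] using R v by (simp add: mx_def mxm_eq_iff[OF P Q dM dNAB])
    qed
  qed
qed

text \<open>An arbitrary homotopy is a graded linear map of degree -1 and hence itself a matrix, so
  homotopy of matrix maps is solvability of a linear system over k[x].\<close>

lemma hq_mx_iff:
  assumes P: "is_based P" and Q: "is_based Q" and M: "chainmat P Q M" and N: "chainmat P Q N"
  shows "hq (cx P) (cx Q) (mx P Q M) (mx P Q N) \<longleftrightarrow> mhtp P Q M N"
proof
  assume "hq (cx P) (cx Q) (mx P Q M) (mx P Q N)"
  then obtain s where s: "homotopy (cx P) (cx Q) s" and e: "\<And>n v. v \<in> el (cx P) n \<Longrightarrow>
      mx P Q M n v = mx P Q N n v \<oplus>\<^bsub>obj (cx Q) n\<^esub>
       (diff (cx Q) (n - 1) (s n v) \<oplus>\<^bsub>obj (cx Q) n\<^esub> s (n + 1) (diff (cx P) n v))"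
    unfolding hq_def using homotopicE by blast
  obtain H where H: "dcond (-1) P Q H"
    and sH: "\<And>n m v. v \<in> el (cx P) n \<Longrightarrow> m = n + -1 \<Longrightarrow> s n v = mxm P Q H m n v"
    using matrix_of_linear[OF P Q, of "-1" s] homotopyD(1)[OF s] by auto
  have "s n v = mxm P Q H (n - 1) n v" if "v \<in> el (cx P) n" for n v
    using sH[OF that] by simp
  moreover have "s (n + 1) (diff (cx P) n v) = mxm P Q H n (n + 1) (diff (cx P) n v)" if "v \<in> el (cx P) n" for n v
    using sH[of "diff (cx P) n v" "n + 1" n] that basedD(1)[OF P] by simp
  ultimately show "mhtp P Q M N"
    unfolding mhtp_def using e H homotopic_mxm[OF P Q M N H] by auto
next
  assume "mhtp P Q M N"
  then obtain H where H: "dcond (-1) P Q H"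
    "\<forall>i<rk Q. \<forall>j<rk P. M i j = N i j + (mm (rk Q) (df Q) H i j + mm (rk P) H (df P) i j)"
    unfolding mhtp_def by blast
  have "homotopic (cx P) (cx Q) (mx P Q M) (mx P Q N)"
    using homotopic_mxm[OF P Q M N H(1)] H(2) linear_mxm[OF P Q]
    by (intro homotopicI[where s = "\<lambda>n. mxm P Q H (n - 1) n"]) (auto simp: homotopy_def)
  then show "hq (cx P) (cx Q) (mx P Q M) (mx P Q N)"
    using chain_mx[OF P Q] M N by (simp add: hq_def)
qed

lemma mx_comp:
  assumes "is_based P" "is_based Q" "is_based S" "chainmat P Q M" "chainmat Q S N" "v \<in> el (cx P) n"
  shows "mx Q S N n (mx P Q M n v) = mx P S (mm (rk Q) N M) n v"
  using assms unfolding mx_def chainmat_def by (intro mxm_comp) simp_all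

lemma mm_assoc: "mm r (mm s A B) C i j = mm s A (mm r B C) i j"
  unfolding mm_def sum_distrib_left sum_distrib_right by (subst sum.swap) (simp add: mult.assoc)

lemma mm_cong:
  "(\<And>k. k < r \<Longrightarrow> N i k = N' i k) \<Longrightarrow> (\<And>k. k < r \<Longrightarrow> M k j = M' k j) \<Longrightarrow> mm r N M i j = mm r N' M' i j"
  unfolding mm_def by (intro sum.cong) auto

lemma chainmat_mm:
  assumes M: "chainmat P Q M" and N: "chainmat Q S N"
  shows "chainmat P S (mm (rk Q) N M)"
proof -
  have "dcond 0 P S (mm (rk Q) N M)"
    using dcond_mm[of 0 P Q M 0 S N] M N by (simp add: chainmat_def)
  moreover have "mm (rk S) (df S) (mm (rk Q) N M) i j = mm (rk P) (mm (rk Q) N M) (df P) i j"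
    if "i < rk S" "j < rk P" for i j
  proof -
    have "mm (rk S) (df S) (mm (rk Q) N M) i j = mm (rk Q) (mm (rk S) (df S) N) M i j" by (simp add: mm_assoc)
    also have "\<dots> = mm (rk Q) (mm (rk Q) N (df Q)) M i j"
      using N that by (intro mm_cong) (simp_all add: chainmat_def)
    also have "\<dots> = mm (rk Q) N (mm (rk Q) (df Q) M) i j" by (simp add: mm_assoc)
    also have "\<dots> = mm (rk Q) N (mm (rk P) M (df P)) i j"
      using M that by (intro mm_cong) (simp_all add: chainmat_def)
    finally show ?thesis by (simp add: mm_assoc)
  qed
  ultimately show ?thesis by (simp add: chainmat_def)
qed

abbreviation dmx :: "'k::field based \<Rightarrow> 'k based \<Rightarrow> (nat \<Rightarrow> nat \<Rightarrow> 'k poly) \<Rightarrow> 'k poly dmor" where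
  "dmx P Q M \<equiv> dmap (cx P) (mx P Q M) (cx Q)"

lemma dmx_comp:
  assumes "is_based P" "is_based Q" "is_based S" "chainmat P Q M" "chainmat Q S N"
  shows "dmx Q S N \<cdot> dmx P Q M = dmx P S (mm (rk Q) N M)"
proof -
  have c: "chain_map (cx P) (mx P Q M) (cx Q)" "chain_map (cx Q) (mx Q S N) (cx S)"
    using assms by (simp_all add: chain_mx)
  have "dmap (cx P) (\<lambda>n. mx Q S N n \<circ> mx P Q M n) (cx S) = dmx P S (mm (rk Q) N M)"
    by (rule dmap_eq) (use assms c chain_map_comp[OF c] in \<open>simp_all add: chain_mx chainmat_mm mx_comp\<close>)
  then show ?thesis using dmap_comp[OF c] by simp
qed

lemma dmx_eq:
  assumes "is_based P" "is_based Q" "chainmat P Q M" "chainmat P Q N" "mhtp P Q M N"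
  shows "dmx P Q M = dmx P Q N"
  using hq_mx_iff[OF assms(1-4)] assms(5) by (intro dmap_homotopic) (simp_all add: hq_def)

subsection \<open>Shifts, sums and cones of based complexes\<close>

lemma sum_lessThan_add:
  fixes f :: "nat \<Rightarrow> 'a::comm_monoid_add"
  shows "(\<Sum>j<r + s. f j) = (\<Sum>j<r. f j) + (\<Sum>j<s. f (j + r))"
  by (induction s) (simp_all add: ac_simps)

definition blk :: "nat \<Rightarrow> nat \<Rightarrow> (nat \<Rightarrow> nat \<Rightarrow> 'k::field poly) \<Rightarrow> (nat \<Rightarrow> nat \<Rightarrow> 'k poly) \<Rightarrow>
    (nat \<Rightarrow> nat \<Rightarrow> 'k poly) \<Rightarrow> (nat \<Rightarrow> nat \<Rightarrow> 'k poly) \<Rightarrow> nat \<Rightarrow> nat \<Rightarrow> 'k poly" where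
  "blk r s A B C D i j = (if i < r then (if j < s then A i j else B i (j - s))
                          else (if j < s then C (i - r) j else D (i - r) (j - s)))"

abbreviation zmat :: "nat \<Rightarrow> nat \<Rightarrow> 'k::field poly" where
  "zmat \<equiv> \<lambda>i j. 0"

abbreviation nmat :: "(nat \<Rightarrow> nat \<Rightarrow> 'k::field poly) \<Rightarrow> nat \<Rightarrow> nat \<Rightarrow> 'k poly" where
  "nmat M \<equiv> \<lambda>i j. - M i j"

definition imat :: "nat \<Rightarrow> nat \<Rightarrow> 'k::field poly" where
  "imat i j = (if i = j then 1 else 0)"

definition bshift :: "'k::field based \<Rightarrow> 'k based" where
  "bshift P = \<lparr>cx = shift (cx P), rk = rk P, dg = (\<lambda>j. dg P j - 1), df = nmat (df P),
     cd = (\<lambda>n. cd P (n + 1)), cmb = (\<lambda>n. cmb P (n + 1))\<rparr>"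

definition bsum :: "'k::field based \<Rightarrow> 'k based \<Rightarrow> 'k based" where
  "bsum P Q = \<lparr>cx = dsum (cx P) (cx Q), rk = rk P + rk Q,
     dg = (\<lambda>j. if j < rk P then dg P j else dg Q (j - rk P)),
     df = blk (rk P) (rk P) (df P) zmat zmat (df Q),
     cd = (\<lambda>n v i. if i < rk P then cd P n (pfst v) i else cd Q n (psnd v) (i - rk P)),
     cmb = (\<lambda>n c. Pr (cmb P n c) (cmb Q n (\<lambda>i. c (i + rk P))))\<rparr>"

definition bcone :: "'k::field based \<Rightarrow> (nat \<Rightarrow> nat \<Rightarrow> 'k poly) \<Rightarrow> 'k based \<Rightarrow> 'k based" where
  "bcone P U Q = \<lparr>cx = cone (cx P) (mx P Q U) (cx Q), rk = rk P + rk Q,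
     dg = (\<lambda>j. if j < rk P then dg P j - 1 else dg Q (j - rk P)),
     df = blk (rk P) (rk P) (nmat (df P)) zmat U (df Q),
     cd = (\<lambda>n v i. if i < rk P then cd P (n + 1) (pfst v) i else cd Q n (psnd v) (i - rk P)),
     cmb = (\<lambda>n c. Pr (cmb P (n + 1) c) (cmb Q n (\<lambda>i. c (i + rk P))))\<rparr>"

lemma based_simps [simp]:
  "cx (bshift P) = shift (cx P)" "rk (bshift P) = rk P" "dg (bshift P) j = dg P j - 1" "df (bshift P) i j = - df P i j"
  "cd (bshift P) n = cd P (n + 1)" "cmb (bshift P) n = cmb P (n + 1)"
  "cx (bsum P Q) = dsum (cx P) (cx Q)" "rk (bsum P Q) = rk P + rk Q"
  "dg (bsum P Q) j = (if j < rk P then dg P j else dg Q (j - rk P))"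
  "df (bsum P Q) = blk (rk P) (rk P) (df P) zmat zmat (df Q)"
  "cd (bsum P Q) n v i = (if i < rk P then cd P n (pfst v) i else cd Q n (psnd v) (i - rk P))"
  "cmb (bsum P Q) n c = Pr (cmb P n c) (cmb Q n (\<lambda>i. c (i + rk P)))"
  "cx (bcone P U Q) = cone (cx P) (mx P Q U) (cx Q)" "rk (bcone P U Q) = rk P + rk Q"
  "dg (bcone P U Q) j = (if j < rk P then dg P j - 1 else dg Q (j - rk P))"
  "df (bcone P U Q) = blk (rk P) (rk P) (nmat (df P)) zmat U (df Q)"
  "cd (bcone P U Q) n v i = (if i < rk P then cd P (n + 1) (pfst v) i else cd Q n (psnd v) (i - rk P))"
  "cmb (bcone P U Q) n c = Pr (cmb P (n + 1) c) (cmb Q n (\<lambda>i. c (i + rk P)))"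
  by (simp_all add: bshift_def bsum_def bcone_def)

lemma is_based_shift:
  assumes P: "is_based P" shows "is_based (bshift P)"
proof -
  note D = basedD[OF P]
  have "cd P (n + 1 + 1) (\<ominus>\<^bsub>obj (cx P) (n + 1 + 1)\<^esub> diff (cx P) (n + 1) v) i = - (\<Sum>j<rk P. df P i j * cd P (n + 1) v j)"
    if "v \<in> el (cx P) (n + 1)" "i < rk P" for n v i
    using that D(1) D(7)[OF that] bc_closed[OF D(1) that(1)]
    by (subst cd_neg[OF P]) (simp_all del: add.assoc)
  moreover have "(dg P i - 1 = n) = (dg P i = n + 1)" for i n by auto
  ultimately show ?thesis
    unfolding is_based_def
    by (intro conjI) (auto simp: D(1-6) sum_negf simp del: add.assoc)
qed

lemma is_based_sum:
  assumes P: "is_based P" and Q: "is_based Q" shows "is_based (bsum P Q)"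
proof -
  note D = basedD[OF P] and E = basedD[OF Q]
  have s: "cd P n (pfst v) i = 0" if "v \<in> carrier (dsum_module (obj (cx P) n) (obj (cx Q) n))" "dg P i \<noteq> n" for n v i
    using that cd_supp[OF P] by (auto elim!: dsum_cases)
  have c: "cmb P n (cd (bsum P Q) n (Pr a b)) = a" if "a \<in> el (cx P) n" for n a b
    using cmb_cong[OF P, of "cd (bsum P Q) n (Pr a b)" "cd P n a" n] D(6)[OF that] by simp
  show ?thesis
    unfolding is_based_def
  proof (intro conjI allI ballI impI)
    fix n v i assume "v \<in> el (cx (bsum P Q)) n" and i: "i < rk (bsum P Q)"
    then obtain a b where v: "v = Pr a b" "a \<in> el (cx P) n" "b \<in> el (cx Q) n"
      by (auto elim!: dsum_cases)
    show "cd (bsum P Q) (n + 1) (diff (cx (bsum P Q)) n v) i = (\<Sum>j<rk (bsum P Q). df (bsum P Q) i j * cd (bsum P Q) n v j)"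
      using v i by (simp add: sum_lessThan_add blk_def D(7) E(7))
  qed (use D(1-6) E(1-6) in \<open>auto elim!: dsum_cases simp: c\<close>)
qed

lemma is_based_cone:
  assumes P: "is_based P" and Q: "is_based Q" and U: "chainmat P Q U" shows "is_based (bcone P U Q)"
proof -
  note D = basedD[OF P] and E = basedD[OF Q]
  have u: "chain_map (cx P) (mx P Q U) (cx Q)" by (rule chain_mx[OF P Q U])
  have dU: "dcond 0 P Q U" using U by (simp add: chainmat_def)
  have c: "cmb P (n + 1) (cd (bcone P U Q) n (Pr a b)) = a" if "a \<in> el (cx P) (n + 1)" for n a b
    using cmb_cong[OF P, of "cd (bcone P U Q) n (Pr a b)" "cd P (n + 1) a" "n + 1"] D(6)[OF that] by simp
  show ?thesis
    unfolding is_based_def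
  proof (intro conjI allI ballI impI)
    fix n v i assume "v \<in> el (cx (bcone P U Q)) n" and i: "i < rk (bcone P U Q)"
    then obtain a b where v: "v = Pr a b" "a \<in> el (cx P) (n + 1)" "b \<in> el (cx Q) n"
      by (auto elim!: dsum_cases)
    show "cd (bcone P U Q) (n + 1) (diff (cx (bcone P U Q)) n v) i = (\<Sum>j<rk (bcone P U Q). df (bcone P U Q) i j * cd (bcone P U Q) n v j)"
    proof (cases "i < rk P")
      case True
      then show ?thesis
        using v D(1) D(7)[OF v(2) True] cd_neg[OF P bc_closed[OF D(1) v(2)], of i]
        by (simp add: sum_lessThan_add blk_def sum_negf del: add.assoc)
    next
      case False
      then show ?thesis
        using v i E(1) chain_mapD(5)[OF u v(2)] E(7)[OF v(3), of "i - rk P"] cd_mxm[OF P Q dU v(2), of "n + 1" "i - rk P"]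
        by (simp add: sum_lessThan_add blk_def E(2) mx_def)
    qed
  next
    show "cd (bcone P U Q) n (cmb (bcone P U Q) n c) i = (if i < rk (bcone P U Q) \<and> dg (bcone P U Q) i = n then c i else 0)" for n c i
      using D(5)[of "n + 1" c i] E(5) by auto
  qed (use D(1-4,6) E(1-4,6) u in \<open>auto elim!: dsum_cases simp: c\<close>)
qed

lemma mx_shift [simp]: "mx (bshift P) (bshift Q) M = shift_map (mx P Q M)"
  by (simp add: mx_def mxm_def fun_eq_iff)

lemma chainmat_shift:
  assumes "chainmat P Q M" shows "chainmat (bshift P) (bshift Q) M"
  using assms by (auto simp: chainmat_def dcond_def mm_def sum_negf)

lemma dmx_shift: "is_based P \<Longrightarrow> is_based Q \<Longrightarrow> chainmat P Q M \<Longrightarrow> (dmx P Q M)\<langle>1\<rangle> = dmx (bshift P) (bshift Q) M"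
  by (simp add: dshift_dmap chain_mx)

text \<open>Coordinates determine the map, so a coordinate formula identifies a concretely given map
  with its matrix and yields the chain condition on that matrix as well. This is how the structural
  maps of sums and cones are translated.\<close>

lemma chain_map_matrix:
  assumes P: "is_based P" and Q: "is_based Q" and F: "chain_map (cx P) F (cx Q)"
    and e: "\<And>n v i. v \<in> el (cx P) n \<Longrightarrow> i < rk Q \<Longrightarrow> cd Q n (F n v) i = (\<Sum>j<rk P. M i j * cd P n v j)"
  shows "chainmat P Q M" "dmap (cx P) F (cx Q) = dmx P Q M"
proof -
  obtain N where N: "chainmat P Q N" "\<And>n v. v \<in> el (cx P) n \<Longrightarrow> F n v = mx P Q N n v"
    using matrix_of_chain[OF P Q F] by blast
  have dN: "dcond 0 P Q N" using N by (simp add: chainmat_def)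
  have MN: "M i j = N i j" if "i < rk Q" "j < rk P" for i j
  proof -
    let ?v = "cmb P (dg P j) (unit_vec j)"
    have "cd Q (dg P j) (F (dg P j) ?v) i = (\<Sum>l<rk P. if l = j then M i l else 0)"
      using that by (subst e[OF basedD(4)[OF P]], simp, intro sum.cong) (auto simp: basedD(5)[OF P] unit_vec_def)
    then show ?thesis
      using that cd_mxm_unit[OF P Q dN that, of "dg P j"] N(2)[OF basedD(4)[OF P], of "dg P j" "unit_vec j"]
      by (simp add: mx_def)
  qed
  have "mm r A M i j = mm r A N i j" "mm s M B i j = mm s N B i j"
    if "i < rk Q" "j < rk P" "r = rk Q" "s = rk P" for r s A B i j
    using that MN by (auto intro!: mm_cong)
  moreover have "mm r A M i j = mm r A N i j" if "r = rk Q" "j < rk P" for r A i j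
    using that MN by (auto intro!: mm_cong)
  ultimately show M: "chainmat P Q M"
    using N(1) MN unfolding chainmat_def dcond_def by (auto simp: MN)
  have dM: "dcond 0 P Q M" using M by (simp add: chainmat_def)
  show "dmap (cx P) F (cx Q) = dmx P Q M"
  proof (rule dmap_eq[OF F chain_mx[OF P Q M]])
    show "F n v = mx P Q M n v" if "v \<in> el (cx P) n" for n v
      unfolding N(2)[OF that] mx_def using MN that by (intro mxm_eq_iff[OF P Q dN dM]) simp_all
  qed
qed

text \<open>Matrices are total functions read only below the ranks, so \<open>imat\<close> serves as
  inclusion and projection for the first summand; the second summand needs an offset by the rank of
  the first.\<close>

definition in2mat :: "nat \<Rightarrow> nat \<Rightarrow> nat \<Rightarrow> 'k::field poly" where "in2mat r i j = imat i (j + r)"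
definition pr2mat :: "nat \<Rightarrow> nat \<Rightarrow> nat \<Rightarrow> 'k::field poly" where "pr2mat r i j = imat (i + r) j"

lemma sum_imat [simp]:
  "(\<Sum>j<r. imat i j * c j) = (if i < r then c i else 0)"
  "(\<Sum>j<r. imat i (j + s) * c j) = (if s \<le> i \<and> i < r + s then c (i - s) else (0::'k::field poly))"
proof -
  show "(\<Sum>j<r. imat i j * c j) = (if i < r then c i else 0)"
    by (simp add: imat_def if_distrib[of "\<lambda>x. x * _"] cong: if_cong)
  have "(\<Sum>j<r. imat i (j + s) * c j) = (\<Sum>j<r. if j = i - s then (if s \<le> i then c (i - s) else 0) else 0)"
    by (intro sum.cong) (auto simp: imat_def)
  then show "(\<Sum>j<r. imat i (j + s) * c j) = (if s \<le> i \<and> i < r + s then c (i - s) else 0)"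
    by auto
qed

lemma sum_imat':
  "(\<Sum>j<r. c j * imat j k) = (if k < r then c k else (0::'k::field poly))"
  by (simp add: imat_def if_distrib[of "\<lambda>x. _ * x"] cong: if_cong)

lemma chain_in1:
  "bounded_complex X \<Longrightarrow> bounded_complex Y \<Longrightarrow> chain_map X (\<lambda>n v. Pr v \<zero>\<^bsub>obj Y n\<^esub>) (dsum X Y)"
  by (intro chain_mapI linear_mapI) simp_all

lemma chain_in2:
  "bounded_complex X \<Longrightarrow> bounded_complex Y \<Longrightarrow> chain_map Y (\<lambda>n v. Pr \<zero>\<^bsub>obj X n\<^esub> v) (dsum X Y)"
  by (intro chain_mapI linear_mapI) simp_all

lemma chain_pr1:
  "bounded_complex X \<Longrightarrow> bounded_complex Y \<Longrightarrow> chain_map (dsum X Y) (\<lambda>n. pfst) X"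
  by (intro chain_mapI) (auto simp: linear_map_pfst)

lemma chain_pr2:
  "bounded_complex X \<Longrightarrow> bounded_complex Y \<Longrightarrow> chain_map (dsum X Y) (\<lambda>n. psnd) Y"
  by (intro chain_mapI) (auto simp: linear_map_psnd)

lemma chain_cone_in:
  "chain_map X u Y \<Longrightarrow> chain_map Y (\<lambda>n v. Pr \<zero>\<^bsub>obj X (n + 1)\<^esub> v) (cone X u Y)"
  by (intro chain_mapI linear_mapI) (auto simp: chain_mapD(1,2,8)[of X u Y])

lemma chain_cone_out:
  "chain_map X u Y \<Longrightarrow> chain_map (cone X u Y) (\<lambda>n. pfst) (shift X)"
  by (intro chain_mapI) (auto simp: linear_map_pfst chain_mapD(1,2))

lemma structure_matrices:
  assumes P: "is_based P" and Q: "is_based Q"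
  shows "chainmat P (bsum P Q) imat" "din1 (cx P) (cx Q) = dmx P (bsum P Q) imat"
    "chainmat Q (bsum P Q) (in2mat (rk P))" "din2 (cx P) (cx Q) = dmx Q (bsum P Q) (in2mat (rk P))"
    "chainmat (bsum P Q) P imat" "dpr1 (cx P) (cx Q) = dmx (bsum P Q) P imat"
    "chainmat (bsum P Q) Q (pr2mat (rk P))" "dpr2 (cx P) (cx Q) = dmx (bsum P Q) Q (pr2mat (rk P))"
proof -
  note D = basedD(1)[OF P] basedD(1)[OF Q] and B = is_based_sum[OF P Q]
  note [simp] = cd_zero[OF P] cd_zero[OF Q]
  note c1 = chain_map_matrix[OF P B, where F = "\<lambda>n v. Pr v \<zero>\<^bsub>obj (cx Q) n\<^esub>" and M = imat]
    and c2 = chain_map_matrix[OF Q B, where F = "\<lambda>n v. Pr \<zero>\<^bsub>obj (cx P) n\<^esub> v" and M = "in2mat (rk P)"]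
    and c3 = chain_map_matrix[OF B P, where F = "\<lambda>n. pfst" and M = imat]
    and c4 = chain_map_matrix[OF B Q, where F = "\<lambda>n. psnd" and M = "pr2mat (rk P)"]
  show "chainmat P (bsum P Q) imat" "din1 (cx P) (cx Q) = dmx P (bsum P Q) imat"
    unfolding din1_def using chain_in1[OF D] by (auto intro!: c1[simplified])
  show "chainmat Q (bsum P Q) (in2mat (rk P))" "din2 (cx P) (cx Q) = dmx Q (bsum P Q) (in2mat (rk P))"
    unfolding din2_def using chain_in2[OF D] by (auto intro!: c2[simplified] simp: in2mat_def)
  show "chainmat (bsum P Q) P imat" "dpr1 (cx P) (cx Q) = dmx (bsum P Q) P imat"
    unfolding dpr1_def using chain_pr1[OF D] by (auto intro!: c3[simplified])
  show "chainmat (bsum P Q) Q (pr2mat (rk P))" "dpr2 (cx P) (cx Q) = dmx (bsum P Q) Q (pr2mat (rk P))"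
    unfolding dpr2_def using chain_pr2[OF D] by (auto intro!: c4[simplified] simp: pr2mat_def)
qed

lemma cone_matrices:
  assumes P: "is_based P" and Q: "is_based Q" and U: "chainmat P Q U"
  shows "chainmat Q (bcone P U Q) (in2mat (rk P))"
    "cone_in (cx P) (mx P Q U) (cx Q) = dmx Q (bcone P U Q) (in2mat (rk P))"
    "chainmat (bcone P U Q) (bshift P) imat"
    "cone_out (cx P) (mx P Q U) (cx Q) = dmx (bcone P U Q) (bshift P) imat"
proof -
  note u = chain_mx[OF P Q U] and B = is_based_cone[OF P Q U]
  note [simp] = cd_zero[OF P] cd_zero[OF Q]
  note c2 = chain_map_matrix[OF Q B, where F = "\<lambda>n v. Pr \<zero>\<^bsub>obj (cx P) (n + 1)\<^esub> v" and M = "in2mat (rk P)"]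
    and c3 = chain_map_matrix[OF B is_based_shift[OF P], where F = "\<lambda>n. pfst" and M = imat]
  show "chainmat Q (bcone P U Q) (in2mat (rk P))"
    "cone_in (cx P) (mx P Q U) (cx Q) = dmx Q (bcone P U Q) (in2mat (rk P))"
    unfolding cone_in_def using chain_cone_in[OF u] by (auto intro!: c2[simplified] simp: in2mat_def)
  show "chainmat (bcone P U Q) (bshift P) imat"
    "cone_out (cx P) (mx P Q U) (cx Q) = dmx (bcone P U Q) (bshift P) imat"
    unfolding cone_out_def using chain_cone_out[OF u] by (auto intro!: c3[simplified])
qed

lemma id_matrix:
  assumes P: "is_based P" shows "chainmat P P imat" "did (cx P) = dmx P P imat"
  using chain_map_matrix[OF P P, where F = "\<lambda>n. id" and M = imat] basedD(1)[OF P] by auto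

section \<open>Homotopically projective complexes\<close>

definition two_term :: "'k::field based \<Rightarrow> bool" where
  "two_term P \<longleftrightarrow> is_based P \<and> rk P = 2 \<and> dg P 1 = dg P 0 - 1"

text \<open>A chain map out of a two-term complex amounts to the images y0, y1 of its generators,
  subject to d y0 = 0 and d y1 = p y0; the value is zero in all other degrees.\<close>

definition tt_map :: "'k::field based \<Rightarrow> 'k poly cplx \<Rightarrow> 'k poly elt \<Rightarrow> 'k poly elt \<Rightarrow> 'k poly gmap" where
  "tt_map P Y y0 y1 n v = (if n = dg P 0 then cd P n v 0 \<odot>\<^bsub>obj Y n\<^esub> y0
     else if n = dg P 0 - 1 then cd P n v 1 \<odot>\<^bsub>obj Y n\<^esub> y1 else \<zero>\<^bsub>obj Y n\<^esub>)"

context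
  fixes P :: "'k::field based" and d :: int and p :: "'k poly" and e0 e1 :: "'k poly elt"
  assumes T: "two_term P"
  defines "d \<equiv> dg P 0" and "p \<equiv> df P 0 1" and "e0 \<equiv> cmb P (dg P 0) (unit_vec 0)"
    and "e1 \<equiv> cmb P (dg P 0 - 1) (unit_vec 1)"
begin

lemma tt_based: "is_based P" using T by (simp add: two_term_def)

lemma tt_bc: "bounded_complex (cx P)" using basedD(1)[OF tt_based] .

lemma tt_supp: "i < rk P \<and> dg P i = n \<longleftrightarrow> (i = 0 \<and> n = d) \<or> (i = 1 \<and> n = d - 1)"
  using T by (auto simp: two_term_def d_def less_2_cases_iff)

lemma tt_basis:
  "e0 \<in> el (cx P) d" "e1 \<in> el (cx P) (d - 1)"
  "cd P d e0 0 = 1" "cd P (d - 1) e1 1 = 1"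
  using basedD(4)[OF tt_based] tt_supp[of 0 d] tt_supp[of 1 "d - 1"] unfolding e0_def e1_def d_def
  by (simp_all add: basedD(5)[OF tt_based] unit_vec_def)

lemma tt_expand:
  "v \<in> el (cx P) d \<Longrightarrow> v = cd P d v 0 \<odot>\<^bsub>obj (cx P) d\<^esub> e0"
  "v \<in> el (cx P) (d - 1) \<Longrightarrow> v = cd P (d - 1) v 1 \<odot>\<^bsub>obj (cx P) (d - 1)\<^esub> e1"
  "v \<in> el (cx P) n \<Longrightarrow> n \<noteq> d \<Longrightarrow> n \<noteq> d - 1 \<Longrightarrow> v = \<zero>\<^bsub>obj (cx P) n\<^esub>"
proof -
  show "v = cd P d v 0 \<odot>\<^bsub>obj (cx P) d\<^esub> e0" if v: "v \<in> el (cx P) d"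
  proof (rule cd_inj[OF tt_based v])
    show "cd P d v i = cd P d (cd P d v 0 \<odot>\<^bsub>obj (cx P) d\<^esub> e0) i" if "i < rk P" "dg P i = d" for i
    proof -
      have "i = 0" using tt_supp[of i d] that by auto
      then show ?thesis using tt_basis by (simp add: basedD(3)[OF tt_based])
    qed
  qed (use tt_bc tt_basis in simp)
  show "v = cd P (d - 1) v 1 \<odot>\<^bsub>obj (cx P) (d - 1)\<^esub> e1" if v: "v \<in> el (cx P) (d - 1)"
  proof (rule cd_inj[OF tt_based v])
    show "cd P (d - 1) v i = cd P (d - 1) (cd P (d - 1) v 1 \<odot>\<^bsub>obj (cx P) (d - 1)\<^esub> e1) i" if "i < rk P" "dg P i = d - 1" for i
    proof -
      have "i = 1" using tt_supp[of i "d - 1"] that by auto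
      then show ?thesis using basedD(3)[OF tt_based tt_basis(2)] tt_basis(4) by (simp del: One_nat_def)
    qed
  qed (use tt_bc tt_basis in simp)
  show "v = \<zero>\<^bsub>obj (cx P) n\<^esub>" if v: "v \<in> el (cx P) n" and n: "n \<noteq> d" "n \<noteq> d - 1"
    by (rule cd_inj[OF tt_based v]) (use tt_bc tt_supp n in auto)
qed

text \<open>For degree reasons the differential has a single entry that can be nonzero, namely p
  from the generator in degree d - 1 to the one in degree d.\<close>

lemma tt_cd_diff:
  assumes "v \<in> el (cx P) n"
  shows "cd P (n + 1) (diff (cx P) n v) 0 = p * cd P n v 1" "cd P (n + 1) (diff (cx P) n v) 1 = 0"
proof -
  have r: "rk P = 2" using T by (simp add: two_term_def)
  have "df P i j = 0" if "i < 2" "j < 2" "dg P i \<noteq> dg P j + 1" for i j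
    using df_dcond[OF tt_based] that r unfolding dcond_def by metis
  from this[of 0 0] this[of 1 0] this[of 1 1] have z: "df P 0 0 = 0" "df P 1 0 = 0" "df P 1 1 = 0"
    using T by (simp_all add: two_term_def)
  show "cd P (n + 1) (diff (cx P) n v) 0 = p * cd P n v 1" "cd P (n + 1) (diff (cx P) n v) 1 = 0"
    using basedD(7)[OF tt_based assms, of 0] basedD(7)[OF tt_based assms, of 1] r z
    by (simp_all add: p_def numeral_2_eq_2)
qed

lemma tt_diff: "diff (cx P) d e0 = \<zero>\<^bsub>obj (cx P) (d + 1)\<^esub>" "diff (cx P) (d - 1) e1 = p \<odot>\<^bsub>obj (cx P) d\<^esub> e0"
proof -
  show "diff (cx P) d e0 = \<zero>\<^bsub>obj (cx P) (d + 1)\<^esub>"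
    using tt_bc tt_basis by (intro tt_expand(3)) simp_all
  show "diff (cx P) (d - 1) e1 = p \<odot>\<^bsub>obj (cx P) d\<^esub> e0"
    using tt_expand(1)[of "diff (cx P) (d - 1) e1"] tt_cd_diff(1)[OF tt_basis(2)] tt_bc tt_basis by simp
qed

lemma tt_chain:
  assumes Y: "bounded_complex Y" and y: "y0 \<in> el Y d" "y1 \<in> el Y (d - 1)"
    and e: "diff Y d y0 = \<zero>\<^bsub>obj Y (d + 1)\<^esub>" "diff Y (d - 1) y1 = p \<odot>\<^bsub>obj Y d\<^esub> y0"
  shows "chain_map (cx P) (tt_map P Y y0 y1) Y" "tt_map P Y y0 y1 d e0 = y0" "tt_map P Y y0 y1 (d - 1) e1 = y1"
proof -
  show "chain_map (cx P) (tt_map P Y y0 y1) Y"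
  proof (rule chain_mapI[OF tt_bc Y])
    show "linear_map (obj (cx P) n) (obj Y n) (tt_map P Y y0 y1 n)" for n
      using Y y by (intro linear_mapI)
        (auto simp: tt_map_def d_def[symmetric] basedD(2,3)[OF tt_based] km)
    show "diff Y n (tt_map P Y y0 y1 n v) = tt_map P Y y0 y1 (n + 1) (diff (cx P) n v)"
      if v: "v \<in> el (cx P) n" for n v
    proof -
      have t: "tt_map P Y y0 y1 m w = (if m = d then cd P m w 0 \<odot>\<^bsub>obj Y m\<^esub> y0
          else if m = d - 1 then cd P m w 1 \<odot>\<^bsub>obj Y m\<^esub> y1 else \<zero>\<^bsub>obj Y m\<^esub>)" for m w
        by (simp add: tt_map_def d_def)
      \<comment> \<open>These are the degrees in which one of the generators can contribute. For d =
        n + 2 the target lies in degree d - 1, where coordinate 1 of a differential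
        vanishes.\<close>
      consider "d = n" | "d = n + 1" | "d = n + 2" | "d \<noteq> n" "d \<noteq> n + 1" "d \<noteq> n + 2" by blast
      then show ?thesis
      proof cases
        case 1
        then show ?thesis using Y y(1) e(1) by (simp add: t bc_smult)
      next
        case 2
        have y': "y0 \<in> el Y (n + 1)" "y1 \<in> el Y n" "diff Y n y1 = p \<odot>\<^bsub>obj Y (n + 1)\<^esub> y0"
          using y e(2) 2 by simp_all
        have "diff Y n (cd P n v 1 \<odot>\<^bsub>obj Y n\<^esub> y1) = (cd P n v 1 * p) \<odot>\<^bsub>obj Y (n + 1)\<^esub> y0"
          using Y y' bc_smult[OF Y y'(2)] by (simp add: mod_smult)
        then show ?thesis using 2 tt_cd_diff(1)[OF v] by (simp add: t mult.commute)
      next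
        case 3
        have "d - 1 = n + 1" using 3 by simp
        then have "y1 \<in> el Y (n + 1)" using y(2) by metis
        then show ?thesis using 3 Y tt_cd_diff(2)[OF v] by (simp add: t)
      next
        case 4
        then show ?thesis using Y by (simp add: t)
      qed
    qed
  qed
  show "tt_map P Y y0 y1 d e0 = y0" "tt_map P Y y0 y1 (d - 1) e1 = y1"
    using Y y tt_basis by (simp_all add: tt_map_def d_def[symmetric])
qed

text \<open>A homotopy out of a two-term complex is likewise given by two elements b0, b1, and it is
  enough to test it on the generators. The term p b0 is its value on d e1 = p e0.\<close>

lemma tt_hq:
  assumes f: "chain_map (cx P) f Y" and g: "chain_map (cx P) g Y"
    and b: "b0 \<in> el Y (d - 1)" "b1 \<in> el Y (d - 2)"
    and e0: "f d e0 = g d e0 \<oplus>\<^bsub>obj Y d\<^esub> diff Y (d - 1) b0"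
    and e1: "f (d - 1) e1 = g (d - 1) e1 \<oplus>\<^bsub>obj Y (d - 1)\<^esub> (diff Y (d - 2) b1 \<oplus>\<^bsub>obj Y (d - 1)\<^esub> p \<odot>\<^bsub>obj Y (d - 1)\<^esub> b0)"
  shows "hq (cx P) Y f g"
proof -
  note F = chain_mapD[OF f] and G = chain_mapD[OF g]
  note Y = F(2)
  define s where "s n v = (if n = d then cd P n v 0 \<odot>\<^bsub>obj Y (n - 1)\<^esub> b0
     else if n = d - 1 then cd P n v 1 \<odot>\<^bsub>obj Y (n - 1)\<^esub> b1 else \<zero>\<^bsub>obj Y (n - 1)\<^esub>)" for n v
  have "homotopic (cx P) Y f g"
  proof (rule homotopicI)
    show "homotopy (cx P) Y s"
      unfolding homotopy_def using Y b
      by (intro allI linear_mapI) (auto simp: s_def basedD(2,3)[OF tt_based] km)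
    fix n v assume v: "v \<in> el (cx P) n"
    show "f n v = g n v \<oplus>\<^bsub>obj Y n\<^esub> (diff Y (n - 1) (s n v) \<oplus>\<^bsub>obj Y n\<^esub> s (n + 1) (diff (cx P) n v))"
    proof -
      consider "n = d" | "n = d - 1" | "n \<noteq> d" "n \<noteq> d - 1" by blast
      then show ?thesis
      proof cases
        case 1
        define c where "c = cd P d v 0"
        have v': "v = c \<odot>\<^bsub>obj (cx P) d\<^esub> e0" using tt_expand(1) v 1 by (simp add: c_def)
        have fe: "f d v = c \<odot>\<^bsub>obj Y d\<^esub> f d e0" "g d v = c \<odot>\<^bsub>obj Y d\<^esub> g d e0"
          unfolding v' using F(7) G(7) tt_basis(1) by blast+
        have "g d e0 \<in> el Y d" using G(5) tt_basis(1) by blast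
        then show ?thesis
          using Y b 1 by (simp add: fe e0 s_def c_def[symmetric] bc_pred_lin mod_smult)
      next
        case 2
        define c where "c = cd P (d - 1) v 1"
        have v': "v = c \<odot>\<^bsub>obj (cx P) (d - 1)\<^esub> e1" using tt_expand(2) v 2 by (simp add: c_def)
        have fe: "f (d - 1) v = c \<odot>\<^bsub>obj Y (d - 1)\<^esub> f (d - 1) e1" "g (d - 1) v = c \<odot>\<^bsub>obj Y (d - 1)\<^esub> g (d - 1) e1"
          unfolding v' using F(7) G(7) tt_basis(2) by blast+
        have c0: "cd P (d - 1) v (Suc 0) = c" by (simp add: c_def)
        have c1: "cd P d (diff (cx P) (d - 1) v) 0 = c * p"
          using tt_cd_diff(1)[OF v] 2 by (simp add: c_def mult.commute)
        have ge: "g (d - 1) e1 \<in> el Y (d - 1)" using G(5) tt_basis(2) by blast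
        have db: "diff Y (d - 2) b1 \<in> el Y (d - 1)" using Y b by simp
        have "diff Y (d - 2) (c \<odot>\<^bsub>obj Y (d - 2)\<^esub> b1) = c \<odot>\<^bsub>obj Y (d - 1)\<^esub> diff Y (d - 2) b1"
          using bc_smult[OF Y b(2), of c] by simp
        then show ?thesis
          using Y b 2 ge db by (simp add: fe e1 s_def c0 c1 mod_smult)
      next
        case 3
        have v0: "v = \<zero>\<^bsub>obj (cx P) n\<^esub>" using tt_expand(3) v 3 by blast
        show ?thesis
          unfolding v0 using Y b 3 tt_bc bc_zero[OF Y, of "n - 1"]
          by (auto simp: F(8) G(8) s_def cd_zero[OF tt_based])
      qed
    qed
  qed
  then show ?thesis using f g by (simp add: hq_def)
qed

text \<open>Lifts and homotopies are constructed one generator at a time, starting in degree d.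
  Freeness lets the images be chosen, injectivity on cohomology produces a candidate in the next
  degree, and surjectivity corrects it by a cocycle.\<close>

lemma kproj_two_term: "kproj (cx P)"
  unfolding kproj_def
proof (intro conjI allI impI tt_bc)
  fix X Y :: "'k poly cplx" and s :: "'k poly gmap"
  assume qs: "quasi_iso X s Y"
  note Q = quasi_isoD[OF qs]
  note S = chain_mapD[OF Q(1)]
  note X = S(1) and Y = S(2)
  {
    fix u assume u: "chain_map (cx P) u Y"
    note U = chain_mapD[OF u]
    define y0 y1 where "y0 = u d e0" and "y1 = u (d - 1) e1"
    have y: "y0 \<in> el Y d" "y1 \<in> el Y (d - 1)"
      using U(5) tt_basis by (simp_all add: y0_def y1_def)
    have dy0: "diff Y d y0 = \<zero>\<^bsub>obj Y (d + 1)\<^esub>"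
      using U(4)[OF tt_basis(1)] U(8) by (simp add: y0_def tt_diff)
    have dy1: "diff Y (d - 1) y1 = p \<odot>\<^bsub>obj Y d\<^esub> y0"
      using U(4)[OF tt_basis(2)] U(7)[OF tt_basis(1)] by (simp add: y1_def y0_def tt_diff)
    obtain x0 b0 where x0: "x0 \<in> el X d" "diff X d x0 = \<zero>\<^bsub>obj X (d + 1)\<^esub>"
      and b0: "b0 \<in> el Y (d - 1)" "y0 = s d x0 \<oplus>\<^bsub>obj Y d\<^esub> diff Y (d - 1) b0"
      using Q(3)[OF y(1) dy0] by blast
    \<comment> \<open>Subtracting p b0 turns d y1 = p y0 into an equation whose right side is the
      image of p x0, so injectivity on cohomology makes p x0 a coboundary in X.\<close>
    let ?w = "y1 \<oplus>\<^bsub>obj Y (d - 1)\<^esub> \<ominus>\<^bsub>obj Y (d - 1)\<^esub> (p \<odot>\<^bsub>obj Y (d - 1)\<^esub> b0)"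
    have dw: "diff Y (d - 1) ?w = s d (p \<odot>\<^bsub>obj X d\<^esub> x0)"
      using X Y y b0 x0 S(5)[OF x0(1)] by (simp add: bc_pred_lin dy1 S(7) km)
    obtain x' where x': "x' \<in> el X (d - 1)" "p \<odot>\<^bsub>obj X d\<^esub> x0 = diff X (d - 1) x'"
      using Q(2)[of "p \<odot>\<^bsub>obj X d\<^esub> x0" d ?w] X Y x0 y b0 dw by (auto simp: bc_smult)
    \<comment> \<open>The element \<open>x'\<close> need not lie over the corrected y1, but the
      defect is a cocycle, and surjectivity on cohomology in degree d - 1 supplies the correction
      \<open>c\<close>.\<close>
    let ?w' = "?w \<oplus>\<^bsub>obj Y (d - 1)\<^esub> \<ominus>\<^bsub>obj Y (d - 1)\<^esub> s (d - 1) x'"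
    have w': "?w' \<in> el Y (d - 1)" "diff Y (d - 1) ?w' = \<zero>\<^bsub>obj Y d\<^esub>"
    proof -
      have 1: "?w \<in> el Y (d - 1)" "s (d - 1) x' \<in> el Y (d - 1)"
        using Y y b0 x' S(5) by simp_all
      show "?w' \<in> el Y (d - 1)" using 1 Y by simp
      have "diff Y (d - 1) ?w' = diff Y (d - 1) ?w \<oplus>\<^bsub>obj Y d\<^esub> \<ominus>\<^bsub>obj Y d\<^esub> diff Y (d - 1) (s (d - 1) x')"
        using 1 Y bc_pred_lin(1)[OF Y 1(2)] bc_pred_lin(2)[OF Y 1(1), of "\<ominus>\<^bsub>obj Y (d - 1)\<^esub> s (d - 1) x'"] by simp
      also have "\<dots> = \<zero>\<^bsub>obj Y d\<^esub>"
        unfolding dw using chain_pred[OF Q(1) x'(1)] x'(2) S(5)[of "diff X (d - 1) x'" d] X Y x'(1) by simp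
      finally show "diff Y (d - 1) ?w' = \<zero>\<^bsub>obj Y d\<^esub>" .
    qed
    obtain c b1 where c: "c \<in> el X (d - 1)" "diff X (d - 1) c = \<zero>\<^bsub>obj X d\<^esub>"
      and b1: "b1 \<in> el Y (d - 2)" "?w' = s (d - 1) c \<oplus>\<^bsub>obj Y (d - 1)\<^esub> diff Y (d - 2) b1"
      using Q(3)[OF w'(1)] w'(2) by auto
    define x1 where "x1 = x' \<oplus>\<^bsub>obj X (d - 1)\<^esub> c"
    have x1: "x1 \<in> el X (d - 1)" "diff X (d - 1) x1 = p \<odot>\<^bsub>obj X d\<^esub> x0"
      using X x' c x0 by (simp_all add: x1_def bc_pred_lin)
    note v = tt_chain[OF X x0(1) x1(1) x0(2) x1(2)]
    let ?v = "tt_map P X x0 x1"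
    have "hq (cx P) Y u (\<lambda>n. s n \<circ> ?v n)"
    proof (rule tt_hq[OF u chain_map_comp[OF v(1) Q(1)] b0(1) b1(1)])
      show "u d e0 = (s d \<circ> ?v d) e0 \<oplus>\<^bsub>obj Y d\<^esub> diff Y (d - 1) b0"
        using b0(2) by (simp add: v(2) y0_def)
      have 1: "s (d - 1) x' \<in> el Y (d - 1)" "s (d - 1) c \<in> el Y (d - 1)"
        "diff Y (d - 2) b1 \<in> el Y (d - 1)" "p \<odot>\<^bsub>obj Y (d - 1)\<^esub> b0 \<in> el Y (d - 1)"
        using S(5) x' c b1 b0 Y by simp_all
      have "y1 = (?w' \<oplus>\<^bsub>obj Y (d - 1)\<^esub> s (d - 1) x') \<oplus>\<^bsub>obj Y (d - 1)\<^esub> p \<odot>\<^bsub>obj Y (d - 1)\<^esub> b0"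
        using Y y 1 by (simp add: km)
      also have "\<dots> = s (d - 1) x1 \<oplus>\<^bsub>obj Y (d - 1)\<^esub> (diff Y (d - 2) b1 \<oplus>\<^bsub>obj Y (d - 1)\<^esub> p \<odot>\<^bsub>obj Y (d - 1)\<^esub> b0)"
        unfolding b1(2) x1_def S(6)[OF x'(1) c(1)] using Y 1 by (simp add: km)
      finally show "u (d - 1) e1 = (s (d - 1) \<circ> ?v (d - 1)) e1 \<oplus>\<^bsub>obj Y (d - 1)\<^esub>
         (diff Y (d - 2) b1 \<oplus>\<^bsub>obj Y (d - 1)\<^esub> p \<odot>\<^bsub>obj Y (d - 1)\<^esub> b0)"
        by (simp add: v(3) y1_def)
    qed
    then show "\<exists>v. chain_map (cx P) v X \<and> hq (cx P) Y (\<lambda>n. s n \<circ> v n) u" using v(1) hq_sym by blast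
  }
  {
    fix v v' assume v: "chain_map (cx P) v X" and v': "chain_map (cx P) v' X"
      and h: "hq (cx P) Y (\<lambda>n. s n \<circ> v n) (\<lambda>n. s n \<circ> v' n)"
    note V = chain_mapD[OF v] and V' = chain_mapD[OF v']
    obtain t where t: "homotopy (cx P) Y t" and e: "\<And>n w. w \<in> el (cx P) n \<Longrightarrow>
        s n (v n w) = s n (v' n w) \<oplus>\<^bsub>obj Y n\<^esub> (diff Y (n - 1) (t n w) \<oplus>\<^bsub>obj Y n\<^esub> t (n + 1) (diff (cx P) n w))"
      using h unfolding hq_def by (auto elim: homotopicE)
    define b0 b1 where "b0 = t d e0" and "b1 = t (d - 1) e1"
    have b: "b0 \<in> el Y (d - 1)" "b1 \<in> el Y (d - 2)"
      using homotopyD(2)[OF t tt_basis(1)] homotopyD(2)[OF t tt_basis(2)] by (simp_all add: b0_def b1_def)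
    define x0 x0' x1 x1' where "x0 = v d e0" and "x0' = v' d e0" and "x1 = v (d - 1) e1" and "x1' = v' (d - 1) e1"
    have x: "x0 \<in> el X d" "x0' \<in> el X d" "x1 \<in> el X (d - 1)" "x1' \<in> el X (d - 1)"
      using V(5) V'(5) tt_basis by (simp_all add: x0_def x0'_def x1_def x1'_def)
    have dx0: "diff X d x0 = \<zero>\<^bsub>obj X (d + 1)\<^esub>" "diff X d x0' = \<zero>\<^bsub>obj X (d + 1)\<^esub>"
      using V(4)[OF tt_basis(1)] V'(4)[OF tt_basis(1)] V(8) V'(8) by (simp_all add: x0_def x0'_def tt_diff)
    have dx1: "diff X (d - 1) x1 = p \<odot>\<^bsub>obj X d\<^esub> x0" "diff X (d - 1) x1' = p \<odot>\<^bsub>obj X d\<^esub> x0'"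
      using V(4)[OF tt_basis(2)] V(7)[OF tt_basis(1)] V'(4)[OF tt_basis(2)] V'(7)[OF tt_basis(1)]
      by (simp_all add: x1_def x0_def x1'_def x0'_def tt_diff)
    have sx: "s d x0 \<in> el Y d" "s d x0' \<in> el Y d"
      "s (d - 1) x1 \<in> el Y (d - 1)" "s (d - 1) x1' \<in> el Y (d - 1)"
      using x S(5) by simp_all
    have "t (d + 1) \<zero>\<^bsub>obj (cx P) (d + 1)\<^esub> = \<zero>\<^bsub>obj Y d\<^esub>"
      using lin_zero[OF homotopyD(1)[OF t, of "d + 1"]] tt_bc Y by simp
    then have s0: "s d x0 = s d x0' \<oplus>\<^bsub>obj Y d\<^esub> diff Y (d - 1) b0"
      using e[OF tt_basis(1)] Y b by (simp add: x0_def x0'_def b0_def tt_diff)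
    have "t d (p \<odot>\<^bsub>obj (cx P) d\<^esub> e0) = p \<odot>\<^bsub>obj Y (d - 1)\<^esub> b0"
      using homotopyD(6)[OF t tt_basis(1)] by (simp add: b0_def)
    then have s1: "s (d - 1) x1 = s (d - 1) x1' \<oplus>\<^bsub>obj Y (d - 1)\<^esub> (diff Y (d - 2) b1 \<oplus>\<^bsub>obj Y (d - 1)\<^esub> p \<odot>\<^bsub>obj Y (d - 1)\<^esub> b0)"
      using e[OF tt_basis(2)] by (simp add: x1_def x1'_def b1_def tt_diff)
    let ?u0 = "x0 \<oplus>\<^bsub>obj X d\<^esub> \<ominus>\<^bsub>obj X d\<^esub> x0'" and ?u1 = "x1 \<oplus>\<^bsub>obj X (d - 1)\<^esub> \<ominus>\<^bsub>obj X (d - 1)\<^esub> x1'"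
    have u0: "?u0 \<in> el X d" "diff X d ?u0 = \<zero>\<^bsub>obj X (d + 1)\<^esub>" "s d ?u0 = diff Y (d - 1) b0"
      using X Y x sx b by (simp_all add: bc_add bc_neg dx0 S(6,9) s0 km)
    obtain a' where a': "a' \<in> el X (d - 1)" "?u0 = diff X (d - 1) a'"
      using Q(2)[OF u0(1,2) b(1) u0(3)] by blast
    \<comment> \<open>The element \<open>a'\<close> bounds the difference in degree d but need not
      lie over b0. The defect is a cocycle; subtracting a lift of its class leaves only the
      coboundary of \<open>b'\<close>.\<close>
    let ?w = "s (d - 1) a' \<oplus>\<^bsub>obj Y (d - 1)\<^esub> \<ominus>\<^bsub>obj Y (d - 1)\<^esub> b0"
    have sa: "s (d - 1) a' \<in> el Y (d - 1)" using S(5) a' by simp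
    have w: "?w \<in> el Y (d - 1)" "diff Y (d - 1) ?w = \<zero>\<^bsub>obj Y d\<^esub>"
      using Y sa b u0(3) a' chain_pred[OF Q(1) a'(1)] by (simp_all add: bc_pred_lin)
    obtain c b' where c: "c \<in> el X (d - 1)" "diff X (d - 1) c = \<zero>\<^bsub>obj X d\<^esub>"
      and b': "b' \<in> el Y (d - 2)" "?w = s (d - 1) c \<oplus>\<^bsub>obj Y (d - 1)\<^esub> diff Y (d - 2) b'"
      using Q(3)[OF w(1)] w(2) by auto
    have db': "diff Y (d - 2) b' \<in> el Y (d - 1)" "diff Y (d - 2) b1 \<in> el Y (d - 1)"
      using Y b'(1) b by simp_all
    have sc: "s (d - 1) c \<in> el Y (d - 1)" using S(5) c by simp
    define a0 where "a0 = a' \<oplus>\<^bsub>obj X (d - 1)\<^esub> \<ominus>\<^bsub>obj X (d - 1)\<^esub> c"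
    have a0: "a0 \<in> el X (d - 1)" "diff X (d - 1) a0 = ?u0"
      using X a' c u0(1) by (simp_all add: a0_def bc_pred_lin)
    have "s (d - 1) a' = ?w \<oplus>\<^bsub>obj Y (d - 1)\<^esub> b0" using Y sa b by (simp add: km)
    then have sa0: "s (d - 1) a0 = b0 \<oplus>\<^bsub>obj Y (d - 1)\<^esub> diff Y (d - 2) b'"
      unfolding b'(2) a0_def using X Y a' c b sc db' by (simp add: S(6,9) km)
    \<comment> \<open>What remains of the second generator after using a0 is a cocycle, and its
      image is the differential of b1 - p b'; injectivity on cohomology then gives the second
      component of the homotopy.\<close>
    let ?z = "?u1 \<oplus>\<^bsub>obj X (d - 1)\<^esub> \<ominus>\<^bsub>obj X (d - 1)\<^esub> (p \<odot>\<^bsub>obj X (d - 1)\<^esub> a0)"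
    have z: "?z \<in> el X (d - 1)" using X x a0 by simp
    have dz: "diff X (d - 1) ?z = \<zero>\<^bsub>obj X d\<^esub>"
      using X x a0 by (simp add: bc_pred_lin dx1 km)
    let ?b = "b1 \<oplus>\<^bsub>obj Y (d - 2)\<^esub> \<ominus>\<^bsub>obj Y (d - 2)\<^esub> (p \<odot>\<^bsub>obj Y (d - 2)\<^esub> b')"
    have dbb: "diff Y (d - 2) ?b = diff Y (d - 2) b1 \<oplus>\<^bsub>obj Y (d - 1)\<^esub> \<ominus>\<^bsub>obj Y (d - 1)\<^esub> (p \<odot>\<^bsub>obj Y (d - 1)\<^esub> diff Y (d - 2) b')"
      using Y b b'(1) bc_pred_lin[OF Y, of _ "d - 1"] by simp
    have sz: "s (d - 1) ?z = diff Y (d - 2) ?b"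
      unfolding dbb using X Y x a0 b sx db' by (simp add: S(6,7,9) s1 sa0 km)
    obtain a1 where a1: "a1 \<in> el X (d - 2)" "?z = diff X (d - 2) a1"
      using Q(2)[of ?z "d - 1" ?b] z dz sz Y b b'(1) by auto
    show "hq (cx P) X v v'"
    proof (rule tt_hq[OF v v' a0(1) a1(1)])
      show "v d e0 = v' d e0 \<oplus>\<^bsub>obj X d\<^esub> diff X (d - 1) a0"
        unfolding a0(2) x0_def[symmetric] x0'_def[symmetric] using X x by (simp add: km)
      show "v (d - 1) e1 = v' (d - 1) e1 \<oplus>\<^bsub>obj X (d - 1)\<^esub> (diff X (d - 2) a1 \<oplus>\<^bsub>obj X (d - 1)\<^esub> p \<odot>\<^bsub>obj X (d - 1)\<^esub> a0)"
        unfolding a1(2)[symmetric] x1_def[symmetric] x1'_def[symmetric] using X x a0 by (simp add: km)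
    qed
  }
qed

end

section \<open>Direct sums of homotopically projective complexes\<close>

lemma hq_sum_source:
  assumes f: "chain_map (dsum P Q) f Y" and g: "chain_map (dsum P Q) g Y"
    and P: "bounded_complex P" and Q: "bounded_complex Q"
    and h1: "hq P Y (\<lambda>n v. f n (Pr v \<zero>\<^bsub>obj Q n\<^esub>)) (\<lambda>n v. g n (Pr v \<zero>\<^bsub>obj Q n\<^esub>))"
    and h2: "hq Q Y (\<lambda>n v. f n (Pr \<zero>\<^bsub>obj P n\<^esub> v)) (\<lambda>n v. g n (Pr \<zero>\<^bsub>obj P n\<^esub> v))"
  shows "hq (dsum P Q) Y f g"
proof -
  note F = chain_mapD[OF f] and G = chain_mapD[OF g]
  obtain s where s: "homotopy P Y s" and e: "\<And>n v. v \<in> el P n \<Longrightarrow>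
        f n (Pr v \<zero>\<^bsub>obj Q n\<^esub>) = g n (Pr v \<zero>\<^bsub>obj Q n\<^esub>) \<oplus>\<^bsub>obj Y n\<^esub> (diff Y (n - 1) (s n v) \<oplus>\<^bsub>obj Y n\<^esub> s (n + 1) (diff P n v))"
    using h1 unfolding hq_def by (auto elim: homotopicE)
  obtain t where t: "homotopy Q Y t" and e': "\<And>n v. v \<in> el Q n \<Longrightarrow>
        f n (Pr \<zero>\<^bsub>obj P n\<^esub> v) = g n (Pr \<zero>\<^bsub>obj P n\<^esub> v) \<oplus>\<^bsub>obj Y n\<^esub> (diff Y (n - 1) (t n v) \<oplus>\<^bsub>obj Y n\<^esub> t (n + 1) (diff Q n v))"
    using h2 unfolding hq_def by (auto elim: homotopicE)
  have "homotopic (dsum P Q) Y f g"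
  proof (rule homotopicI[where s = "\<lambda>n v. s n (pfst v) \<oplus>\<^bsub>obj Y (n - 1)\<^esub> t n (psnd v)"])
    show "homotopy (dsum P Q) Y (\<lambda>n v. s n (pfst v) \<oplus>\<^bsub>obj Y (n - 1)\<^esub> t n (psnd v))"
      unfolding homotopy_def dsum_simps using homotopyD(1)[OF s] homotopyD(1)[OF t] F(2)
      by (intro allI linear_map_row) simp_all
    fix n v assume "v \<in> el (dsum P Q) n"
    then obtain a b where v: "v = Pr a b" and a: "a \<in> el P n" and b: "b \<in> el Q n"
      by (auto elim!: dsum_cases)
    have "Pr a b = Pr a \<zero>\<^bsub>obj Q n\<^esub> \<oplus>\<^bsub>obj (dsum P Q) n\<^esub> Pr \<zero>\<^bsub>obj P n\<^esub> b"
      using P Q a b by simp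
    then have fv: "f n v = f n (Pr a \<zero>\<^bsub>obj Q n\<^esub>) \<oplus>\<^bsub>obj Y n\<^esub> f n (Pr \<zero>\<^bsub>obj P n\<^esub> b)"
      and gv: "g n v = g n (Pr a \<zero>\<^bsub>obj Q n\<^esub>) \<oplus>\<^bsub>obj Y n\<^esub> g n (Pr \<zero>\<^bsub>obj P n\<^esub> b)"
      using F(6)[of "Pr a \<zero>\<^bsub>obj Q n\<^esub>" n "Pr \<zero>\<^bsub>obj P n\<^esub> b"] G(6)[of "Pr a \<zero>\<^bsub>obj Q n\<^esub>" n "Pr \<zero>\<^bsub>obj P n\<^esub> b"] P Q a b
      by (simp_all add: v)
    have "g n (Pr a \<zero>\<^bsub>obj Q n\<^esub>) \<in> el Y n" "g n (Pr \<zero>\<^bsub>obj P n\<^esub> b) \<in> el Y n"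
      using G(5) P Q a b by simp_all
    then show "f n v = g n v \<oplus>\<^bsub>obj Y n\<^esub> (diff Y (n - 1) (s n (pfst v) \<oplus>\<^bsub>obj Y (n - 1)\<^esub> t n (psnd v)) \<oplus>\<^bsub>obj Y n\<^esub>
        (s (n + 1) (pfst (diff (dsum P Q) n v)) \<oplus>\<^bsub>obj Y (n + 1 - 1)\<^esub> t (n + 1) (psnd (diff (dsum P Q) n v))))"
      unfolding fv gv e[OF a] e'[OF b]
      using P Q F(2) a b homotopyD(2,3)[OF s] homotopyD(2,3)[OF t] by (simp add: v bc_pred_lin km)
  qed
  then show ?thesis using f g by (simp add: hq_def)
qed

lemma chain_map_row:
  assumes f: "chain_map P f Y" and g: "chain_map Q g Y"
  shows "chain_map (dsum P Q) (\<lambda>n v. f n (pfst v) \<oplus>\<^bsub>obj Y n\<^esub> g n (psnd v)) Y"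
proof (rule chain_mapI)
  note F = chain_mapD[OF f] and G = chain_mapD[OF g]
  show "linear_map (obj (dsum P Q) n) (obj Y n) (\<lambda>v. f n (pfst v) \<oplus>\<^bsub>obj Y n\<^esub> g n (psnd v))" for n
    unfolding dsum_simps using F(2,3) G(3) by (intro linear_map_row) simp_all
  show "diff Y n (f n (pfst v) \<oplus>\<^bsub>obj Y n\<^esub> g n (psnd v)) =
      f (n + 1) (pfst (diff (dsum P Q) n v)) \<oplus>\<^bsub>obj Y (n + 1)\<^esub> g (n + 1) (psnd (diff (dsum P Q) n v))"
    if "v \<in> el (dsum P Q) n" for n v
    using that F(2) by (auto elim!: dsum_cases simp: bc_add F(4,5) G(4,5))
qed (use chain_mapD(1,2)[OF f] chain_mapD(1)[OF g] in simp_all)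

text \<open>Maps out of a direct sum are pairs of maps out of the summands, and the same holds for
  homotopies; existence and uniqueness of lifts therefore follow summand by summand.\<close>

lemma kproj_dsum:
  assumes P: "kproj P" and Q: "kproj Q" shows "kproj (dsum P Q)"
  unfolding kproj_def
proof (intro conjI allI impI)
  note bP = kproj_bc[OF P] and bQ = kproj_bc[OF Q]
  note i1 = chain_in1[OF bP bQ] and i2 = chain_in2[OF bP bQ]
  show "bounded_complex (dsum P Q)" using bP bQ by simp
  fix X Y :: "'a poly cplx" and s :: "'a poly gmap"
  assume qs: "quasi_iso X s Y"
  note s = quasi_isoD(1)[OF qs]
  {
    fix u assume u: "chain_map (dsum P Q) u Y"
    obtain v where v: "chain_map P v X" "hq P Y (\<lambda>n. s n \<circ> v n) (\<lambda>n. u n \<circ> (\<lambda>v. Pr v \<zero>\<^bsub>obj Q n\<^esub>))"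
      using kproj_lift[OF P qs chain_map_comp[OF i1 u]] .
    obtain w where w: "chain_map Q w X" "hq Q Y (\<lambda>n. s n \<circ> w n) (\<lambda>n. u n \<circ> (\<lambda>v. Pr \<zero>\<^bsub>obj P n\<^esub> v))"
      using kproj_lift[OF Q qs chain_map_comp[OF i2 u]] .
    let ?f = "\<lambda>n x. v n (pfst x) \<oplus>\<^bsub>obj X n\<^esub> w n (psnd x)"
    have f: "chain_map (dsum P Q) ?f X" using v(1) w(1) by (rule chain_map_row)
    note sf = chain_map_comp[OF f s]
    have X: "bounded_complex X" using chain_mapD(1)[OF s] .
    have "hq (dsum P Q) Y (\<lambda>n. s n \<circ> ?f n) u"
    proof (rule hq_sum_source[OF sf u bP bQ])
      have 1: "hq P Y (\<lambda>n x. (s n \<circ> ?f n) (Pr x \<zero>\<^bsub>obj Q n\<^esub>)) (\<lambda>n. s n \<circ> v n)"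
        using chain_map_comp[OF i1 sf] chain_map_comp[OF v(1) s] X
        by (auto simp: hq_def comp_def chain_mapD(5)[OF v(1)] chain_mapD(8)[OF w(1)] intro!: homotopic_eq)
      show "hq P Y (\<lambda>n x. (s n \<circ> ?f n) (Pr x \<zero>\<^bsub>obj Q n\<^esub>)) (\<lambda>n x. u n (Pr x \<zero>\<^bsub>obj Q n\<^esub>))"
        using hq_trans[OF 1 v(2)] by (simp add: comp_def)
      have 2: "hq Q Y (\<lambda>n x. (s n \<circ> ?f n) (Pr \<zero>\<^bsub>obj P n\<^esub> x)) (\<lambda>n. s n \<circ> w n)"
        using chain_map_comp[OF i2 sf] chain_map_comp[OF w(1) s] X
        by (auto simp: hq_def comp_def chain_mapD(5)[OF w(1)] chain_mapD(8)[OF v(1)] intro!: homotopic_eq)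
      show "hq Q Y (\<lambda>n x. (s n \<circ> ?f n) (Pr \<zero>\<^bsub>obj P n\<^esub> x)) (\<lambda>n x. u n (Pr \<zero>\<^bsub>obj P n\<^esub> x))"
        using hq_trans[OF 2 w(2)] by (simp add: comp_def)
    qed
    then show "\<exists>v. chain_map (dsum P Q) v X \<and> hq (dsum P Q) Y (\<lambda>n. s n \<circ> v n) u" using f by blast
  }
  {
    fix v v' assume v: "chain_map (dsum P Q) v X" and v': "chain_map (dsum P Q) v' X"
      and h: "hq (dsum P Q) Y (\<lambda>n. s n \<circ> v n) (\<lambda>n. s n \<circ> v' n)"
    have 1: "hq P X (\<lambda>n. v n \<circ> (\<lambda>x. Pr x \<zero>\<^bsub>obj Q n\<^esub>)) (\<lambda>n. v' n \<circ> (\<lambda>x. Pr x \<zero>\<^bsub>obj Q n\<^esub>))"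
      using hq_comp_right[OF h i1] by (intro kproj_inj[OF P qs] chain_map_comp[OF i1] v v') (simp add: comp_assoc)
    have 2: "hq Q X (\<lambda>n. v n \<circ> (\<lambda>x. Pr \<zero>\<^bsub>obj P n\<^esub> x)) (\<lambda>n. v' n \<circ> (\<lambda>x. Pr \<zero>\<^bsub>obj P n\<^esub> x))"
      using hq_comp_right[OF h i2] by (intro kproj_inj[OF Q qs] chain_map_comp[OF i2] v v') (simp add: comp_assoc)
    show "hq (dsum P Q) X v v'"
      using 1 2 by (intro hq_sum_source[OF v v' bP bQ]) (simp_all add: comp_def)
  }
qed

section \<open>Matrices of morphisms\<close>

record (overloaded) ('k::field) resolved =
  bs :: "'k based"
  aug :: "'k poly gmap"
  ob :: "'k poly cplx"

definition is_res :: "'k::field resolved \<Rightarrow> bool" where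
  "is_res R \<longleftrightarrow> is_based (bs R) \<and> kproj (cx (bs R)) \<and> quasi_iso (cx (bs R)) (aug R) (ob R)"

abbreviation daug :: "'k::field resolved \<Rightarrow> 'k poly dmor" where
  "daug R \<equiv> dmap (cx (bs R)) (aug R) (ob R)"

text \<open>M is a lift of \<phi> along the augmentations. It exists for every \<phi>
  (\<open>rep_full\<close>), it is determined up to matrix homotopy (\<open>rep_faithful\<close>),
  and every chain matrix occurs (\<open>rep_exists\<close>), so derived morphisms between resolved
  objects are matrices modulo homotopy.\<close>

definition rep :: "'k::field resolved \<Rightarrow> 'k resolved \<Rightarrow> (nat \<Rightarrow> nat \<Rightarrow> 'k poly) \<Rightarrow> 'k poly dmor \<Rightarrow> bool" where
  "rep R S M \<phi> \<longleftrightarrow> \<phi> \<in> dhom (ob R) (ob S) \<and> chainmat (bs R) (bs S) M \<and>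
     \<phi> \<cdot> daug R = daug S \<cdot> dmx (bs R) (bs S) M"

definition rshift :: "'k::field resolved \<Rightarrow> 'k resolved" where
  "rshift R = \<lparr>bs = bshift (bs R), aug = shift_map (aug R), ob = shift (ob R)\<rparr>"

definition rsum :: "'k::field resolved \<Rightarrow> 'k resolved \<Rightarrow> 'k resolved" where
  "rsum R S = \<lparr>bs = bsum (bs R) (bs S), aug = dsum_map (aug R) (aug S), ob = dsum (ob R) (ob S)\<rparr>"

lemma res_simps [simp]:
  "bs (rshift R) = bshift (bs R)" "aug (rshift R) = shift_map (aug R)" "ob (rshift R) = shift (ob R)"
  "bs (rsum R S) = bsum (bs R) (bs S)" "aug (rsum R S) = dsum_map (aug R) (aug S)"
  "ob (rsum R S) = dsum (ob R) (ob S)"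
  by (simp_all add: rshift_def rsum_def)

lemma resD:
  assumes "is_res R"
  shows "is_based (bs R)" "kproj (cx (bs R))" "quasi_iso (cx (bs R)) (aug R) (ob R)"
    "chain_map (cx (bs R)) (aug R) (ob R)" "bounded_complex (ob R)" "bounded_complex (cx (bs R))"
    "daug R \<in> dhom (cx (bs R)) (ob R)"
    "dinv (cx (bs R)) (aug R) (ob R) \<in> dhom (ob R) (cx (bs R))"
    "daug R \<cdot> dinv (cx (bs R)) (aug R) (ob R) = did (ob R)"
    "dinv (cx (bs R)) (aug R) (ob R) \<cdot> daug R = did (cx (bs R))"
  using assms unfolding is_res_def
  by (auto dest: quasi_isoD(1) quasi_iso_bc simp: dmap_hom dinv_hom dinv_left dinv_right)

lemma is_res_sum: "is_res R \<Longrightarrow> is_res S \<Longrightarrow> is_res (rsum R S)"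
  by (simp add: is_res_def is_based_sum kproj_dsum quasi_iso_dsum)

lemma dmx_hom: "is_based P \<Longrightarrow> is_based Q \<Longrightarrow> chainmat P Q M \<Longrightarrow> dmx P Q M \<in> dhom (cx P) (cx Q)"
  by (simp add: dmap_hom chain_mx)

lemma repD:
  assumes "rep R S M \<phi>"
  shows "\<phi> \<in> dhom (ob R) (ob S)" "chainmat (bs R) (bs S) M" "\<phi> \<cdot> daug R = daug S \<cdot> dmx (bs R) (bs S) M"
  using assms by (simp_all add: rep_def)

text \<open>The augmentation is a quasi-isomorphism, hence invertible in the derived
  category.\<close>

lemma aug_cancel:
  assumes R: "is_res R" and p: "\<phi> \<in> dhom (ob R) Y" "\<psi> \<in> dhom (ob R) Y" and e: "\<phi> \<cdot> daug R = \<psi> \<cdot> daug R"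
  shows "\<phi> = \<psi>"
proof -
  note D = resD[OF R]
  have "\<phi> = (\<phi> \<cdot> daug R) \<cdot> dinv (cx (bs R)) (aug R) (ob R)"
    using dcomp_assoc[OF D(8,7) p(1)] D(9) did_right[OF p(1)] by simp
  also have "\<dots> = \<psi>" unfolding e
    using dcomp_assoc[OF D(8,7) p(2)] D(9) did_right[OF p(2)] by simp
  finally show ?thesis .
qed

lemma rep_comp:
  assumes R: "is_res R" and S: "is_res S" and T: "is_res T"
    and a: "rep R S M \<phi>" and b: "rep S T N \<psi>"
  shows "rep R T (mm (rk (bs S)) N M) (\<psi> \<cdot> \<phi>)"
proof -
  note A = repD[OF a] and B = repD[OF b]
  note DR = resD[OF R] and DS = resD[OF S] and DT = resD[OF T]
  note hM = dmx_hom[OF DR(1) DS(1) A(2)] and hN = dmx_hom[OF DS(1) DT(1) B(2)]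
  have "(\<psi> \<cdot> \<phi>) \<cdot> daug R = \<psi> \<cdot> \<phi> \<cdot> daug R" by (rule dcomp_assoc[OF DR(7) A(1) B(1)])
  also have "\<dots> = (\<psi> \<cdot> daug S) \<cdot> dmx (bs R) (bs S) M"
    unfolding A(3) by (rule dcomp_assoc[OF hM DS(7) B(1), symmetric])
  also have "\<dots> = daug T \<cdot> dmx (bs S) (bs T) N \<cdot> dmx (bs R) (bs S) M"
    unfolding B(3) by (rule dcomp_assoc[OF hM hN DT(7)])
  also have "dmx (bs S) (bs T) N \<cdot> dmx (bs R) (bs S) M = dmx (bs R) (bs T) (mm (rk (bs S)) N M)"
    by (rule dmx_comp[OF DR(1) DS(1) DT(1) A(2) B(2)])
  finally show ?thesis
    unfolding rep_def using dcomp_hom[OF A(1) B(1)] chainmat_mm[OF A(2) B(2)] by blast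
qed

lemma rep_mhtp_eq:
  assumes R: "is_res R" and S: "is_res S" and a: "rep R S M \<phi>" and b: "rep R S N \<psi>"
    and h: "mhtp (bs R) (bs S) M N"
  shows "\<phi> = \<psi>"
  using aug_cancel[OF R repD(1)[OF a] repD(1)[OF b]] repD(3)[OF a] repD(3)[OF b]
    dmx_eq[OF resD(1)[OF R] resD(1)[OF S] repD(2)[OF a] repD(2)[OF b] h] by simp

lemma mhtp_eq:
  assumes "\<And>i j. i < rk Q \<Longrightarrow> j < rk P \<Longrightarrow> M i j = N i j" shows "mhtp P Q M N"
  unfolding mhtp_def using assms by (intro exI[of _ zmat]) (simp add: dcond_def mm_def)

lemma chainmat_cong:
  assumes M: "chainmat P Q M" and e: "\<And>i j. i < rk Q \<Longrightarrow> j < rk P \<Longrightarrow> M i j = N i j"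
  shows "chainmat P Q N"
proof -
  have "mm (rk Q) (df Q) M i j = mm (rk Q) (df Q) N i j" "mm (rk P) M (df P) i j = mm (rk P) N (df P) i j"
    if "i < rk Q" "j < rk P" for i j
    using that e by (auto intro!: mm_cong)
  then show ?thesis using M e by (simp add: chainmat_def dcond_def)
qed

lemma rep_mhtp:
  assumes R: "is_res R" and S: "is_res S" and a: "rep R S M \<phi>" and N: "chainmat (bs R) (bs S) N"
    and h: "mhtp (bs R) (bs S) M N"
  shows "rep R S N \<phi>"
  using repD[OF a] N dmx_eq[OF resD(1)[OF R] resD(1)[OF S] repD(2)[OF a] N h] by (simp add: rep_def)

lemma rep_cong:
  assumes R: "is_res R" and S: "is_res S" and a: "rep R S M \<phi>"
    and e: "\<And>i j. i < rk (bs S) \<Longrightarrow> j < rk (bs R) \<Longrightarrow> M i j = N i j"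
  shows "rep R S N \<phi>"
  using rep_mhtp[OF R S a] chainmat_cong[OF repD(2)[OF a] e] mhtp_eq[OF e] by simp

lemma rep_unique:
  assumes R: "is_res R" and S: "is_res S" and a: "rep R S M \<phi>" and b: "rep R S N \<psi>"
    and e: "\<And>i j. i < rk (bs S) \<Longrightarrow> j < rk (bs R) \<Longrightarrow> M i j = N i j"
  shows "\<phi> = \<psi>"
  using rep_mhtp_eq[OF R S a b mhtp_eq[OF e]] by simp

text \<open>Projectivity enters twice: it turns \<phi> after the augmentation of R into a chain map,
  and it lifts this chain map along the augmentation of S. A chain map between based complexes is
  then a matrix.\<close>

lemma rep_full:
  assumes R: "is_res R" and S: "is_res S" and p: "\<phi> \<in> dhom (ob R) (ob S)"
  obtains M where "rep R S M \<phi>"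
proof -
  note DR = resD[OF R] and DS = resD[OF S]
  obtain v where v: "chain_map (cx (bs R)) v (ob S)" "\<phi> \<cdot> daug R = dmap (cx (bs R)) v (ob S)"
    using dmap_full[OF DR(2) p DR(4)] .
  obtain w where w: "chain_map (cx (bs R)) w (cx (bs S))"
      "hq (cx (bs R)) (ob S) (\<lambda>n. aug S n \<circ> w n) v"
    using kproj_lift[OF DR(2) DS(3) v(1)] .
  obtain M where M: "chainmat (bs R) (bs S) M"
      "\<And>n x. x \<in> el (cx (bs R)) n \<Longrightarrow> w n x = mx (bs R) (bs S) M n x"
    using matrix_of_chain[OF DR(1) DS(1) w(1)] by blast
  have "dmap (cx (bs R)) w (cx (bs S)) = dmx (bs R) (bs S) M"
    using M(2) by (intro dmap_eq[OF w(1) chain_mx[OF DR(1) DS(1) M(1)]])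
  then have "\<phi> \<cdot> daug R = daug S \<cdot> dmx (bs R) (bs S) M"
    using v(2) dmap_comp[OF w(1) DS(4)] dmap_homotopic[of _ "\<lambda>n. aug S n \<circ> w n" _ v] w(2)
    by (simp add: hq_def)
  then show ?thesis using that[of M] p M(1) by (simp add: rep_def)
qed

text \<open>After cancelling the augmentation of S, two classes of chain maps out of a homotopically
  projective complex are equal, and such maps are homotopic. This is the passage from equations in
  the derived category to polynomial identities.\<close>

lemma rep_faithful:
  assumes R: "is_res R" and S: "is_res S" and a: "rep R S M \<phi>" and b: "rep R S N \<phi>"
  shows "mhtp (bs R) (bs S) M N"
proof -
  note DR = resD[OF R] and DS = resD[OF S]
  have e: "daug S \<cdot> dmx (bs R) (bs S) M = daug S \<cdot> dmx (bs R) (bs S) N"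
    using repD(3)[OF a] repD(3)[OF b] by simp
  have "dmx (bs R) (bs S) M = dmx (bs R) (bs S) N"
    using dcomp_cancel[OF DS(7,8,10) dmx_hom[OF DR(1) DS(1) repD(2)[OF a]]]
      dcomp_cancel[OF DS(7,8,10) dmx_hom[OF DR(1) DS(1) repD(2)[OF b]]] e by metis
  then have "hq (cx (bs R)) (cx (bs S)) (mx (bs R) (bs S) M) (mx (bs R) (bs S) N)"
    by (intro dmap_faithful[OF DR(2)] chain_mx DR(1) DS(1) repD(2)[OF a] repD(2)[OF b])
  then show ?thesis
    using hq_mx_iff[OF DR(1) DS(1) repD(2)[OF a] repD(2)[OF b]] by simp
qed

text \<open>The morphism is obtained by conjugating the matrix map with the augmentations, one of
  them inverted.\<close>

lemma rep_exists:
  assumes R: "is_res R" and S: "is_res S" and M: "chainmat (bs R) (bs S) M"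
  obtains \<phi> where "rep R S M \<phi>"
proof -
  note DR = resD[OF R] and DS = resD[OF S]
  note hM = dmx_hom[OF DR(1) DS(1) M]
  let ?\<phi> = "(daug S \<cdot> dmx (bs R) (bs S) M) \<cdot> dinv (cx (bs R)) (aug R) (ob R)"
  note h = dcomp_hom[OF hM DS(7)]
  have "?\<phi> \<cdot> daug R = daug S \<cdot> dmx (bs R) (bs S) M"
    using dcomp_assoc[OF DR(7,8) h] DR(10) did_right[OF h] by simp
  then show ?thesis using that[of ?\<phi>] dcomp_hom[OF DR(8) h] M by (simp add: rep_def)
qed

lemma rep_chain_map:
  assumes R: "is_res R" and S: "is_res S" and f: "chain_map (ob R) f (ob S)"
    and F: "chain_map (cx (bs R)) F (cx (bs S))"
    and M: "chainmat (bs R) (bs S) M" "dmap (cx (bs R)) F (cx (bs S)) = dmx (bs R) (bs S) M"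
    and e: "\<And>n v. v \<in> el (cx (bs R)) n \<Longrightarrow> f n (aug R n v) = aug S n (F n v)"
  shows "rep R S M (dmap (ob R) f (ob S))"
proof -
  note DR = resD[OF R] and DS = resD[OF S]
  have "dmap (ob R) f (ob S) \<cdot> daug R = daug S \<cdot> dmx (bs R) (bs S) M"
    unfolding M(2)[symmetric] dmap_comp[OF DR(4) f] dmap_comp[OF F DS(4)]
    using e by (intro dmap_eq[OF chain_map_comp[OF DR(4) f] chain_map_comp[OF F DS(4)]]) simp
  then show ?thesis using f M by (simp add: rep_def dmap_hom)
qed

lemma rep_mx:
  assumes R: "is_res R" and S: "is_res S" and f: "chain_map (ob R) f (ob S)"
    and M: "chainmat (bs R) (bs S) M"
    and e: "\<And>n v. v \<in> el (cx (bs R)) n \<Longrightarrow> f n (aug R n v) = aug S n (mx (bs R) (bs S) M n v)"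
  shows "rep R S M (dmap (ob R) f (ob S))"
  by (rule rep_chain_map[OF R S f chain_mx[OF resD(1)[OF R] resD(1)[OF S] M] M HOL.refl e])

section \<open>Matrices of shifts, identities, zero morphisms, negatives and structural maps\<close>

lemma rep_shift:
  assumes R: "is_res R" and S: "is_res S" and a: "rep R S M \<phi>"
  shows "rep (rshift R) (rshift S) M (\<phi>\<langle>1\<rangle>)"
proof -
  note DR = resD[OF R] and DS = resD[OF S] and A = repD[OF a]
  have "(\<phi> \<cdot> daug R)\<langle>1\<rangle> = (daug S \<cdot> dmx (bs R) (bs S) M)\<langle>1\<rangle>" using A(3) by simp
  then have "\<phi>\<langle>1\<rangle> \<cdot> daug (rshift R) = daug (rshift S) \<cdot> dmx (bshift (bs R)) (bshift (bs S)) M"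
    unfolding dshift_comp[OF DR(7) A(1)] dshift_comp[OF dmx_hom[OF DR(1) DS(1) A(2)] DS(7)]
      dmx_shift[OF DR(1) DS(1) A(2)]
    using DR(4) DS(4) by (simp add: dshift_dmap)
  then show ?thesis using dshift_hom[OF A(1)] chainmat_shift[OF A(2)] by (simp add: rep_def)
qed

lemma rep_id: "is_res R \<Longrightarrow> rep R R imat (did (ob R))"
  using id_matrix[OF resD(1), of R] did_left[OF resD(7), of R] did_right[OF resD(7), of R] did_hom[OF resD(5)]
  by (simp add: rep_def)

lemma rep_zero:
  assumes R: "is_res R" and S: "is_res S" shows "rep R S zmat (dzero (ob R) (ob S))"
  unfolding dzero_def
proof (rule rep_mx[OF R S])
  note DR = resD[OF R] and DS = resD[OF S]
  show "chain_map (ob R) (\<lambda>n v. \<zero>\<^bsub>obj (ob S) n\<^esub>) (ob S)" using DR DS by (simp add: chain_map_zero)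
  show "chainmat (bs R) (bs S) zmat" by (simp add: chainmat_def dcond_def mm_def)
  have "mx (bs R) (bs S) zmat n v = \<zero>\<^bsub>obj (cx (bs S)) n\<^esub>" for n v
    by (rule cd_inj[OF DS(1), of _ n])
      (simp_all add: mx_def mxm_def basedD(4,5)[OF DS(1)] cd_zero[OF DS(1)] basedD(1)[OF DS(1)])
  then show "\<zero>\<^bsub>obj (ob S) n\<^esub> = aug S n (mx (bs R) (bs S) zmat n v)" for n v
    using chain_mapD(8)[OF DS(4)] by simp
qed

lemma rep_neg:
  assumes R: "is_res R" and S: "is_res S" and a: "rep R S M \<phi>"
  shows "rep R S (nmat M) (dneg \<phi>)"
proof -
  note DS = resD[OF S]
  let ?n = "\<lambda>n v. \<ominus>\<^bsub>obj (cx (bs S)) n\<^esub> v"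
  have cn: "chain_map (cx (bs S)) ?n (cx (bs S))" using DS by (simp add: chain_map_neg)
  have c: "cd (bs S) n (\<ominus>\<^bsub>obj (cx (bs S)) n\<^esub> v) i = (\<Sum>j<rk (bs S). - imat i j * cd (bs S) n v j)"
    if "v \<in> el (cx (bs S)) n" "i < rk (bs S)" for n v i
    using that by (simp add: cd_neg[OF DS(1)] sum_negf)
  have m: "chainmat (bs S) (bs S) (nmat imat)"
    using chain_map_matrix(1)[OF DS(1,1) cn, of "nmat imat"] c by blast
  have mx: "mx (bs S) (bs S) (nmat imat) n v = \<ominus>\<^bsub>obj (cx (bs S)) n\<^esub> v" if v: "v \<in> el (cx (bs S)) n" for n v
  proof (rule cd_inj[OF DS(1), of _ n])
    show "cd (bs S) n (mx (bs S) (bs S) (nmat imat) n v) i = cd (bs S) n (\<ominus>\<^bsub>obj (cx (bs S)) n\<^esub> v) i" if "i < rk (bs S)" for i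
      using m c[OF v that] cd_mxm[OF DS(1,1) _ v _ that, of 0 "nmat imat" n] by (simp add: mx_def chainmat_def)
  qed (use v DS in \<open>simp_all add: mx_def\<close>)
  have "rep S S (nmat imat) (dmap (ob S) (\<lambda>n v. \<ominus>\<^bsub>obj (ob S) n\<^esub> v) (ob S))"
    using DS by (intro rep_mx[OF S S _ m]) (simp_all add: chain_map_neg mx chain_mapD(9)[OF DS(4)])
  then have "rep R S (mm (rk (bs S)) (nmat imat) M) (dneg \<phi>)"
    using rep_comp[OF R S S a] dneg_eq[OF repD(1)[OF a]] by simp
  then show ?thesis
    by (rule rep_cong[OF R S]) (simp add: mm_def sum_negf)
qed

lemma rep_structure:
  assumes R: "is_res R" and S: "is_res S"
  shows "rep R (rsum R S) imat (din1 (ob R) (ob S))"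
    "rep S (rsum R S) (in2mat (rk (bs R))) (din2 (ob R) (ob S))"
    "rep (rsum R S) R imat (dpr1 (ob R) (ob S))"
    "rep (rsum R S) S (pr2mat (rk (bs R))) (dpr2 (ob R) (ob S))"
proof -
  note DR = resD[OF R] and DS = resD[OF S] and T = is_res_sum[OF R S]
  note M = structure_matrices[OF DR(1) DS(1)] and zero = chain_mapD(8)[OF DR(4)] chain_mapD(8)[OF DS(4)]
  show "rep R (rsum R S) imat (din1 (ob R) (ob S))"
    using rep_chain_map[OF R T, unfolded res_simps based_simps, OF chain_in1[OF DR(5) DS(5)] chain_in1[OF DR(6) DS(6)]
        M(1) M(2)[unfolded din1_def based_simps]]
    by (simp add: zero din1_def)
  show "rep S (rsum R S) (in2mat (rk (bs R))) (din2 (ob R) (ob S))"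
    using rep_chain_map[OF S T, unfolded res_simps based_simps, OF chain_in2[OF DR(5) DS(5)] chain_in2[OF DR(6) DS(6)]
        M(3) M(4)[unfolded din2_def based_simps]]
    by (simp add: zero din2_def)
  show "rep (rsum R S) R imat (dpr1 (ob R) (ob S))"
    using rep_chain_map[OF T R, unfolded res_simps based_simps, OF chain_pr1[OF DR(5) DS(5)] chain_pr1[OF DR(6) DS(6)]
        M(5) M(6)[unfolded dpr1_def based_simps]]
    by (simp add: dpr1_def)
  show "rep (rsum R S) S (pr2mat (rk (bs R))) (dpr2 (ob R) (ob S))"
    using rep_chain_map[OF T S, unfolded res_simps based_simps, OF chain_pr2[OF DR(5) DS(5)] chain_pr2[OF DR(6) DS(6)]
        M(7) M(8)[unfolded dpr2_def based_simps]]
    by (simp add: dpr2_def)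
qed

subsection \<open>Block matrices\<close>

definition colm :: "nat \<Rightarrow> (nat \<Rightarrow> nat \<Rightarrow> 'k::field poly) \<Rightarrow> (nat \<Rightarrow> nat \<Rightarrow> 'k poly) \<Rightarrow> nat \<Rightarrow> nat \<Rightarrow> 'k poly" where
  "colm r M N i j = (if i < r then M i j else N (i - r) j)"

definition rowm :: "nat \<Rightarrow> (nat \<Rightarrow> nat \<Rightarrow> 'k::field poly) \<Rightarrow> (nat \<Rightarrow> nat \<Rightarrow> 'k poly) \<Rightarrow> nat \<Rightarrow> nat \<Rightarrow> 'k poly" where
  "rowm r M N i j = (if j < r then M i j else N i (j - r))"

lemma mm_structure:
  "i < r \<Longrightarrow> r \<le> n \<Longrightarrow> mm n imat M i j = M i j"
  "i + r < n \<Longrightarrow> mm n (pr2mat r) M i j = M (i + r) j"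
  "j < n \<Longrightarrow> mm n M imat i j = M i j"
  "j + r < n \<Longrightarrow> mm n M (in2mat r) i j = M i (j + r)"
  by (simp_all add: mm_def pr2mat_def in2mat_def sum_imat')

lemma mm_colm:
  "mm n (colm r M N) A i j = (if i < r then mm n M A i j else mm n N A (i - r) j)"
  by (simp add: mm_def colm_def)

lemma mm_rowm:
  "mm n A (rowm r M N) i j = (if j < r then mm n A M i j else mm n A N i (j - r))"
  by (simp add: mm_def rowm_def)

lemma mm_blk_colm:
  "mm (r + s) (blk r r A zmat zmat D) (colm r M N) i j = (if i < r then mm r A M i j else mm s D N (i - r) j)"
  by (simp add: mm_def blk_def colm_def sum_lessThan_add)

lemma mm_rowm_blk:
  "mm (r + s) (rowm r M N) (blk r r A zmat zmat D) i j = (if j < r then mm r M A i j else mm s N D i (j - r))"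
  by (simp add: mm_def blk_def rowm_def sum_lessThan_add)

lemma chainmat_colm:
  assumes "chainmat R P M" "chainmat R Q N" shows "chainmat R (bsum P Q) (colm (rk P) M N)"
proof -
  have "dcond 0 R (bsum P Q) (colm (rk P) M N)"
    using assms by (auto simp: chainmat_def dcond_def colm_def)
  then show ?thesis using assms by (simp add: chainmat_def mm_blk_colm mm_colm)
qed

lemma chainmat_rowm:
  assumes "chainmat P R M" "chainmat Q R N" shows "chainmat (bsum P Q) R (rowm (rk P) M N)"
proof -
  have "dcond 0 (bsum P Q) R (rowm (rk P) M N)"
    using assms by (auto simp: chainmat_def dcond_def rowm_def)
  then show ?thesis using assms by (simp add: chainmat_def mm_rowm_blk mm_rowm)
qed

text \<open>The differential of a direct sum is block diagonal, so homotopies for the two block rows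
  stack to one for the whole matrix. The last two hypotheses let the upper block be given by any
  matrices that agree there.\<close>

lemma mhtp_target_sum:
  assumes "mhtp R P M M'" "mhtp R Q (\<lambda>i j. N (i + rk P) j) (\<lambda>i j. N' (i + rk P) j)"
    and "\<And>i j. i < rk P \<Longrightarrow> M i j = N i j" "\<And>i j. i < rk P \<Longrightarrow> M' i j = N' i j"
  shows "mhtp R (bsum P Q) N N'"
proof -
  obtain H where H: "dcond (-1) R P H"
    "\<forall>i<rk P. \<forall>j<rk R. M i j = M' i j + (mm (rk P) (df P) H i j + mm (rk R) H (df R) i j)"
    using assms(1) unfolding mhtp_def by blast
  obtain K where K: "dcond (-1) R Q K"
    "\<forall>i<rk Q. \<forall>j<rk R. N (i + rk P) j = N' (i + rk P) j + (mm (rk Q) (df Q) K i j + mm (rk R) K (df R) i j)"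
    using assms(2) unfolding mhtp_def by blast
  have "dcond (-1) R (bsum P Q) (colm (rk P) H K)"
    using H(1) K(1) by (auto simp: dcond_def colm_def)
  moreover have "N i j = N' i j + (mm (rk P + rk Q) (blk (rk P) (rk P) (df P) zmat zmat (df Q)) (colm (rk P) H K) i j +
      mm (rk R) (colm (rk P) H K) (df R) i j)" if "i < rk P + rk Q" "j < rk R" for i j
    using that H(2) K(2)[rule_format, of "i - rk P" j] assms(3,4)
    by (cases "i < rk P") (simp_all add: mm_blk_colm mm_colm less_diff_conv2)
  ultimately show ?thesis unfolding mhtp_def by auto
qed

lemma mhtp_source_sum:
  assumes "mhtp P R M M'" "mhtp Q R (\<lambda>i j. N i (j + rk P)) (\<lambda>i j. N' i (j + rk P))"
    and "\<And>i j. j < rk P \<Longrightarrow> M i j = N i j" "\<And>i j. j < rk P \<Longrightarrow> M' i j = N' i j"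
  shows "mhtp (bsum P Q) R N N'"
proof -
  obtain H where H: "dcond (-1) P R H"
    "\<forall>i<rk R. \<forall>j<rk P. M i j = M' i j + (mm (rk R) (df R) H i j + mm (rk P) H (df P) i j)"
    using assms(1) unfolding mhtp_def by blast
  obtain K where K: "dcond (-1) Q R K"
    "\<forall>i<rk R. \<forall>j<rk Q. N i (j + rk P) = N' i (j + rk P) + (mm (rk R) (df R) K i j + mm (rk Q) K (df Q) i j)"
    using assms(2) unfolding mhtp_def by blast
  have "dcond (-1) (bsum P Q) R (rowm (rk P) H K)"
    using H(1) K(1) by (auto simp: dcond_def rowm_def)
  moreover have "N i j = N' i j + (mm (rk R) (df R) (rowm (rk P) H K) i j +
      mm (rk P + rk Q) (rowm (rk P) H K) (blk (rk P) (rk P) (df P) zmat zmat (df Q)) i j)" if "i < rk R" "j < rk P + rk Q" for i j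
    using that H(2) K(2)[rule_format, of i "j - rk P"] assms(3,4)
    by (cases "j < rk P") (simp_all add: mm_rowm_blk mm_rowm less_diff_conv2)
  ultimately show ?thesis unfolding mhtp_def by auto
qed

text \<open>The uniqueness half of the product property, required to evaluate the definite
  descriptions in \<open>dcol\<close> and \<open>dmat\<close>. It is proved on matrices: equal
  components have homotopic block rows, and these homotopies assemble.\<close>

lemma mor_into_sum_unique:
  assumes R: "is_res R" and S: "is_res S" and T: "is_res T"
    and m: "m \<in> dhom (ob R) (dsum (ob S) (ob T))" "m' \<in> dhom (ob R) (dsum (ob S) (ob T))"
    and e: "dpr1 (ob S) (ob T) \<cdot> m = dpr1 (ob S) (ob T) \<cdot> m'" "dpr2 (ob S) (ob T) \<cdot> m = dpr2 (ob S) (ob T) \<cdot> m'"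
  shows "m = m'"
proof -
  note ST = is_res_sum[OF S T] and P = rep_structure[OF S T]
  obtain N where N: "rep R (rsum S T) N m" using rep_full[OF R ST, of m] m(1) by auto
  obtain N' where N': "rep R (rsum S T) N' m'" using rep_full[OF R ST, of m'] m(2) by auto
  let ?n = "rk (bs S) + rk (bs T)"
  have 1: "rep R S N (dpr1 (ob S) (ob T) \<cdot> m)" "rep R S N' (dpr1 (ob S) (ob T) \<cdot> m)"
    using rep_cong[OF R S rep_comp[OF R ST S N P(3)], of N]
      rep_cong[OF R S rep_comp[OF R ST S N' P(3)], of N'] e by (simp_all add: mm_structure)
  have 2: "rep R T (\<lambda>i j. N (i + rk (bs S)) j) (dpr2 (ob S) (ob T) \<cdot> m)"
      "rep R T (\<lambda>i j. N' (i + rk (bs S)) j) (dpr2 (ob S) (ob T) \<cdot> m)"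
    using rep_cong[OF R T rep_comp[OF R ST T N P(4)], of "\<lambda>i j. N (i + rk (bs S)) j"]
      rep_cong[OF R T rep_comp[OF R ST T N' P(4)], of "\<lambda>i j. N' (i + rk (bs S)) j"] e
    by (simp_all add: mm_structure add.commute)
  have "mhtp (bs R) (bs (rsum S T)) N N'"
    unfolding res_simps
    by (rule mhtp_target_sum[OF rep_faithful[OF R S 1] rep_faithful[OF R T 2]]) simp_all
  then show ?thesis by (rule rep_mhtp_eq[OF R ST N N'])
qed

lemma mor_from_sum_unique:
  assumes R: "is_res R" and S: "is_res S" and T: "is_res T"
    and m: "m \<in> dhom (dsum (ob S) (ob T)) (ob R)" "m' \<in> dhom (dsum (ob S) (ob T)) (ob R)"
    and e: "m \<cdot> din1 (ob S) (ob T) = m' \<cdot> din1 (ob S) (ob T)" "m \<cdot> din2 (ob S) (ob T) = m' \<cdot> din2 (ob S) (ob T)"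
  shows "m = m'"
proof -
  note ST = is_res_sum[OF S T] and P = rep_structure[OF S T]
  obtain N where N: "rep (rsum S T) R N m" using rep_full[OF ST R, of m] m(1) by auto
  obtain N' where N': "rep (rsum S T) R N' m'" using rep_full[OF ST R, of m'] m(2) by auto
  have 1: "rep S R N (m \<cdot> din1 (ob S) (ob T))" "rep S R N' (m \<cdot> din1 (ob S) (ob T))"
    using rep_cong[OF S R rep_comp[OF S ST R P(1) N], of N]
      rep_cong[OF S R rep_comp[OF S ST R P(1) N'], of N'] e by (simp_all add: mm_structure)
  have 2: "rep T R (\<lambda>i j. N i (j + rk (bs S))) (m \<cdot> din2 (ob S) (ob T))"
      "rep T R (\<lambda>i j. N' i (j + rk (bs S))) (m \<cdot> din2 (ob S) (ob T))"
    using rep_cong[OF T R rep_comp[OF T ST R P(2) N], of "\<lambda>i j. N i (j + rk (bs S))"]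
      rep_cong[OF T R rep_comp[OF T ST R P(2) N'], of "\<lambda>i j. N' i (j + rk (bs S))"] e
    by (simp_all add: mm_structure add.commute)
  have "mhtp (bs (rsum S T)) (bs R) N N'"
    unfolding res_simps
    by (rule mhtp_source_sum[OF rep_faithful[OF S R 1] rep_faithful[OF T R 2]]) simp_all
  then show ?thesis by (rule rep_mhtp_eq[OF ST R N N'])
qed

text \<open>Stacking the two matrices gives a morphism with the right components, and uniqueness
  makes it the value of the definite description.\<close>

lemma rep_dcol:
  assumes R: "is_res R" and S: "is_res S" and T: "is_res T"
    and a: "rep R S M \<phi>" and b: "rep R T N \<psi>"
  shows "rep R (rsum S T) (colm (rk (bs S)) M N) (dcol (ob R) (ob S) (ob T) \<phi> \<psi>)"
    and "dpr1 (ob S) (ob T) \<cdot> dcol (ob R) (ob S) (ob T) \<phi> \<psi> = \<phi>"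
    and "dpr2 (ob S) (ob T) \<cdot> dcol (ob R) (ob S) (ob T) \<phi> \<psi> = \<psi>"
proof -
  note ST = is_res_sum[OF S T] and P = rep_structure[OF S T]
  obtain m where m: "rep R (rsum S T) (colm (rk (bs S)) M N) m"
    using rep_exists[OF R ST, of "colm (rk (bs S)) M N"] chainmat_colm[OF repD(2)[OF a] repD(2)[OF b]] by auto
  have 1: "dpr1 (ob S) (ob T) \<cdot> m = \<phi>"
    by (rule rep_unique[OF R S rep_comp[OF R ST S m P(3)] a]) (simp add: mm_structure colm_def)
  have 2: "dpr2 (ob S) (ob T) \<cdot> m = \<psi>"
    by (rule rep_unique[OF R T rep_comp[OF R ST T m P(4)] b]) (simp add: mm_structure colm_def)
  have h: "m \<in> dhom (ob R) (dsum (ob S) (ob T))" using repD(1)[OF m] by simp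
  have "dcol (ob R) (ob S) (ob T) \<phi> \<psi> = m"
    unfolding dcol_def
  proof (rule the_equality)
    show "m' = m" if "m' \<in> dhom (ob R) (dsum (ob S) (ob T)) \<and> dpr1 (ob S) (ob T) \<cdot> m' = \<phi> \<and> dpr2 (ob S) (ob T) \<cdot> m' = \<psi>" for m'
      using mor_into_sum_unique[OF R S T, of m' m] that h 1 2 by simp
  qed (use h 1 2 in blast)
  then show "rep R (rsum S T) (colm (rk (bs S)) M N) (dcol (ob R) (ob S) (ob T) \<phi> \<psi>)"
    "dpr1 (ob S) (ob T) \<cdot> dcol (ob R) (ob S) (ob T) \<phi> \<psi> = \<phi>"
    "dpr2 (ob S) (ob T) \<cdot> dcol (ob R) (ob S) (ob T) \<phi> \<psi> = \<psi>"
    using m 1 2 by simp_all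
qed

lemma rep_drow:
  assumes R: "is_res R" and S: "is_res S" and T: "is_res T"
    and a: "rep S R M \<phi>" and b: "rep T R N \<psi>"
  shows "rep (rsum S T) R (rowm (rk (bs S)) M N) (drow (ob S) (ob T) (ob R) \<phi> \<psi>)"
    and "drow (ob S) (ob T) (ob R) \<phi> \<psi> \<cdot> din1 (ob S) (ob T) = \<phi>"
    and "drow (ob S) (ob T) (ob R) \<phi> \<psi> \<cdot> din2 (ob S) (ob T) = \<psi>"
proof -
  note ST = is_res_sum[OF S T] and P = rep_structure[OF S T]
  obtain m where m: "rep (rsum S T) R (rowm (rk (bs S)) M N) m"
    using rep_exists[OF ST R, of "rowm (rk (bs S)) M N"] chainmat_rowm[OF repD(2)[OF a] repD(2)[OF b]] by auto
  have 1: "m \<cdot> din1 (ob S) (ob T) = \<phi>"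
    by (rule rep_unique[OF S R rep_comp[OF S ST R P(1) m] a]) (simp add: mm_structure rowm_def)
  have 2: "m \<cdot> din2 (ob S) (ob T) = \<psi>"
    by (rule rep_unique[OF T R rep_comp[OF T ST R P(2) m] b]) (simp add: mm_structure rowm_def)
  have h: "m \<in> dhom (dsum (ob S) (ob T)) (ob R)" using repD(1)[OF m] by simp
  have "drow (ob S) (ob T) (ob R) \<phi> \<psi> = m"
    unfolding drow_def
  proof (rule the_equality)
    show "m' = m" if "m' \<in> dhom (dsum (ob S) (ob T)) (ob R) \<and> m' \<cdot> din1 (ob S) (ob T) = \<phi> \<and> m' \<cdot> din2 (ob S) (ob T) = \<psi>" for m'
      using mor_from_sum_unique[OF R S T, of m' m] that h 1 2 by simp
  qed (use h 1 2 in blast)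
  then show "rep (rsum S T) R (rowm (rk (bs S)) M N) (drow (ob S) (ob T) (ob R) \<phi> \<psi>)"
    "drow (ob S) (ob T) (ob R) \<phi> \<psi> \<cdot> din1 (ob S) (ob T) = \<phi>"
    "drow (ob S) (ob T) (ob R) \<phi> \<psi> \<cdot> din2 (ob S) (ob T) = \<psi>"
    using m 1 2 by simp_all
qed

lemma rep_dmat:
  assumes R: "is_res R" and S: "is_res S" and U: "is_res U" and V: "is_res V"
    and a: "rep R U MA a" and b: "rep S U MB b" and c: "rep R V MC c" and d: "rep S V MD d"
  shows "rep (rsum R S) (rsum U V) (colm (rk (bs U)) (rowm (rk (bs R)) MA MB) (rowm (rk (bs R)) MC MD))
     (dmat (ob R) (ob S) (ob U) (ob V) a b c d)"
proof -
  note RS = is_res_sum[OF R S] and UV = is_res_sum[OF U V]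
  note P = rep_structure[OF U V] and I = rep_structure[OF R S]
  note r1 = rep_drow[OF U R S a b] and r2 = rep_drow[OF V R S c d]
  let ?r1 = "drow (ob R) (ob S) (ob U) a b" and ?r2 = "drow (ob R) (ob S) (ob V) c d"
  note m = rep_dcol[OF RS U V r1(1) r2(1), unfolded res_simps]
  let ?m = "dcol (dsum (ob R) (ob S)) (ob U) (ob V) ?r1 ?r2"
  have h: "?m \<in> dhom (dsum (ob R) (ob S)) (dsum (ob U) (ob V))" using repD(1)[OF m(1)] by simp
  note ih = repD(1)[OF I(1), unfolded res_simps] repD(1)[OF I(2), unfolded res_simps]
  note ph = repD(1)[OF P(3), unfolded res_simps] repD(1)[OF P(4), unfolded res_simps]
  \<comment> \<open>Composition is nested to the right in \<open>dmat\<close>; regrouping exposes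
    the rows, to which uniqueness out of a direct sum applies.\<close>
  have as: "dpr1 (ob U) (ob V) \<cdot> m' \<cdot> din1 (ob R) (ob S) = (dpr1 (ob U) (ob V) \<cdot> m') \<cdot> din1 (ob R) (ob S)"
      "dpr1 (ob U) (ob V) \<cdot> m' \<cdot> din2 (ob R) (ob S) = (dpr1 (ob U) (ob V) \<cdot> m') \<cdot> din2 (ob R) (ob S)"
      "dpr2 (ob U) (ob V) \<cdot> m' \<cdot> din1 (ob R) (ob S) = (dpr2 (ob U) (ob V) \<cdot> m') \<cdot> din1 (ob R) (ob S)"
      "dpr2 (ob U) (ob V) \<cdot> m' \<cdot> din2 (ob R) (ob S) = (dpr2 (ob U) (ob V) \<cdot> m') \<cdot> din2 (ob R) (ob S)"
    if "m' \<in> dhom (dsum (ob R) (ob S)) (dsum (ob U) (ob V))" for m'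
    using dcomp_assoc[OF ih(1) that ph(1)] dcomp_assoc[OF ih(2) that ph(1)]
      dcomp_assoc[OF ih(1) that ph(2)] dcomp_assoc[OF ih(2) that ph(2)] by simp_all
  have "dmat (ob R) (ob S) (ob U) (ob V) a b c d = ?m"
    unfolding dmat_def
  proof (rule the_equality)
    fix m' assume m': "m' \<in> dhom (dsum (ob R) (ob S)) (dsum (ob U) (ob V)) \<and>
        dpr1 (ob U) (ob V) \<cdot> m' \<cdot> din1 (ob R) (ob S) = a \<and> dpr1 (ob U) (ob V) \<cdot> m' \<cdot> din2 (ob R) (ob S) = b \<and>
        dpr2 (ob U) (ob V) \<cdot> m' \<cdot> din1 (ob R) (ob S) = c \<and> dpr2 (ob U) (ob V) \<cdot> m' \<cdot> din2 (ob R) (ob S) = d"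
    then have h': "m' \<in> dhom (dsum (ob R) (ob S)) (dsum (ob U) (ob V))" by blast
    have "dpr1 (ob U) (ob V) \<cdot> m' = ?r1"
      using mor_from_sum_unique[OF U R S dcomp_hom[OF h' ph(1)], of ?r1] repD(1)[OF r1(1)] r1(2,3) m' as[OF h'] by simp
    moreover have "dpr2 (ob U) (ob V) \<cdot> m' = ?r2"
      using mor_from_sum_unique[OF V R S dcomp_hom[OF h' ph(2)], of ?r2] repD(1)[OF r2(1)] r2(2,3) m' as[OF h'] by simp
    ultimately show "m' = ?m"
      using mor_into_sum_unique[OF RS U V, of m' ?m] h h' m(2,3) by simp
  qed (use h m(2,3) r1(2,3) r2(2,3) as[OF h] in simp)
  then show ?thesis using m(1) by simp
qed

subsection \<open>Distinguished triangles from matrices\<close>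

text \<open>The triangle is compared with the cone of the matrix map U between the resolutions. The
  first two vertical isomorphisms are inverse augmentations, the third is G after an inverse
  augmentation. Homotopy inverseness of G and K makes it invertible, and the last two hypotheses are
  the squares with the inclusion into the cone and the projection from it.\<close>

lemma distinguished_matrix:
  assumes R: "is_res R" and S: "is_res S" and T: "is_res T" and R1: "is_res (rshift R)"
    and u: "rep R S U u" and v: "rep S T V v" and w: "rep T (rshift R) W w"
    and G: "chainmat (bs T) (bcone (bs R) U (bs S)) G" and K: "chainmat (bcone (bs R) U (bs S)) (bs T) K"
    and GK: "mhtp (bcone (bs R) U (bs S)) (bcone (bs R) U (bs S)) (mm (rk (bs T)) G K) imat"
    and KG: "mhtp (bs T) (bs T) (mm (rk (bs R) + rk (bs S)) K G) imat"
    and GV: "mhtp (bs S) (bcone (bs R) U (bs S)) (mm (rk (bs T)) G V) (in2mat (rk (bs R)))"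
    and W: "mhtp (bs T) (bshift (bs R)) (mm (rk (bs R) + rk (bs S)) imat G) W"
  shows "distinguished (ob R) u (ob S) v (ob T) w"
proof -
  note DR = resD[OF R] and DS = resD[OF S] and DT = resD[OF T]
  note ru = repD[OF u] and rv = repD[OF v] and rw = repD[OF w]
  let ?C = "bcone (bs R) U (bs S)"
  note C = is_based_cone[OF DR(1) DS(1) ru(2)]
  note CM = cone_matrices[OF DR(1) DS(1) ru(2)]
  note R' = is_based_shift[OF DR(1)]
  let ?ir = "dinv (cx (bs R)) (aug R) (ob R)" and ?is = "dinv (cx (bs S)) (aug S) (ob S)"
    and ?it = "dinv (cx (bs T)) (aug T) (ob T)"
  let ?G = "dmx (bs T) ?C G" and ?K = "dmx ?C (bs T) K"
  note hG = dmx_hom[OF DT(1) C G] and hK = dmx_hom[OF C DT(1) K]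
  have "?K \<cdot> ?G = did (cx (bs T))"
    using dmx_comp[OF DT(1) C DT(1) G K] id_matrix[OF DT(1)] dmx_eq[OF DT(1) DT(1) _ _ KG] chainmat_mm[OF G K]
    by simp
  moreover have "?G \<cdot> ?K = did (cx ?C)"
    using dmx_comp[OF C DT(1) C K G] id_matrix[OF C] dmx_eq[OF C C _ _ GK] chainmat_mm[OF K G] by simp
  ultimately have iG: "diso (cx (bs T)) ?G (cx ?C)"
    unfolding diso_def using hG hK by blast
  have hU: "dmx (bs R) (bs S) U \<in> dhom (cx (bs R)) (cx (bs S))" by (rule dmx_hom[OF DR(1) DS(1) ru(2)])
  have hV: "dmx (bs S) (bs T) V \<in> dhom (cx (bs S)) (cx (bs T))" by (rule dmx_hom[OF DS(1) DT(1) rv(2)])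
  \<comment> \<open>Naturality of the inverse augmentations: the defining square of
    \<open>rep\<close> with both vertical arrows inverted.\<close>
  have swap: "dinv (cx (bs S')) (aug S') (ob S') \<cdot> p = dmx (bs R') (bs S') M \<cdot> dinv (cx (bs R')) (aug R') (ob R')"
    if "is_res R'" "is_res S'" "rep R' S' M p" for R' S' :: "'a resolved" and M p
  proof -
    note E = resD[OF that(1)] and E' = resD[OF that(2)] and q = repD[OF that(3)]
    note hM = dmx_hom[OF E(1) E'(1) q(2)]
    let ?i = "dinv (cx (bs R')) (aug R') (ob R')" and ?j = "dinv (cx (bs S')) (aug S') (ob S')"
    have "?j \<cdot> p = ?j \<cdot> (p \<cdot> daug R') \<cdot> ?i"
      using dcomp_assoc[OF E(8,7) q(1)] E(9) did_right[OF q(1)] by simp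
    also have "\<dots> = ?j \<cdot> daug S' \<cdot> dmx (bs R') (bs S') M \<cdot> ?i"
      unfolding q(3) using dcomp_assoc[OF E(8) hM E'(7)] by simp
    also have "\<dots> = dmx (bs R') (bs S') M \<cdot> ?i"
      by (rule dcomp_cancel[OF E'(7,8,10) dcomp_hom[OF E(8) hM]])
    finally show ?thesis .
  qed
  show ?thesis
    unfolding distinguished_def
  proof (intro conjI exI)
    show "u \<in> dhom (ob R) (ob S)" "v \<in> dhom (ob S) (ob T)" "w \<in> dhom (ob T) (shift (ob R))"
      using ru rv rw by simp_all
    show "chain_map (cx (bs R)) (mx (bs R) (bs S) U) (cx (bs S))" by (rule chain_mx[OF DR(1) DS(1) ru(2)])
    show "diso (ob R) ?ir (cx (bs R))" "diso (ob S) ?is (cx (bs S))"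
      using DR(3) DS(3) by (simp_all add: diso_dinv)
    show "diso (ob T) (?G \<cdot> ?it) (cone (cx (bs R)) (mx (bs R) (bs S) U) (cx (bs S)))"
      using diso_comp[OF diso_dinv[OF DT(3)] iG] by simp
    show "?is \<cdot> u = dmx (bs R) (bs S) U \<cdot> ?ir" by (rule swap[OF R S u])
    have "(?G \<cdot> ?it) \<cdot> v = ?G \<cdot> dmx (bs S) (bs T) V \<cdot> ?is"
      using dcomp_assoc[OF rv(1) DT(8) hG] swap[OF S T v] by simp
    also have "\<dots> = (?G \<cdot> dmx (bs S) (bs T) V) \<cdot> ?is"
      by (rule dcomp_assoc[OF DS(8) hV hG, symmetric])
    also have "?G \<cdot> dmx (bs S) (bs T) V = cone_in (cx (bs R)) (mx (bs R) (bs S) U) (cx (bs S))"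
      unfolding CM(2) dmx_comp[OF DS(1) DT(1) C rv(2) G]
      by (rule dmx_eq[OF DS(1) C chainmat_mm[OF rv(2) G] CM(1) GV])
    finally show "(?G \<cdot> ?it) \<cdot> v = cone_in (cx (bs R)) (mx (bs R) (bs S) U) (cx (bs S)) \<cdot> ?is" .
    have s1: "?ir\<langle>1\<rangle> = dinv (shift (cx (bs R))) (shift_map (aug R)) (shift (ob R))"
      using DR(3) by (simp add: dinv_def dshift_dclass)
    have hO: "cone_out (cx (bs R)) (mx (bs R) (bs S) U) (cx (bs S)) \<in> dhom (cx ?C) (cx (bshift (bs R)))"
      unfolding CM(4) by (rule dmx_hom[OF C R' CM(3)])
    have "?ir\<langle>1\<rangle> \<cdot> w = dmx (bs T) (bshift (bs R)) W \<cdot> ?it"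
      using swap[OF T R1 w] s1 by simp
    also have "dmx (bs T) (bshift (bs R)) W = cone_out (cx (bs R)) (mx (bs R) (bs S) U) (cx (bs S)) \<cdot> ?G"
    proof -
      have "dmx (bs T) (bshift (bs R)) (mm (rk ?C) imat G) = dmx (bs T) (bshift (bs R)) W"
        using rw(2) W by (intro dmx_eq[OF DT(1) R' chainmat_mm[OF G CM(3)]]) simp_all
      then show ?thesis unfolding CM(4) using dmx_comp[OF DT(1) C R' G CM(3)] by simp
    qed
    also have "\<dots> \<cdot> ?it = cone_out (cx (bs R)) (mx (bs R) (bs S) U) (cx (bs S)) \<cdot> ?G \<cdot> ?it"
      by (rule dcomp_assoc[OF DT(8) hG hO])
    finally show "?ir\<langle>1\<rangle> \<cdot> w = cone_out (cx (bs R)) (mx (bs R) (bs S) U) (cx (bs S)) \<cdot> ?G \<cdot> ?it" .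
  qed
qed

section \<open>Resolutions of shifted objects\<close>

lemma two_term_shift: "two_term P \<Longrightarrow> two_term (bshift P)"
  by (simp add: two_term_def is_based_shift)

text \<open>The two complexes have the same terms, but their differentials need to agree only on the
  carriers, because negation in a direct sum is unspecified elsewhere. Chain maps and homotopies
  depend only on values on the carriers, so projectivity carries over.\<close>

lemma kproj_shift_dsum:
  assumes P: "bounded_complex P" and Q: "bounded_complex Q" and k: "kproj (dsum (shift P) (shift Q))"
  shows "kproj (shift (dsum P Q))"
proof -
  let ?A = "shift (dsum P Q)" and ?B = "dsum (shift P) (shift Q)"
  have o: "obj ?A n = obj ?B n" for n by simp
  have d: "diff ?A n v = diff ?B n v" if "v \<in> el ?B n" for n v
    using that P Q by (auto elim!: dsum_cases)
  have bA: "bounded_complex ?A" and bB: "bounded_complex ?B" using P Q by simp_all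
  have c: "chain_map ?A f Y \<longleftrightarrow> chain_map ?B f Y" for f Y
    unfolding chain_map_def using o d bA bB by auto
  have h: "hq ?A Y f g \<longleftrightarrow> hq ?B Y f g" for f g Y
    unfolding hq_def c homotopic_def o using d by auto
  show ?thesis using k unfolding kproj_def c h using bA by blast
qed

lemma is_res_shift_sum:
  assumes R: "is_res R" and S: "is_res S" and R': "is_res (rshift R)" and S': "is_res (rshift S)"
  shows "is_res (rshift (rsum R S))"
proof -
  have "kproj (dsum (shift (cx (bs R))) (shift (cx (bs S))))"
    using resD(2)[OF R'] resD(2)[OF S'] by (simp add: kproj_dsum)
  then show ?thesis
    using is_res_sum[OF R S] kproj_shift_dsum[OF resD(6)[OF R] resD(6)[OF S]]
    by (simp add: is_res_def is_based_shift quasi_iso_shift)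
qed

text \<open>The shift of a two-term complex is again two-term, so its homotopical projectivity comes
  from the same lifting argument.\<close>

lemma is_res_shift:
  assumes "is_res R" "two_term (bs R)" shows "is_res (rshift R)"
  using assms kproj_two_term[OF two_term_shift[OF assms(2)]]
  by (simp add: is_res_def is_based_shift quasi_iso_shift)

section \<open>The modules $R_n$\<close>

text \<open>The element type consists of cosets and pairs; a polynomial in a free module is
  therefore stored as the singleton containing it.\<close>

definition fe :: "'k::field poly \<Rightarrow> 'k poly elt" where "fe p = Coset {p}"
definition ev :: "'k::field poly elt \<Rightarrow> 'k poly" where "ev u = the_elem (the_coset u)"

lemma ev_fe [simp]: "ev (fe p) = p" by (simp add: ev_def fe_def)

lemma fe_inj [simp]: "fe p = fe q \<longleftrightarrow> p = q" by (simp add: fe_def)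

text \<open>The flag chooses between k[x] and the zero module inside the same encoding, which gives
  one formula for the terms of a resolution in all degrees.\<close>

definition fr_mod :: "bool \<Rightarrow> 'k::field poly rmod" where
  "fr_mod b = \<lparr>carrier = {fe p | p. b \<or> p = 0}, monoid.mult = undefined, one = undefined,
     ring.zero = fe 0, add = (\<lambda>u v. fe (ev u + ev v)), module.smult = (\<lambda>r u. fe (r * ev u))\<rparr>"

lemma fr_mod_simps [simp]:
  "\<zero>\<^bsub>fr_mod b\<^esub> = fe 0" "u \<oplus>\<^bsub>fr_mod b\<^esub> v = fe (ev u + ev v)" "r \<odot>\<^bsub>fr_mod b\<^esub> u = fe (r * ev u)"
  by (simp_all add: fr_mod_def)

lemma fe_in_fr [simp]: "fe p \<in> carrier (fr_mod b) \<longleftrightarrow> b \<or> p = 0"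
  by (auto simp: fr_mod_def)

lemma fr_cases:
  assumes "u \<in> carrier (fr_mod b)" obtains p where "u = fe p" "b \<or> p = 0"
  using assms by (auto simp: fr_mod_def)

lemma module_fr: "module kx (fr_mod b)"
proof (rule moduleI)
  show "abelian_group (fr_mod b)"
  proof (rule abelian_groupI)
    fix x assume "x \<in> carrier (fr_mod b)"
    then show "\<exists>y\<in>carrier (fr_mod b). y \<oplus>\<^bsub>fr_mod b\<^esub> x = \<zero>\<^bsub>fr_mod b\<^esub>"
      by (auto elim!: fr_cases intro!: bexI[of _ "fe (- ev x)"])
  qed (auto elim!: fr_cases simp: algebra_simps)
qed (auto elim!: fr_cases simp: algebra_simps cring_kx)

lemma fg_fr: "fg_module (fr_mod b)"
proof (rule fg_moduleI[OF module_fr, of "fe (if b then 1 else 0)"])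
  fix v assume "v \<in> carrier (fr_mod b)"
  then show "\<exists>p. v = p \<odot>\<^bsub>fr_mod b\<^esub> fe (if b then 1 else 0)"
    by (auto elim!: fr_cases intro!: exI[of _ "ev v"])
qed simp

section \<open>Residue classes modulo powers of x\<close>

definition cls :: "nat \<Rightarrow> 'k::field poly \<Rightarrow> 'k poly elt" where
  "cls n p = Coset {q. xpow n dvd q - p}"

lemma xideal_eq: "xideal n = {q :: 'k::field poly. xpow n dvd q}"
  by (auto simp: xideal_def cgenideal_def dvd_def mult.commute)

lemma dvd_diff_shift: "(p :: 'k::field poly) dvd q - a \<Longrightarrow> p dvd q - b \<longleftrightarrow> p dvd a - b"
  using dvd_add_right_iff[of p "q - a" "a - b"] by simp

lemma cls_eq_iff: "cls n p = cls n q \<longleftrightarrow> xpow n dvd p - q"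
proof -
  have "{r. xpow n dvd r - p} = {r. xpow n dvd r - q} \<longleftrightarrow> xpow n dvd p - q"
  proof
    assume "{r. xpow n dvd r - p} = {r. xpow n dvd r - q}"
    moreover have "p \<in> {r. xpow n dvd r - p}" by simp
    ultimately show "xpow n dvd p - q" by blast
  next
    assume "xpow n dvd p - q"
    then have "xpow n dvd q - p" using dvd_minus_iff[of "xpow n" "p - q"] by simp
    then show "{r. xpow n dvd r - p} = {r. xpow n dvd r - q}"
      using \<open>xpow n dvd p - q\<close> dvd_diff_shift by blast
  qed
  then show ?thesis by (simp add: cls_def)
qed

lemma regular_module_simps [simp]:
  "carrier regular_module = UNIV" "p \<oplus>\<^bsub>regular_module\<^esub> q = p + q" "r \<odot>\<^bsub>regular_module\<^esub> p = r * p"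
  by (simp_all add: regular_module_def ring.defs)

lemma regular_coset: "xideal n +>\<^bsub>regular_module\<^esub> p = {q. xpow n dvd q - p}"
proof -
  have "q \<in> xideal n +>\<^bsub>regular_module\<^esub> p \<longleftrightarrow> xpow n dvd q - p" for q
  proof -
    have "q \<in> xideal n +>\<^bsub>regular_module\<^esub> p \<longleftrightarrow> (\<exists>h. xpow n dvd h \<and> q = h + p)"
      by (auto simp: a_r_coset_def' xideal_eq)
    also have "\<dots> \<longleftrightarrow> xpow n dvd q - p" by (metis add_diff_cancel_right' diff_add_cancel)
    finally show ?thesis .
  qed
  then show ?thesis by blast
qed

lemma kx_coset: "xideal n +>\<^bsub>kx\<^esub> p = {q. xpow n dvd q - p}"
proof -
  have "q \<in> xideal n +>\<^bsub>kx\<^esub> p \<longleftrightarrow> xpow n dvd q - p" for q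
  proof -
    have "q \<in> xideal n +>\<^bsub>kx\<^esub> p \<longleftrightarrow> (\<exists>h. xpow n dvd h \<and> q = h + p)"
      by (auto simp: a_r_coset_def' xideal_eq)
    also have "\<dots> \<longleftrightarrow> xpow n dvd q - p" by (metis add_diff_cancel_right' diff_add_cancel)
    finally show ?thesis .
  qed
  then show ?thesis by blast
qed

lemma carrier_Rmod: "carrier (Rmod n) = range (cls n)"
  by (auto simp: Rmod_def Let_def quot_module_def A_RCOSETS_def' regular_coset cls_def image_iff)

lemma coset_add:
  "(\<Union>h\<in>{q. xpow n dvd q - p}. \<Union>k\<in>{q. xpow n dvd q - p'}. {h + k}) = {q :: 'k::field poly. xpow n dvd q - (p + p')}"
proof (intro Set.set_eqI iffI)
  fix q :: "'k poly" assume "q \<in> {q. xpow n dvd q - (p + p')}"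
  then show "q \<in> (\<Union>h\<in>{q. xpow n dvd q - p}. \<Union>k\<in>{q. xpow n dvd q - p'}. {h + k})"
    by (intro UN_I[of p] UN_I[of "q - p"]) (simp_all add: algebra_simps)
next
  fix q :: "'k poly" assume "q \<in> (\<Union>h\<in>{q. xpow n dvd q - p}. \<Union>k\<in>{q. xpow n dvd q - p'}. {h + k})"
  then obtain h k where "xpow n dvd h - p" "xpow n dvd k - p'" "q = h + k" by auto
  then show "q \<in> {q. xpow n dvd q - (p + p')}"
    using dvd_add[of "xpow n" "h - p" "k - p'"] by (simp add: algebra_simps)
qed

lemma coset_smult:
  "(\<Union>c\<in>{q. xpow n dvd q - p}. {q. xpow n dvd q - r * c}) = {q :: 'k::field poly. xpow n dvd q - r * p}"
proof (intro Set.set_eqI iffI)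
  fix q :: "'k poly" assume "q \<in> (\<Union>c\<in>{q. xpow n dvd q - p}. {q. xpow n dvd q - r * c})"
  then obtain c where "xpow n dvd c - p" "xpow n dvd q - r * c" by auto
  then have "xpow n dvd r * (c - p) + (q - r * c)" by (intro dvd_add dvd_mult)
  then show "q \<in> {q. xpow n dvd q - r * p}" by (simp add: algebra_simps)
qed (auto intro: exI[of _ p])

lemma Rmod_simps [simp]:
  "\<zero>\<^bsub>Rmod n\<^esub> = cls n 0" "cls n p \<oplus>\<^bsub>Rmod n\<^esub> cls n q = cls n (p + q)" "r \<odot>\<^bsub>Rmod n\<^esub> cls n p = cls n (r * p)"
  unfolding Rmod_def Let_def quot_module_def cls_def
  by (simp_all add: set_add_def' regular_coset coset_add coset_smult) (simp add: xideal_eq)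

lemma cls_in [simp]: "cls n p \<in> carrier (Rmod n)"
  by (simp add: carrier_Rmod)

lemma cls_cases: assumes "u \<in> carrier (Rmod n)" obtains p where "u = cls n p"
  using assms by (auto simp: carrier_Rmod)

lemma module_Rmod: "module kx (Rmod n :: 'k::field poly rmod)"
proof (rule moduleI)
  show "abelian_group (Rmod n :: 'k poly rmod)"
  proof (rule abelian_groupI)
    fix x :: "'k poly elt" assume "x \<in> carrier (Rmod n)"
    then obtain p where "x = cls n p" by (rule cls_cases)
    then show "\<exists>y\<in>carrier (Rmod n). y \<oplus>\<^bsub>Rmod n\<^esub> x = \<zero>\<^bsub>Rmod n\<^esub>"
      by (intro bexI[of _ "cls n (- p)"]) simp_all
  qed (auto elim!: cls_cases simp: algebra_simps)
qed (auto elim!: cls_cases simp: algebra_simps cring_kx)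

lemma fg_Rmod: "fg_module (Rmod n)"
  by (rule fg_moduleI[OF module_Rmod, of "cls n 1"]) (auto elim!: cls_cases)

lemma Rmod_neg: "\<ominus>\<^bsub>Rmod n\<^esub> (cls n p) = cls n (- p)"
  by (rule mod_a_inv_unique[OF module_Rmod]) simp_all

text \<open>Independence of the representative is where the hypothesis enters: x^i times a multiple
  of x^m is a multiple of x^(m+i), hence of x^n.\<close>

lemma Rmap_cls:
  assumes "n \<le> m + i" shows "Rmap n i (cls m p) = cls n (xpow i * p)"
proof -
  have "(\<Union>c\<in>{q. xpow m dvd q - p}. {q. xpow n dvd q - xpow i * c}) = {q. xpow n dvd q - xpow i * p}"
  proof (intro Set.set_eqI iffI)
    fix q assume "q \<in> (\<Union>c\<in>{q. xpow m dvd q - p}. {q. xpow n dvd q - xpow i * c})"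
    then obtain c where c: "xpow m dvd c - p" "xpow n dvd q - xpow i * c" by auto
    have "xpow n dvd xpow (m + i) * (1 :: 'a poly)" using assms by (simp add: le_imp_power_dvd)
    also have "xpow (m + i) * 1 dvd xpow i * (c - p)"
      using c(1) by (simp add: power_add mult.commute mult_dvd_mono)
    finally have "xpow n dvd xpow i * (c - p) + (q - xpow i * c)" using c(2) by (rule dvd_add)
    then show "q \<in> {q. xpow n dvd q - xpow i * p}" by (simp add: algebra_simps)
  qed (auto intro: exI[of _ p])
  then show ?thesis by (simp add: Rmap_def cls_def kx_coset)
qed

lemma linear_Rmap: "n \<le> m + i \<Longrightarrow> linear_map (Rmod m) (Rmod n) (Rmap n i)"
  by (rule linear_mapI) (auto elim!: cls_cases simp: Rmap_cls algebra_simps)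


subsection \<open>Free resolutions\<close>

text \<open>A matrix as its list of rows; only entries below the ranks are ever read. From here on
  \<open>ml\<close> denotes this constant and not the octahedron field of the same name.\<close>

definition ml :: "'a list list \<Rightarrow> nat \<Rightarrow> nat \<Rightarrow> 'a" where
  "ml L i j = L ! i ! j"

text \<open>Unfolds matrix identities into finitely many polynomial identities. The sizes are the
  ranks of the resolutions, of their sums and of the cones that occur.\<close>

lemma small_all:
  "(\<forall>i<(2::nat). P i) \<longleftrightarrow> P 0 \<and> P 1"
  "(\<forall>i<(4::nat). P i) \<longleftrightarrow> P 0 \<and> P 1 \<and> P 2 \<and> P 3"
  "(\<forall>i<(6::nat). P i) \<longleftrightarrow> P 0 \<and> P 1 \<and> P 2 \<and> P 3 \<and> P 4 \<and> P 5"
  "(\<forall>i<(8::nat). P i) \<longleftrightarrow> P 0 \<and> P 1 \<and> P 2 \<and> P 3 \<and> P 4 \<and> P 5 \<and> P 6 \<and> P 7"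
  by (simp_all add: numeral_eq_Suc All_less_Suc conj_ac)

lemma small_sum:
  fixes g :: "nat \<Rightarrow> 'a::comm_monoid_add"
  shows "(\<Sum>k<2. g k) = g 0 + g 1"
  "(\<Sum>k<4. g k) = g 0 + g 1 + g 2 + g 3"
  "(\<Sum>k<6. g k) = g 0 + g 1 + g 2 + g 3 + g 4 + g 5"
  "(\<Sum>k<8. g k) = g 0 + g 1 + g 2 + g 3 + g 4 + g 5 + g 6 + g 7"
  by (simp_all add: numeral_eq_Suc)

lemmas small_simps = small_all small_sum

text \<open>The free resolution of R_n by x^n on k[x], placed in degrees -1 and 0. Basis element 0
  lies in degree 0 and basis element 1 in degree -1, hence the position of x^n in row 0 and column
  1.\<close>

definition Pn :: "nat \<Rightarrow> 'k::field based" where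
  "Pn n = \<lparr>cx = \<lparr>obj = (\<lambda>i. fr_mod (i = 0 \<or> i = -1)), diff = (\<lambda>i v. fe (if i = -1 then xpow n * ev v else 0))\<rparr>,
     rk = 2, dg = (\<lambda>j. if j = 0 then 0 else -1), df = ml [[0, xpow n], [0, 0]],
     cd = (\<lambda>i v j. if (i = 0 \<and> j = 0) \<or> (i = -1 \<and> j = 1) then ev v else 0),
     cmb = (\<lambda>i c. fe (if i = 0 then c 0 else if i = -1 then c 1 else 0))\<rparr>"

lemma Pn_simps [simp]:
  "obj (cx (Pn n)) i = fr_mod (i = 0 \<or> i = -1)" "diff (cx (Pn n)) i v = fe (if i = -1 then xpow n * ev v else 0)"
  "rk (Pn n) = 2" "dg (Pn n) j = (if j = 0 then 0 else -1)" "df (Pn n) = ml [[0, xpow n], [0, 0]]"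
  "cd (Pn n) i v j = (if (i = 0 \<and> j = 0) \<or> (i = -1 \<and> j = 1) then ev v else 0)"
  "cmb (Pn n) i c = fe (if i = 0 then c 0 else if i = -1 then c 1 else 0)"
  by (simp_all add: Pn_def)

lemma bc_Pn: "bounded_complex (cx (Pn n))"
proof (rule bounded_complexI[where N = 1])
  show "linear_map (obj (cx (Pn n)) i) (obj (cx (Pn n)) (i + 1)) (diff (cx (Pn n)) i)" for i
    by (rule linear_mapI) (auto simp: algebra_simps)
  show "el (cx (Pn n)) i = {\<zero>\<^bsub>obj (cx (Pn n)) i\<^esub>}" if "\<bar>i\<bar> > 1" for i
    using that by (auto elim!: fr_cases)
qed (simp_all add: fg_fr)

lemma two_term_Pn: "two_term (Pn n)"
proof -
  have "is_based (Pn n)"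
    unfolding is_based_def using bc_Pn[of n]
    by (auto elim!: fr_cases simp: less_2_cases_iff small_simps ml_def)
  then show ?thesis by (simp add: two_term_def)
qed

lemma Rn_simps [simp]:
  "obj (Rn n) i = (if i = 0 then Rmod n else Rmod 0)"
  "diff (Rn n) i v = cls (if i = -1 then n else 0) 0"
proof -
  have "i + 1 = 0 \<longleftrightarrow> i = -1" for i :: int by auto
  then show "obj (Rn n) i = (if i = 0 then Rmod n else Rmod 0)"
    "diff (Rn n) i v = cls (if i = -1 then n else 0) 0"
    by (simp_all add: Rn_def stalk_def Let_def)
qed

lemma cls_zero_eq: "cls 0 p = cls 0 q"
  by (simp add: cls_eq_iff)

lemma carrier_Rmod0: "carrier (Rmod 0) = {cls 0 0}"
  using cls_zero_eq by (auto simp: carrier_Rmod)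

lemma bc_Rn: "bounded_complex (Rn n)"
proof (rule bounded_complexI[where N = 0])
  show "linear_map (obj (Rn n) i) (obj (Rn n) (i + 1)) (diff (Rn n) i)" for i
    by (rule linear_mapI) auto
qed (auto simp: fg_Rmod carrier_Rmod0)

definition RR :: "nat \<Rightarrow> 'k::field resolved" where
  "RR n = \<lparr>bs = Pn n, aug = (\<lambda>i v. if i = 0 then cls n (ev v) else cls 0 0), ob = Rn n\<rparr>"

lemma RR_ob [simp]: "bs (RR n) = Pn n" "ob (RR n) = Rn n"
  by (simp_all add: RR_def)

lemma aug_RR [simp]: "aug (RR n) i v = (if i = 0 then cls n (ev v) else cls 0 0)"
  by (simp add: RR_def)

lemma is_res_RR: "is_res (RR n :: 'k::field resolved)"
proof -
  have c: "chain_map (cx (Pn n)) (aug (RR n)) (Rn n :: 'k poly cplx)"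
  proof (rule chain_mapI[OF bc_Pn bc_Rn])
    show "linear_map (obj (cx (Pn n)) i) (obj (Rn n) i) (aug (RR n) i)" for i
      by (rule linear_mapI) auto
    show "diff (Rn n) i (aug (RR n) i v) = aug (RR n) (i + 1) (diff (cx (Pn n)) i v)" for i v
      by (auto simp: cls_eq_iff)
  qed
  have "quasi_iso (cx (Pn n)) (aug (RR n)) (Rn n :: 'k poly cplx)"
  proof (rule quasi_isoI[OF c])
    fix i z b assume z: "z \<in> el (cx (Pn n)) i" "diff (cx (Pn n)) i z = \<zero>\<^bsub>obj (cx (Pn n)) (i + 1)\<^esub>"
      and b: "aug (RR n) i z = diff (Rn n :: 'k poly cplx) (i - 1) b"
    \<comment> \<open>Outside degree 0 every cocycle is zero; in degree -1 this is injectivity of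
      multiplication by x^n.\<close>
    consider "i = 0" | "i \<noteq> 0" "z = fe 0"
      using z by (auto elim!: fr_cases)
    then show "\<exists>a\<in>el (cx (Pn n)) (i - 1). z = diff (cx (Pn n)) (i - 1) a"
    proof cases
      case 1
      then obtain p where p: "z = fe p" using z by (auto elim: fr_cases)
      then have "xpow n dvd p" using b 1 by (simp add: cls_eq_iff)
      then obtain q where "p = xpow n * q" by (elim dvdE)
      then show ?thesis using p 1 by (intro bexI[of _ "fe q"]) simp_all
    next
      case 2
      then show ?thesis by (intro bexI[of _ "fe 0"]) simp_all
    qed
  next
    fix i and w :: "'k poly elt" assume w: "w \<in> el (Rn n) i"
    obtain p where p: "w = aug (RR n) i (fe p)" "i = 0 \<or> p = 0"
      using w by (cases "i = 0") (auto elim!: cls_cases simp: carrier_Rmod0)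
    then show "\<exists>z\<in>el (cx (Pn n)) i. diff (cx (Pn n)) i z = \<zero>\<^bsub>obj (cx (Pn n)) (i + 1)\<^esub> \<and>
        (\<exists>b\<in>el (Rn n) (i - 1). w = aug (RR n) i z \<oplus>\<^bsub>obj (Rn n) i\<^esub> diff (Rn n) (i - 1) b)"
      \<comment> \<open>The last witness is the zero of degree i - 1, which lives in R_n exactly
        when i = 1.\<close>
      by (intro bexI[of _ "fe p"] conjI bexI[of _ "cls (if i = 1 then n else 0) 0"]) auto
  qed
  then show ?thesis
    using kproj_two_term[OF two_term_Pn] two_term_Pn by (auto simp: is_res_def two_term_def)
qed

lemma chain_stalk_map:
  assumes "n \<le> m + i" shows "chain_map (Rn m) (stalk_map (Rmap n i)) (Rn n)"
proof (rule chain_mapI[OF bc_Rn bc_Rn])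
  show "linear_map (obj (Rn m) j) (obj (Rn n) j) (stalk_map (Rmap n i) j)" for j
    using linear_Rmap[OF assms] by (cases "j = 0") (auto simp: stalk_map_def intro!: linear_mapI)
qed (auto simp: stalk_map_def Rmap_cls[OF assms])

text \<open>The lift is x^i in degree 0; since x^i x^m = x^n x^(m+i-n), commutation with the
  differentials forces x^(m+i-n) in degree -1.\<close>

lemma rep_xmor:
  assumes "n \<le> m + i"
  shows "rep (RR m) (RR n) (ml [[xpow i, 0], [0, xpow (m + i - n)]]) (xmor m n i)"
proof -
  let ?M = "ml [[xpow i, 0], [0, xpow (m + i - n)]] :: nat \<Rightarrow> nat \<Rightarrow> 'a poly"
  have "chainmat (Pn m) (Pn n) ?M"
    using assms by (simp add: chainmat_def dcond_def mm_def small_simps ml_def power_add[symmetric] add.commute)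
  moreover have "stalk_map (Rmap n i) j (aug (RR m) j v) = aug (RR n) j (mx (Pn m) (Pn n) ?M j v)"
    if "v \<in> el (cx (Pn m)) j" for j v
    using that Rmap_cls[OF assms]
    by (cases "j = 0") (auto elim!: fr_cases simp: stalk_map_def mx_def mxm_def small_simps ml_def)
  ultimately have "rep (RR m) (RR n) ?M (dmap (ob (RR m)) (stalk_map (Rmap n i)) (ob (RR n)))"
    using chain_stalk_map[OF assms] by (intro rep_mx is_res_RR) simp_all
  then show ?thesis by (simp add: xmor_def)
qed

text \<open>The inverted leg of the roof is resolved by lifting the augmentation of
  \<open>Pn m\<close> through the cone of x^m. Projecting this lift to R_n[1] sends the generator of
  degree -1 to the class of 1, which is the single entry 1. There is no sign because the projection
  of the cone has none.\<close>

lemma rep_ymor: "rep (RR m) (rshift (RR n)) (ml [[0, 1], [0, 0]]) (ymor m n :: 'k::field poly dmor)"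
proof -
  let ?M = "ml [[0, 1], [0, 0]] :: nat \<Rightarrow> nat \<Rightarrow> 'k poly"
  let ?u = "stalk_map (Rmap (n + m) m) :: 'k poly gmap" and ?v = "stalk_map (Rmap m 0) :: 'k poly gmap"
  let ?C = "cone (Rn n) ?u (Rn (n + m))" and ?q = "\<lambda>i w. ?v i (psnd w)"
  have u: "chain_map (Rn n) ?u (Rn (n + m))" and v: "chain_map (Rn (n + m)) ?v (Rn m)"
    by (simp_all add: chain_stalk_map)
  have u0: "?u 0 (cls n p) = cls (n + m) (xpow m * p)" and v0: "?v 0 (cls (n + m) p) = cls m p"
    and u1: "i \<noteq> 0 \<Longrightarrow> ?u i w = cls 0 0" and v1: "i \<noteq> 0 \<Longrightarrow> ?v i w = cls 0 0" for p i w
    by (simp_all add: stalk_map_def Rmap_cls)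
  note [simp] = u0 v0 u1 v1 Rmod_neg
  \<comment> \<open>In each degree at most one component of the cone can be nonzero: the second in
    degree 0, the first in degree -1.\<close>
  have cases: "(\<exists>p. i = 0 \<and> w = Pr (cls 0 0) (cls (n + m) p)) \<or> (\<exists>p. i = -1 \<and> w = Pr (cls n p) (cls 0 0)) \<or>
      (i \<noteq> 0 \<and> i \<noteq> -1 \<and> w = Pr (cls 0 0) (cls 0 0))" if "w \<in> el ?C i" for i w
  proof -
    obtain a b where w: "w = Pr a b" and a: "a \<in> el (Rn n) (i + 1)" and b: "b \<in> el (Rn (n + m)) i"
      using \<open>w \<in> el ?C i\<close> by (auto elim!: dsum_cases)
    have "(\<exists>p. b = cls (n + m) p) \<or> i \<noteq> 0" "b = cls 0 0 \<or> i = 0"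
      using b by (auto simp: carrier_Rmod0 elim: cls_cases split: if_splits)
    moreover have "(\<exists>p. a = cls n p) \<or> i \<noteq> -1" "a = cls 0 0 \<or> i = -1"
      using a by (auto simp: carrier_Rmod0 elim: cls_cases split: if_splits)
    ultimately show ?thesis unfolding w by auto
  qed
  have qc: "chain_map ?C ?q (Rn m)"
  proof (rule chain_mapI[OF bc_cone[OF u] bc_Rn])
    show "linear_map (obj ?C i) (obj (Rn m) i) (?q i)" for i
      using linear_map_comp[OF linear_map_psnd chain_mapD(3)[OF v, of i], of "obj (Rn n) (i + 1)"] by (simp add: comp_def)
    show "diff (Rn m) i (?q i w) = ?q (i + 1) (diff ?C i w)" if "w \<in> el ?C i" for i w
      using cases[OF that] by (auto simp: cls_eq_iff)
  qed
  have q: "quasi_iso ?C ?q (Rn m)"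
  proof (rule quasi_isoI[OF qc])
    fix i z b assume z: "z \<in> el ?C i" "diff ?C i z = \<zero>\<^bsub>obj ?C (i + 1)\<^esub>"
      and b: "?q i z = diff (Rn m) (i - 1) b"
    consider p where "i = 0" "z = Pr (cls 0 0) (cls (n + m) p)" | p where "i = -1" "z = Pr (cls n p) (cls 0 0)"
      | "i \<noteq> 0" "i \<noteq> -1" "z = Pr (cls 0 0) (cls 0 0)"
      using cases[OF z(1)] by blast
    then show "\<exists>a\<in>el ?C (i - 1). z = diff ?C (i - 1) a"
    proof cases
      case 1
      then have "xpow m dvd p" using b by (simp add: cls_eq_iff)
      then obtain r where "p = xpow m * r" by (elim dvdE)
      then show ?thesis using 1 by (intro bexI[of _ "Pr (cls n r) (cls 0 0)"]) simp_all
    next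
      case 2
      \<comment> \<open>A cocycle of degree -1 vanishes because x^m maps R_n injectively to
        R_(n+m).\<close>
      then have "xpow (n + m) dvd xpow m * p" using z(2) by (simp add: cls_eq_iff)
      then have "xpow m * xpow n dvd xpow m * p" by (simp add: power_add mult.commute)
      then have "xpow n dvd p" by simp
      then have "cls n p = cls n 0" by (simp add: cls_eq_iff)
      then show ?thesis using 2 by (intro bexI[of _ "Pr (cls 0 0) (cls 0 0)"]) simp_all
    next
      case 3
      then show ?thesis by (intro bexI[of _ "Pr (cls 0 0) (cls (if i = 1 then n + m else 0) 0)"]) auto
    qed
  next
    fix i and w :: "'k poly elt" assume w: "w \<in> el (Rn m) i"
    obtain p where p: "w = cls (if i = 0 then m else 0) p" "i = 0 \<or> p = 0"
      using w by (cases "i = 0") (auto elim!: cls_cases simp: carrier_Rmod0)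
    show "\<exists>z\<in>el ?C i. diff ?C i z = \<zero>\<^bsub>obj ?C (i + 1)\<^esub> \<and>
        (\<exists>b\<in>el (Rn m) (i - 1). w = ?q i z \<oplus>\<^bsub>obj (Rn m) i\<^esub> diff (Rn m) (i - 1) b)"
      using p
      by (intro bexI[of _ "Pr (cls (if i = -1 then n else 0) 0) (cls (if i = 0 then n + m else 0) p)"] conjI
          bexI[of _ "cls (if i = 1 then m else 0) 0"]) auto
  qed
  \<comment> \<open>The lift of the augmentation through the cone: the class modulo x^(n+m) in
    degree 0 and the class modulo x^n in degree -1. Both differentials are multiplication by x^m, so
    it is a chain map.\<close>
  define \<kappa> where "\<kappa> i v = Pr (if i = -1 then cls n (ev v) else cls 0 0) (if i = 0 then cls (n + m) (ev v) else cls 0 0)"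
    for i :: int and v :: "'k poly elt"
  have k: "chain_map (cx (Pn m)) \<kappa> ?C"
  proof (rule chain_mapI[OF bc_Pn bc_cone[OF u]])
    fix i
    show "linear_map (obj (cx (Pn m)) i) (obj ?C i) (\<kappa> i)"
      by (rule linear_mapI) (auto simp: \<kappa>_def)
    show "diff ?C i (\<kappa> i v) = \<kappa> (i + 1) (diff (cx (Pn m)) i v)" if "v \<in> el (cx (Pn m)) i" for v
      using that by (cases "i = 0"; cases "i = -1"; cases "i = -2") (auto simp: \<kappa>_def elim!: fr_cases)
  qed
  have M: "chainmat (Pn m) (bshift (Pn n)) ?M"
    by (simp add: chainmat_def dcond_def mm_def small_simps ml_def)
  note DR = resD[OF is_res_RR[of m]] and S = is_res_shift[OF is_res_RR[of n], unfolded RR_ob, OF two_term_Pn]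
  note DS = resD[OF S] and mc = chain_mx[OF DR(1) DS(1), unfolded RR_ob res_simps, OF M]
  have o: "cone_out (Rn n) ?u (Rn (n + m)) \<in> dhom ?C (shift (Rn n))"
    unfolding cone_out_def using chain_cone_out[OF u] by (rule dmap_hom)
  note iq = dinv_hom[OF q]
  have y: "ymor m n = cone_out (Rn n) ?u (Rn (n + m)) \<cdot> dinv ?C ?q (Rn m)"
    by (simp add: ymor_def dinv_def Let_def)
  have "daug (RR m) = dmap ?C ?q (Rn m) \<cdot> dmap (cx (Pn m)) \<kappa> ?C"
    unfolding dmap_comp[OF k qc] RR_ob
    by (rule dmap_eq[OF DR(4)[unfolded RR_ob] chain_map_comp[OF k qc]]) (simp add: \<kappa>_def)
  then have "dinv ?C ?q (Rn m) \<cdot> daug (RR m) = dmap (cx (Pn m)) \<kappa> ?C"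
    using dcomp_cancel[OF dmap_hom[OF qc] iq dinv_left[OF q] dmap_hom[OF k]] by simp
  then have "ymor m n \<cdot> daug (RR m) = cone_out (Rn n) ?u (Rn (n + m)) \<cdot> dmap (cx (Pn m)) \<kappa> ?C"
    unfolding y using dcomp_assoc[OF DR(7)[unfolded RR_ob] iq o] by simp
  also have "\<dots> = daug (rshift (RR n)) \<cdot> dmx (bs (RR m)) (bs (rshift (RR n))) ?M"
    unfolding cone_out_def dmap_comp[OF k chain_cone_out[OF u]] res_simps RR_ob
      dmap_comp[OF mc DS(4)[unfolded res_simps RR_ob]]
  proof (rule dmap_eq[OF chain_map_comp[OF k chain_cone_out[OF u]] chain_map_comp[OF mc DS(4)[unfolded res_simps RR_ob]]])
    fix i and v :: "'k poly elt" assume "v \<in> el (cx (Pn m)) i"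
    then show "(pfst \<circ> \<kappa> i) v = (shift_map (aug (RR n)) i \<circ> mx (Pn m) (bshift (Pn n)) ?M i) v"
      by (cases "i = -1") (auto elim!: fr_cases simp: \<kappa>_def mx_def mxm_def small_simps ml_def)
  qed
  finally show ?thesis
    unfolding rep_def using M y dcomp_hom[OF iq o] by simp
qed

text \<open>If x^N kills the terms of the complex, every element contributing to the multiple of a
  cohomology class is zero, and the class becomes the coset of coboundaries.\<close>

lemma in_Db0I:
  assumes X: "bounded_complex X" and N: "\<And>n v. v \<in> el X n \<Longrightarrow> xpow N \<odot>\<^bsub>obj X n\<^esub> v = \<zero>\<^bsub>obj X n\<^esub>"
  shows "in_Db0 X"
  unfolding in_Db0_def
proof (intro conjI X exI[of _ N] allI ballI)
  fix n c assume "c \<in> carrier (cohomology X n)"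
  then obtain z where z: "c = coset X n z" "z \<in> el X n"
    by (auto simp: carrier_cohomology in_cocycles)
  have "w \<in> el X n" if "w \<in> c" for w
    using that z X by (auto simp: in_coset)
  then have "xpow N \<odot>\<^bsub>obj X n\<^esub> w = \<zero>\<^bsub>obj X n\<^esub>" if "w \<in> c" for w
    using N that by blast
  moreover have "z \<in> c"
    unfolding z in_coset using X z by (intro bexI[of _ "\<zero>\<^bsub>obj X (n - 1)\<^esub>"]) (simp_all add: bc_pred_lin)
  moreover have "coset X n \<zero>\<^bsub>obj X n\<^esub> = coboundaries X n"
  proof (rule Set.set_eqI)
    show "w \<in> coset X n \<zero>\<^bsub>obj X n\<^esub> \<longleftrightarrow> w \<in> coboundaries X n" for w
      using X by (auto simp: in_coset coboundaries_def)
  qed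
  ultimately have "(\<Union>w\<in>c. coset X n (xpow N \<odot>\<^bsub>obj X n\<^esub> w)) = coboundaries X n"
    by auto
  then show "xpow N \<odot>\<^bsub>cohomology X n\<^esub> c = \<zero>\<^bsub>cohomology X n\<^esub>"
    by (simp add: cohomology_def quot_module_def coset_def a_r_coset_def')
qed

section \<open>The two octahedra\<close>

text \<open>An opaque name for the variable, so that matrix identities are settled by ring
  normalisation rather than by arithmetic on coefficients.\<close>

definition xx :: "'k::field poly" where "xx = [:0, 1:]"

text \<open>The resolved forms of D = F for i = 1 and of E for i = 2. The basis is ordered as R_i[1]
  followed by R_i, with degrees -1, -2, 0, -1 and differential entries -x^i at (0,1) and x^i at
  (2,3); the matrices below all refer to this order.\<close>

definition RS :: "nat \<Rightarrow> 'k::field resolved" where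
  "RS i = rsum (rshift (RR i)) (RR i)"

lemma RS_simps [simp]: "bs (RS i) = bsum (bshift (Pn i)) (Pn i)" "ob (RS i) = dsum (shift (Rn i)) (Rn i)"
  by (simp_all add: RS_def)

lemma res_RR_RS [simp]:
  "is_res (RR n :: 'k::field resolved)" "is_res (rshift (RR n :: 'k resolved))"
  "is_res (RS i :: 'k resolved)" "is_res (rshift (RS i :: 'k resolved))"
proof -
  have 1: "is_res (RR n :: 'k resolved)" for n by (rule is_res_RR)
  have 2: "is_res (rshift (RR n :: 'k resolved))" for n
    by (rule is_res_shift[OF 1]) (simp add: two_term_Pn)
  have 3: "is_res (rshift (rshift (RR n :: 'k resolved)))" for n
    by (rule is_res_shift[OF 2]) (simp add: two_term_shift two_term_Pn)
  show "is_res (RR n :: 'k resolved)" "is_res (rshift (RR n :: 'k resolved))" by (rule 1, rule 2)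
  show "is_res (RS i :: 'k resolved)" "is_res (rshift (RS i :: 'k resolved))"
    unfolding RS_def by (rule is_res_sum[OF 2 1], rule is_res_shift_sum[OF 2 1 3 2])
qed

lemma df_Pn [simp]: "df (Pn n) = ml [[0, xx ^ n], [0, 0]]"
  by (simp add: xx_def)

declare Pn_simps(5) [simp del]

lemmas mat_simps = chainmat_def dcond_def mm_def small_simps ml_def blk_def imat_def in2mat_def
  power2_eq_square power3_eq_cube algebra_simps

section \<open>The distinguished triangles as matrix identities\<close>

lemma mhtpI:
  "dcond (-1) P Q H \<Longrightarrow>
    \<forall>i<rk Q. \<forall>j<rk P. M i j = N i j + (mm (rk Q) (df Q) H i j + mm (rk P) H (df P) i j) \<Longrightarrow> mhtp P Q M N"
  unfolding mhtp_def by blast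

lemma mhtp_eq': "\<forall>i<rk Q. \<forall>j<rk P. M i j = N i j \<Longrightarrow> mhtp P Q M N"
  by (simp add: mhtp_eq)

text \<open>The homotopies are exposed as explicit matrices so that each condition becomes a finite
  computation. In all uses below the top rows of G are W, whence \<open>Hd\<close> is zero, and the
  last columns of K are V.\<close>

lemma distinguished_matrixI:
  assumes "is_res R" "is_res S" "is_res T" "is_res (rshift R)"
    and "rep R S U u" "rep S T V v" "rep T (rshift R) W w"
    and "chainmat (bs T) C G" "chainmat C (bs T) K"
    and "dcond (-1) C C Ha"
      "\<forall>i<rk C. \<forall>j<rk C. mm (rk (bs T)) G K i j = imat i j + (mm (rk C) (df C) Ha i j + mm (rk C) Ha (df C) i j)"
    and "dcond (-1) (bs T) (bs T) Hb"
      "\<forall>i<rk (bs T). \<forall>j<rk (bs T). mm (rk C) K G i j =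
         imat i j + (mm (rk (bs T)) (df (bs T)) Hb i j + mm (rk (bs T)) Hb (df (bs T)) i j)"
    and "dcond (-1) (bs S) C Hc"
      "\<forall>i<rk C. \<forall>j<rk (bs S). mm (rk (bs T)) G V i j =
         in2mat (rk (bs R)) i j + (mm (rk C) (df C) Hc i j + mm (rk (bs S)) Hc (df (bs S)) i j)"
    and "dcond (-1) (bs T) (bshift (bs R)) Hd"
      "\<forall>i<rk (bshift (bs R)). \<forall>j<rk (bs T). mm (rk C) imat G i j =
         W i j + (mm (rk (bshift (bs R))) (df (bshift (bs R))) Hd i j + mm (rk (bs T)) Hd (df (bs T)) i j)"
    and C: "C = bcone (bs R) U (bs S)"
  shows "distinguished (ob R) u (ob S) v (ob T) w"
proof -
  have "mhtp C C (mm (rk (bs T)) G K) imat" by (rule mhtpI[OF assms(10,11)])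
  moreover have "mhtp (bs T) (bs T) (mm (rk C) K G) imat" by (rule mhtpI[OF assms(12,13)])
  moreover have "mhtp (bs S) C (mm (rk (bs T)) G V) (in2mat (rk (bs R)))" by (rule mhtpI[OF assms(14,15)])
  moreover have "mhtp (bs T) (bshift (bs R)) (mm (rk C) imat G) W" by (rule mhtpI[OF assms(16,17)])
  ultimately show ?thesis
    using distinguished_matrix[OF assms(1-7), of G K] assms(8,9) by (simp add: C)
qed

text \<open>The change of basis that splits the cone is an isomorphism of complexes, so all
  homotopies vanish. Column 0 of G is the cocycle e3 - x^2 e0.\<close>

lemma triangle_f:
  assumes u: "rep (RR 3) (RR 3) (ml [[xx, 0], [0, xx]]) u"
    and v: "rep (RR 3) (RS 1) (ml [[0, 1], [0, 0], [1, 0], [0, xx^2]]) v"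
    and w: "rep (RS 1) (rshift (RR 3)) (ml [[- (xx^2), 0, 0, 1], [0, - 1, 0, 0]]) w"
  shows "distinguished (ob (RR 3)) u (ob (RR 3)) v (ob (RS 1)) w"
  by (rule distinguished_matrixI[OF _ _ _ _ u v w _ _ _ _ _ _ _ _ _ _ HOL.refl,
      where G = "ml [[- (xx^2), 0, 0, 1], [0, - 1, 0, 0], [0, 0, 1, 0], [1, 0, 0, 0]]"
        and K = "ml [[0, 0, 0, 1], [0, - 1, 0, 0], [0, 0, 1, 0], [1, 0, 0, xx^2]]"
        and Ha = "zmat"
        and Hb = "zmat"
        and Hc = "zmat"
        and Hd = "zmat"])
    (simp_all add: mat_simps is_res_sum)

text \<open>The same splitting for the cone of x^2, where the differential of e1 is x^2 times the
  cocycle e3 - x e0.\<close>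

lemma triangle_h:
  assumes u: "rep (RR 3) (RR 3) (ml [[xx^2, 0], [0, xx^2]]) u"
    and v: "rep (RR 3) (RS 2) (ml [[0, 1], [0, 0], [1, 0], [0, xx]]) v"
    and w: "rep (RS 2) (rshift (RR 3)) (ml [[- xx, 0, 0, 1], [0, - 1, 0, 0]]) w"
  shows "distinguished (ob (RR 3)) u (ob (RR 3)) v (ob (RS 2)) w"
  by (rule distinguished_matrixI[OF _ _ _ _ u v w _ _ _ _ _ _ _ _ _ _ HOL.refl,
      where G = "ml [[- xx, 0, 0, 1], [0, - 1, 0, 0], [0, 0, 1, 0], [1, 0, 0, 0]]"
        and K = "ml [[0, 0, 0, 1], [0, - 1, 0, 0], [0, 0, 1, 0], [1, 0, 0, xx]]"
        and Ha = "zmat"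
        and Hb = "zmat"
        and Hc = "zmat"
        and Hd = "zmat"])
    (simp_all add: mat_simps is_res_sum)

text \<open>The cone has rank 8 and the third object rank 4. The entries -1 of \<open>Ha\<close>
  contract the two acyclic pairs, basis elements 1, 5 and 3, 7, that the unit entries of u create in
  the cone.\<close>

lemma triangle_k:
  assumes u: "rep (RS 1) (RS 2) (ml [[xx, 0, 0, e], [0, 1, 0, 0], [0, 0, xx, 0], [0, 0, 0, 1]]) u"
    and v: "rep (RS 2) (RS 1) (ml [[1, 0, 0, - e], [0, xx, 0, 0], [0, 0, 1, 0], [0, 0, 0, xx]]) v"
    and w: "rep (RS 1) (rshift (RS 1)) (ml [[0, - 1, 0, 0], [0, 0, 0, 0], [- (xx^2), 0, 0, 1], [0, - (xx^2), 0, 0]]) w"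
  shows "distinguished (ob (RS 1)) u (ob (RS 2)) v (ob (RS 1)) w"
  by (rule distinguished_matrixI[OF _ _ _ _ u v w _ _ _ _ _ _ _ _ _ _ HOL.refl,
      where G = "ml [[0, - 1, 0, 0], [0, 0, 0, 0], [- (xx^2), 0, 0, 1], [0, - (xx^2), 0, 0], [1 + e * xx, 0, 0, e^2], [0, 0, 0, 0], [0, 0, 1 + e * xx, 0], [xx, 0, 0, e]]"
        and K = "ml [[0, 0, 0, 0, 1, 0, 0, - e], [- 1, 0, 0, 0, 0, xx, 0, 0], [0, 0, 0, 0, 0, 0, 1, 0], [0, 0, 1, 0, 0, 0, 0, xx]]"
        and Ha = "ml [[0, 0, 0, 0, 0, 0, 0, 0], [0, 0, 0, 0, 0, - 1, 0, 0], [0, 0, 0, 0, 0, 0, e, 0], [0, 0, e, 0, xx, 0, 0, - 1], [0, 0, 0, 0, 0, 0, 0, 0], [0, 0, 0, 0, 0, 0, 0, 0], [0, 0, 0, 0, 0, 0, 0, 0], [0, 0, 0, 0, 0, 0, 0, 0]]"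
        and Hb = "ml [[0, 0, 0, 0], [0, 0, 0, 0], [0, 0, 0, 0], [0, 0, e, 0]]"
        and Hc = "ml [[0, 0, 0, 0], [0, - 1, 0, 0], [0, 0, e, 0], [xx, 0, 0, - 1], [0, 0, 0, 0], [0, 0, 0, 0], [0, 0, 0, 0], [0, 0, 0, 0]]"
        and Hd = "zmat"])
    (simp_all add: mat_simps is_res_sum)

text \<open>Both sides have rank 6. For e = 0 the matrices G and K are inverse to each other; the
  terms in e require the homotopies, all of whose entries are multiples of e.\<close>

lemma triangle_l:
  assumes u: "rep (RR 3) (RS 2) (ml [[0, xx], [0, 0], [xx, 0], [0, xx^2]]) u"
    and v: "rep (RS 2) (rsum (RS 1) (rshift (RR 3))) (ml [[1, 0, 0, - e], [0, xx, 0, 0], [0, 0, 1, 0], [0, 0, 0, xx], [xx, 0, 0, - 1], [0, 1, 0, 0]]) v"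
    and w: "rep (rsum (RS 1) (rshift (RR 3))) (rshift (RR 3)) (ml [[- (xx^2), 0, 0, 1, xx, 0], [0, - 1, 0, 0, 0, xx]]) w"
  shows "distinguished (ob (RR 3)) u (ob (RS 2)) v (ob (rsum (RS 1) (rshift (RR 3)))) w"
  by (rule distinguished_matrixI[OF _ _ _ _ u v w _ _ _ _ _ _ _ _ _ _ HOL.refl,
      where G = "ml [[- (xx^2), 0, 0, 1, xx, 0], [0, - 1, 0, 0, 0, xx], [1 + e * xx, 0, 0, e^2, - e, 0], [0, e, 0, 0, 0, 1 - e * xx], [0, 0, 1 + e * xx, 0, 0, 0], [xx, 0, 0, e, - 1, 0]]"
        and K = "ml [[0, 0, 1, 0, 0, - e], [0, - 1 + e * xx, 0, xx, 0, 0], [0, 0, 0, 0, 1, 0], [1, 0, 0, 0, 0, xx], [e, 0, xx, 0, 0, - 1], [0, e, 0, 1, 0, 0]]"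
        and Ha = "ml [[0, 0, 0, 0, e, 0], [0, 0, 0, 0, 0, 0], [0, 0, 0, 0, 0, 0], [0, 0, 0, 0, 0, 0], [0, 0, 0, 0, 0, 0], [0, 0, 0, 0, 0, 0]]"
        and Hb = "ml [[0, 0, 0, 0, 0, 0], [0, 0, 0, 0, 0, 0], [0, 0, 0, 0, 0, 0], [0, 0, e, 0, 0, 0], [0, 0, e^2, 0, 0, 0], [0, 0, 0, 0, 0, 0]]"
        and Hc = "ml [[0, 0, e, 0], [0, 0, 0, 0], [0, 0, 0, 0], [0, 0, 0, 0], [0, 0, 0, 0], [0, 0, 0, 0]]"
        and Hd = "zmat"])
    (simp_all add: mat_simps is_res_sum)

text \<open>The unit entries of u make the pairs 0, 6 and 1, 4 of the cone contractible, which
  accounts for the constant terms -1 in \<open>Ha\<close>; the other terms there are corrections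
  divisible by e.\<close>

lemma triangle_l':
  assumes u: "rep (RR 3) (rsum (RR 3) (RS 1)) (ml [[xx, 0], [0, xx], [0, 1], [0, 0], [1, 0], [0, xx^2]]) u"
    and v: "rep (rsum (RR 3) (RS 1)) (RS 2) (ml [[0, 1, - xx, 0, 0, - e], [0, 0, 0, - 1, 0, 0], [1, 0, 0, 0, - xx, 0], [0, xx, 0, 0, 0, - 1]]) v"
    and w: "rep (RS 2) (rshift (RR 3)) (ml [[- (xx^2), 0, 0, xx], [0, - xx, 0, 0]]) w"
  shows "distinguished (ob (RR 3)) u (ob (rsum (RR 3) (RS 1))) v (ob (RS 2)) w"
  by (rule distinguished_matrixI[OF _ _ _ _ u v w _ _ _ _ _ _ _ _ _ _ HOL.refl,
      where G = "ml [[- (xx^2), 0, 0, xx], [0, - xx, 0, 0], [0, 0, 1 - e * xx, 0], [1, 0, 0, - e], [- e, 0, 0, e^2], [0, - 1 - e * xx, 0, 0], [0, 0, - e, 0], [xx, 0, 0, - 1 - e * xx]]"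
        and K = "ml [[0, 0, 0, 1, - xx, 0, 0, - e], [0, e, 0, 0, 0, - 1, 0, 0], [0, 0, 1, 0, 0, 0, - xx, 0], [0, 0, 0, xx, 0, 0, 0, - 1]]"
        and Ha = "ml [[0, 0, - e, 0, 0, 0, - 1 + e * xx, 0], [0, 0, 0, - e, - 1, 0, 0, 0], [0, 0, 0, 0, 0, 0, 0, 0], [0, 0, 0, 0, 0, 0, 0, 0], [0, 0, 0, 0, 0, 0, 0, 0], [0, 0, 0, - (e^2), - e, 0, 0, 0], [0, 0, 0, 0, 0, 0, 0, 0], [0, 0, 0, 0, 0, 0, 0, 0]]"
        and Hb = "zmat"
        and Hc = "ml [[- e, 0, 0, 0, - 1 + e * xx, 0], [0, - e, - 1, 0, 0, 0], [0, 0, 0, 0, 0, 0], [0, 0, 0, 0, 0, 0], [0, 0, 0, 0, 0, 0], [0, - (e^2), - e, 0, 0, 0], [0, 0, 0, 0, 0, 0], [0, 0, 0, 0, 0, 0]]"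
        and Hd = "zmat"])
    (simp_all add: mat_simps is_res_sum)

section \<open>Matrices of the morphisms in the octahedra\<close>

lemma rep_matrix:
  assumes "is_res R" "is_res S" "rep R S M \<phi>"
    and "\<forall>i<rk (bs S). \<forall>j<rk (bs R). M i j = N i j"
  shows "rep R S N \<phi>"
  using rep_cong[OF assms(1-3)] assms(4) by blast

text \<open>Composites are put into a normal form K up to homotopy; composites with k or k' acquire
  terms in e that only disappear in this way.\<close>

lemma rep_product:
  assumes "is_res R" "is_res S" "is_res T" "rep R S M \<phi>" "rep S T N \<psi>"
    and "chainmat (bs R) (bs T) K" "mhtp (bs R) (bs T) (mm (rk (bs S)) N M) K"
  shows "rep R T K (\<psi> \<cdot> \<phi>)"
  using rep_mhtp[OF assms(1,3) rep_comp[OF assms(1-5)] assms(6,7)] .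

lemma rep_x:
  assumes "n \<le> m + i"
  shows "rep (RR m) (RR n) (ml [[xx ^ i, 0], [0, xx ^ (m + i - n)]]) (xmor m n i)"
  using rep_xmor[OF assms] by (simp add: xx_def)

lemma rep_x1: "rep (RR 3) (RR 3) (ml [[xx, 0], [0, xx]]) (xmor 3 3 1)"
  using rep_x[of 3 3 1] by simp

lemmas block_simps = mat_simps colm_def rowm_def

lemma rep_col_y_x:
  "rep (RR 3) (RS 1) (ml [[0, 1], [0, 0], [1, 0], [0, xx^2]])
    (dcol (Rn 3) (shift (Rn 1)) (Rn 1) (ymor 3 1) (xmor 3 1 0))"
  "rep (RR 3) (RS 2) (ml [[0, 1], [0, 0], [1, 0], [0, xx]])
    (dcol (Rn 3) (shift (Rn 2)) (Rn 2) (ymor 3 2) (xmor 3 2 0))"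
  unfolding RS_def
  by (rule rep_matrix[OF _ _ rep_dcol(1)[OF res_RR_RS(1,2,1) rep_ymor rep_x, unfolded res_simps RR_ob]];
      simp add: block_simps is_res_sum)+

lemma rep_row_x_y:
  "rep (RS 1) (rshift (RR 3)) (ml [[- (xx^2), 0, 0, 1], [0, - 1, 0, 0]])
    (drow (shift (Rn 1)) (Rn 1) (shift (Rn 3)) (dneg ((xmor 1 3 2)\<langle>1\<rangle>)) (ymor 1 3))"
  "rep (RS 2) (rshift (RR 3)) (ml [[- xx, 0, 0, 1], [0, - 1, 0, 0]])
    (drow (shift (Rn 2)) (Rn 2) (shift (Rn 3)) (dneg ((xmor 2 3 1)\<langle>1\<rangle>)) (ymor 2 3))"
  unfolding RS_def
  by (rule rep_matrix[OF _ _ rep_drow(1)[OF res_RR_RS(2,2,1)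
          rep_neg[OF res_RR_RS(2,2) rep_shift[OF res_RR_RS(1,1) rep_x]] rep_ymor, unfolded res_simps RR_ob]];
      simp add: block_simps is_res_sum)+

lemmas rep_dmat_RS = rep_dmat[OF res_RR_RS(2,1,2,1), unfolded res_simps RR_ob]

lemma rep_k:
  "rep (RS 1) (RS 2) (ml [[xx, 0, 0, 0], [0, 1, 0, 0], [0, 0, xx, 0], [0, 0, 0, 1]])
    (dmat (shift (Rn 1)) (Rn 1) (shift (Rn 2)) (Rn 2) ((xmor 1 2 1)\<langle>1\<rangle>) (dzero (Rn 1) (shift (Rn 2)))
               (dzero (shift (Rn 1)) (Rn 2)) (xmor 1 2 1))"
  "rep (RS 1) (RS 2) (ml [[xx, 0, 0, 1], [0, 1, 0, 0], [0, 0, xx, 0], [0, 0, 0, 1]])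
    (dmat (shift (Rn 1)) (Rn 1) (shift (Rn 2)) (Rn 2) ((xmor 1 2 1)\<langle>1\<rangle>) (ymor 1 2)
               (dzero (shift (Rn 1)) (Rn 2)) (xmor 1 2 1))"
  "rep (RS 2) (RS 1) (ml [[1, 0, 0, 0], [0, xx, 0, 0], [0, 0, 1, 0], [0, 0, 0, xx]])
    (dmat (shift (Rn 2)) (Rn 2) (shift (Rn 1)) (Rn 1) ((xmor 2 1 0)\<langle>1\<rangle>) (dzero (Rn 2) (shift (Rn 1)))
               (dzero (shift (Rn 2)) (Rn 1)) (xmor 2 1 0))"
  "rep (RS 2) (RS 1) (ml [[1, 0, 0, - 1], [0, xx, 0, 0], [0, 0, 1, 0], [0, 0, 0, xx]])
    (dmat (shift (Rn 2)) (Rn 2) (shift (Rn 1)) (Rn 1) ((xmor 2 1 0)\<langle>1\<rangle>) (dneg (ymor 2 1))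
               (dzero (shift (Rn 2)) (Rn 1)) (xmor 2 1 0))"
proof -
  have z: "rep (RR m) (rshift (RR n)) zmat (dzero (Rn m) (shift (Rn n)))"
    "rep (rshift (RR m)) (RR n) zmat (dzero (shift (Rn m)) (Rn n))" for m n
    using rep_zero[OF res_RR_RS(1,2), of m n] rep_zero[OF res_RR_RS(2,1), of m n] by simp_all
  note s = rep_shift[OF res_RR_RS(1,1) rep_x]
  note [simp] = is_res_sum
  show "rep (RS 1) (RS 2) (ml [[xx, 0, 0, 0], [0, 1, 0, 0], [0, 0, xx, 0], [0, 0, 0, 1]])
    (dmat (shift (Rn 1)) (Rn 1) (shift (Rn 2)) (Rn 2) ((xmor 1 2 1)\<langle>1\<rangle>) (dzero (Rn 1) (shift (Rn 2)))
               (dzero (shift (Rn 1)) (Rn 2)) (xmor 1 2 1))"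
    unfolding RS_def by (rule rep_matrix[OF _ _ rep_dmat_RS[OF s z(1) z(2) rep_x]]) (simp_all add: block_simps)
  show "rep (RS 1) (RS 2) (ml [[xx, 0, 0, 1], [0, 1, 0, 0], [0, 0, xx, 0], [0, 0, 0, 1]])
    (dmat (shift (Rn 1)) (Rn 1) (shift (Rn 2)) (Rn 2) ((xmor 1 2 1)\<langle>1\<rangle>) (ymor 1 2)
               (dzero (shift (Rn 1)) (Rn 2)) (xmor 1 2 1))"
    unfolding RS_def by (rule rep_matrix[OF _ _ rep_dmat_RS[OF s rep_ymor z(2) rep_x]]) (simp_all add: block_simps)
  show "rep (RS 2) (RS 1) (ml [[1, 0, 0, 0], [0, xx, 0, 0], [0, 0, 1, 0], [0, 0, 0, xx]])
    (dmat (shift (Rn 2)) (Rn 2) (shift (Rn 1)) (Rn 1) ((xmor 2 1 0)\<langle>1\<rangle>) (dzero (Rn 2) (shift (Rn 1)))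
               (dzero (shift (Rn 2)) (Rn 1)) (xmor 2 1 0))"
    unfolding RS_def by (rule rep_matrix[OF _ _ rep_dmat_RS[OF s z(1) z(2) rep_x]]) (simp_all add: block_simps)
  show "rep (RS 2) (RS 1) (ml [[1, 0, 0, - 1], [0, xx, 0, 0], [0, 0, 1, 0], [0, 0, 0, xx]])
    (dmat (shift (Rn 2)) (Rn 2) (shift (Rn 1)) (Rn 1) ((xmor 2 1 0)\<langle>1\<rangle>) (dneg (ymor 2 1))
               (dzero (shift (Rn 2)) (Rn 1)) (xmor 2 1 0))"
    unfolding RS_def by (rule rep_matrix[OF _ _ rep_dmat_RS[OF s rep_neg[OF res_RR_RS(1,2) rep_ymor] z(2) rep_x]]) (simp_all add: block_simps is_res_sum)
qed

lemma in_Db0_Rn: "in_Db0 (Rn n :: 'k::field poly cplx)" "in_Db0 (dsum (shift (Rn n)) (Rn n) :: 'k poly cplx)"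
proof -
  have c: "xpow n \<odot>\<^bsub>Rmod n\<^esub> v = cls n 0" if "v \<in> carrier (Rmod n)" for v :: "'k poly elt"
    using that by (auto elim!: cls_cases simp: cls_eq_iff)
  have c0: "xpow n \<odot>\<^bsub>Rmod 0\<^esub> v = cls 0 0" if "v \<in> carrier (Rmod 0)" for v :: "'k poly elt"
    using that by (auto elim!: cls_cases simp: cls_eq_iff)
  show "in_Db0 (Rn n :: 'k poly cplx)" "in_Db0 (dsum (shift (Rn n)) (Rn n) :: 'k poly cplx)"
    using c c0 bc_Rn[where 'a = 'k] by (auto intro!: in_Db0I[where N = n] elim!: dsum_cases)
qed

section \<open>The family of good octahedra and the obstruction to an isomorphism\<close>

context
  fixes f f' h' g'' h'' :: "'k::field poly dmor"
  assumes f: "rep (RR 3) (RR 3) (ml [[xx, 0], [0, xx]]) f"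
    and f': "rep (RR 3) (RS 1) (ml [[0, 1], [0, 0], [1, 0], [0, xx^2]]) f'"
    and h': "rep (RR 3) (RS 2) (ml [[0, 1], [0, 0], [1, 0], [0, xx]]) h'"
    and g'': "rep (RS 1) (rshift (RR 3)) (ml [[- (xx^2), 0, 0, 1], [0, - 1, 0, 0]]) g''"
    and h'': "rep (RS 2) (rshift (RR 3)) (ml [[- xx, 0, 0, 1], [0, - 1, 0, 0]]) h''"
begin

text \<open>The composites and matrix morphisms in which k and k' do not occur; they are shared by
  all members of the family.\<close>

lemma common_reps:
  "rep (RR 3) (RR 3) (ml [[xx^2, 0], [0, xx^2]]) (f \<cdot> f)"
  "rep (RR 3) (RS 2) (ml [[0, xx], [0, 0], [xx, 0], [0, xx^2]]) (h' \<cdot> f)"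
  "rep (RS 2) (rshift (RR 3)) (ml [[- (xx^2), 0, 0, xx], [0, - xx, 0, 0]]) (f\<langle>1\<rangle> \<cdot> h'')"
  "rep (RS 1) (rshift (RS 1)) (ml [[0, - 1, 0, 0], [0, 0, 0, 0], [- (xx^2), 0, 0, 1], [0, - (xx^2), 0, 0]]) (f'\<langle>1\<rangle> \<cdot> g'')"
  "rep (RS 2) (rshift (RR 3)) (ml [[xx, 0, 0, - 1], [0, 1, 0, 0]]) (dneg h'')"
  "rep (rshift (RR 3)) (rshift (RR 3)) (ml [[xx, 0], [0, xx]]) (f\<langle>1\<rangle>)"
  "rep (RR 3) (rsum (RR 3) (RS 1)) (ml [[xx, 0], [0, xx], [0, 1], [0, 0], [1, 0], [0, xx^2]])
     (dcol (Rn 3) (Rn 3) (dsum (shift (Rn 1)) (Rn 1)) f f')"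
  "rep (rsum (RS 1) (rshift (RR 3))) (rshift (RR 3)) (ml [[- (xx^2), 0, 0, 1, xx, 0], [0, - 1, 0, 0, 0, xx]])
     (drow (dsum (shift (Rn 1)) (Rn 1)) (shift (Rn 3)) (shift (Rn 3)) g'' (f\<langle>1\<rangle>))"
proof -
  show f1: "rep (rshift (RR 3)) (rshift (RR 3)) (ml [[xx, 0], [0, xx]]) (f\<langle>1\<rangle>)"
    by (rule rep_shift[OF res_RR_RS(1,1) f])
  have f'1: "rep (rshift (RR 3)) (rshift (RS 1)) (ml [[0, 1], [0, 0], [1, 0], [0, xx^2]]) (f'\<langle>1\<rangle>)"
    by (rule rep_shift[OF res_RR_RS(1,3) f'])
  show "rep (RR 3) (RR 3) (ml [[xx^2, 0], [0, xx^2]]) (f \<cdot> f)"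
    by (rule rep_product[OF _ _ _ f f], simp_all only: res_RR_RS, simp add: mat_simps, rule mhtp_eq', simp add: mat_simps)
  show "rep (RR 3) (RS 2) (ml [[0, xx], [0, 0], [xx, 0], [0, xx^2]]) (h' \<cdot> f)"
    by (rule rep_product[OF _ _ _ f h'], simp_all only: res_RR_RS, simp add: mat_simps, rule mhtp_eq', simp add: mat_simps)
  show "rep (RS 2) (rshift (RR 3)) (ml [[- (xx^2), 0, 0, xx], [0, - xx, 0, 0]]) (f\<langle>1\<rangle> \<cdot> h'')"
    by (rule rep_product[OF _ _ _ h'' f1], simp_all only: res_RR_RS, simp add: mat_simps, rule mhtp_eq', simp add: mat_simps)
  show "rep (RS 1) (rshift (RS 1)) (ml [[0, - 1, 0, 0], [0, 0, 0, 0], [- (xx^2), 0, 0, 1], [0, - (xx^2), 0, 0]]) (f'\<langle>1\<rangle> \<cdot> g'')"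
    by (rule rep_product[OF _ _ _ g'' f'1], simp_all only: res_RR_RS, simp add: mat_simps, rule mhtp_eq', simp add: mat_simps)
  show "rep (RS 2) (rshift (RR 3)) (ml [[xx, 0, 0, - 1], [0, 1, 0, 0]]) (dneg h'')"
    by (rule rep_matrix[OF _ _ rep_neg[OF _ _ h'']]) (simp_all add: block_simps)
  show "rep (RR 3) (rsum (RR 3) (RS 1)) (ml [[xx, 0], [0, xx], [0, 1], [0, 0], [1, 0], [0, xx^2]])
     (dcol (Rn 3) (Rn 3) (dsum (shift (Rn 1)) (Rn 1)) f f')"
    by (rule rep_matrix[OF _ _ rep_dcol(1)[OF res_RR_RS(1,1,3) f f', unfolded RS_simps RR_ob]]) (simp_all add: block_simps is_res_sum)
  show "rep (rsum (RS 1) (rshift (RR 3))) (rshift (RR 3)) (ml [[- (xx^2), 0, 0, 1, xx, 0], [0, - 1, 0, 0, 0, xx]])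
     (drow (dsum (shift (Rn 1)) (Rn 1)) (shift (Rn 3)) (shift (Rn 3)) g'' (f\<langle>1\<rangle>))"
    by (rule rep_matrix[OF _ _ rep_drow(1)[OF res_RR_RS(2,3,2) g'' f1, unfolded RS_simps res_simps RR_ob]])
      (simp_all add: block_simps is_res_sum)
qed

text \<open>Up to homotopy the composites of k and k' with the fixed morphisms do not depend on e,
  so the faces commute as for e = 0, and the triangles are the ones already verified for arbitrary
  e.\<close>

lemma good_octahedron_family:
  assumes k: "rep (RS 1) (RS 2) (ml [[xx, 0, 0, e], [0, 1, 0, 0], [0, 0, xx, 0], [0, 0, 0, 1]]) k"
    and k': "rep (RS 2) (RS 1) (ml [[1, 0, 0, - e], [0, xx, 0, 0], [0, 0, 1, 0], [0, 0, 0, xx]]) k'"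
  shows "good_octahedron (octahedron_of (Rn 3) f (Rn 3) f (Rn 3) (dsum (shift (Rn 1)) (Rn 1)) (dsum (shift (Rn 2)) (Rn 2))
     (dsum (shift (Rn 1)) (Rn 1)) f' h' g'' h'' k k')"
proof -
  note r = common_reps
  \<comment> \<open>The product has the extra entry -e x at (0,3). It is null-homotopic because the
    differential of the source contains the entry x of the resolution of R_1. The homotopies in the
    next three composites absorb -e x, e x^2 and e x^2 in the same way.\<close>
  have kf: "rep (RS 1) (rshift (RR 3)) (ml [[- (xx^2), 0, 0, 1], [0, - 1, 0, 0]]) (h'' \<cdot> k)"
    by (rule rep_product[OF _ _ _ k h''], simp_all only: res_RR_RS, simp add: mat_simps,
        rule mhtpI[where H = "ml [[0, 0, - e, 0], [0, 0, 0, 0]]"], simp_all add: mat_simps)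
  have kg: "rep (RR 3) (RS 1) (ml [[0, 1], [0, 0], [1, 0], [0, xx^2]]) (k' \<cdot> h')"
    by (rule rep_product[OF _ _ _ h' k'], simp_all only: res_RR_RS, simp add: mat_simps,
        rule mhtpI[where H = "ml [[0, 0], [0, e], [0, 0], [0, 0]]"], simp_all add: mat_simps)
  have kl: "rep (RR 3) (RS 2) (ml [[0, xx], [0, 0], [xx, 0], [0, xx^2]]) (k \<cdot> f')"
    by (rule rep_product[OF _ _ _ f' k], simp_all only: res_RR_RS, simp add: mat_simps,
        rule mhtpI[where H = "ml [[0, 0], [0, - e], [0, 0], [0, 0]]"], simp_all add: mat_simps)
  have kl': "rep (RS 2) (rshift (RR 3)) (ml [[- (xx^2), 0, 0, xx], [0, - xx, 0, 0]]) (g'' \<cdot> k')"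
    by (rule rep_product[OF _ _ _ k' g''], simp_all only: res_RR_RS, simp add: mat_simps,
        rule mhtpI[where H = "ml [[0, 0, e, 0], [0, 0, 0, 0]]"], simp_all add: mat_simps)
  have c: "rep (RS 2) (rsum (RS 1) (rshift (RR 3)))
      (ml [[1, 0, 0, - e], [0, xx, 0, 0], [0, 0, 1, 0], [0, 0, 0, xx], [xx, 0, 0, - 1], [0, 1, 0, 0]])
      (dcol (ob (RS 2)) (ob (RS 1)) (ob (rshift (RR 3))) k' (dneg h''))"
    by (rule rep_matrix[OF _ _ rep_dcol(1)[OF res_RR_RS(3,3,2) k' r(5)]]) (simp_all add: block_simps is_res_sum)
  have nk: "rep (RS 1) (RS 2) (ml [[- xx, 0, 0, - e], [0, - 1, 0, 0], [0, 0, - xx, 0], [0, 0, 0, - 1]]) (dneg k)"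
    by (rule rep_matrix[OF _ _ rep_neg[OF _ _ k]]) (simp_all add: block_simps)
  have d: "rep (rsum (RR 3) (RS 1)) (RS 2)
      (ml [[0, 1, - xx, 0, 0, - e], [0, 0, 0, - 1, 0, 0], [1, 0, 0, 0, - xx, 0], [0, xx, 0, 0, 0, - 1]])
      (drow (ob (RR 3)) (ob (RS 1)) (ob (RS 2)) h' (dneg k))"
    by (rule rep_matrix[OF _ _ rep_drow(1)[OF res_RR_RS(3,1,3) h' nk]]) (simp_all add: block_simps is_res_sum)
  have "h' \<cdot> f = k \<cdot> f'" by (rule rep_unique[OF _ _ r(2) kl]) simp_all
  moreover have "f\<langle>1\<rangle> \<cdot> h'' = g'' \<cdot> k'" by (rule rep_unique[OF _ _ r(3) kl']) simp_all
  moreover note triangle_f[OF f f' kf] triangle_f[OF f kg g''] triangle_h[OF r(1) h' h''] triangle_k[OF k k' r(4)]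
    triangle_l[OF r(2) c r(8)] triangle_l'[OF r(7) d r(3)] repD(1)[OF r(2)] repD(1)[OF r(3)]
  ultimately show ?thesis
    unfolding good_octahedron_def is_octahedron_def octahedron_of_def
    by (simp add: in_Db0_Rn)
qed

text \<open>
  With \<open>a\<close>, \<open>b\<close>, \<open>c\<close>, \<open>p\<close> the scalars by which \<open>\<phi>A\<close>, \<open>\<phi>B\<close>, \<open>\<phi>C\<close> and the diagonal of \<open>\<phi>E\<close> act,
  the squares of \<open>f\<close>, \<open>g\<close>, \<open>h'\<close>, \<open>h''\<close> give $a = b = c = p$ modulo $x^2$ and force the
  off-diagonal entry of \<open>\<phi>E\<close> to be divisible by $x$.  The square of \<open>k\<close> then makes
  the scalar of \<open>\<phi>D\<close> on $R_1$ divisible by $x$, so that \<open>\<phi>D\<close> is not invertible.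
\<close>

lemma not_intertwined:
  assumes k: "rep (RS 1) (RS 2) (ml [[xx, 0, 0, 0], [0, 1, 0, 0], [0, 0, xx, 0], [0, 0, 0, 1]]) k"
    and kt: "rep (RS 1) (RS 2) (ml [[xx, 0, 0, 1], [0, 1, 0, 0], [0, 0, xx, 0], [0, 0, 0, 1]]) kt"
    and A: "\<phi>A \<in> dhom (Rn 3) (Rn 3)" and B: "\<phi>B \<in> dhom (Rn 3) (Rn 3)" and C: "\<phi>C \<in> dhom (Rn 3) (Rn 3)"
    and D: "diso (ob (RS 1)) \<phi>D (ob (RS 1))" and E: "\<phi>E \<in> dhom (ob (RS 2)) (ob (RS 2))"
    and sf: "f \<cdot> \<phi>A = \<phi>B \<cdot> f" and sg: "f \<cdot> \<phi>B = \<phi>C \<cdot> f"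
    and sh': "h' \<cdot> \<phi>C = \<phi>E \<cdot> h'" and sh'': "h'' \<cdot> \<phi>E = \<phi>A\<langle>1\<rangle> \<cdot> h''"
    and sk: "kt \<cdot> \<phi>D = \<phi>E \<cdot> k"
  shows False
proof -
  obtain \<psi> where psi: "\<psi> \<in> dhom (ob (RS 1)) (ob (RS 1))" "\<psi> \<cdot> \<phi>D = did (ob (RS 1))"
    and D': "\<phi>D \<in> dhom (ob (RS 1)) (ob (RS 1))"
    using D unfolding diso_def by blast
  obtain MA where MA: "rep (RR 3) (RR 3) MA \<phi>A" using rep_full[OF res_RR_RS(1,1), unfolded RR_ob, OF A] by blast
  obtain MB where MB: "rep (RR 3) (RR 3) MB \<phi>B" using rep_full[OF res_RR_RS(1,1), unfolded RR_ob, OF B] by blast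
  obtain MC where MC: "rep (RR 3) (RR 3) MC \<phi>C" using rep_full[OF res_RR_RS(1,1), unfolded RR_ob, OF C] by blast
  obtain MD where MD: "rep (RS 1) (RS 1) MD \<phi>D" using rep_full[OF res_RR_RS(3,3) D'] by blast
  obtain ME where ME: "rep (RS 2) (RS 2) ME \<phi>E" using rep_full[OF res_RR_RS(3,3) E] by blast
  obtain MI where MI: "rep (RS 1) (RS 1) MI \<psi>" using rep_full[OF res_RR_RS(3,3) psi(1)] by blast
  \<comment> \<open>Extracts a single entry of a homotopy; the matrix H may depend on the entry,
    since only divisibility by powers of x is used.\<close>
  have entry: "\<exists>H. M i j = N i j + (mm (rk Q) (df Q) H i j + mm (rk P) H (df P) i j)"
    if "mhtp P Q M N" "i < rk Q" "j < rk P" for P Q :: "'k based" and M N i j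
    using that unfolding mhtp_def by blast
  have nz: "xx \<noteq> (0 :: 'k poly)" by (simp add: xx_def)
  \<comment> \<open>In the entry of degree -1 the homotopy term is a multiple of x^3; cancelling x
    leaves a congruence modulo x^2.\<close>
  have 1: "\<exists>t. MA 1 1 = MB 1 1 + xx^2 * t"
  proof -
    have "mhtp (Pn 3) (Pn 3) (mm 2 (ml [[xx, 0], [0, xx]]) MA) (mm 2 MB (ml [[xx, 0], [0, xx]]))"
      using rep_faithful[OF _ _ rep_comp[OF _ _ _ MA f] rep_comp[OF _ _ _ f MB, folded sf]] by simp
    then have "\<exists>H :: nat \<Rightarrow> nat \<Rightarrow> 'k poly. xx * MA 1 1 = xx * MB 1 1 + xx * (xx * (xx * H 1 0))"
      by (auto dest!: entry[of _ _ _ _ 1 1] simp: mat_simps)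
    then obtain H :: "nat \<Rightarrow> nat \<Rightarrow> 'k poly" where "xx * MA 1 1 = xx * MB 1 1 + xx * (xx * (xx * H 1 0))" by blast
    then have "xx * MA 1 1 = xx * (MB 1 1 + xx^2 * H 1 0)"
      by (simp add: algebra_simps power2_eq_square)
    then show ?thesis using nz by auto
  qed
  have 2: "\<exists>t. MB 1 1 = MC 1 1 + xx^2 * t"
  proof -
    have "mhtp (Pn 3) (Pn 3) (mm 2 (ml [[xx, 0], [0, xx]]) MB) (mm 2 MC (ml [[xx, 0], [0, xx]]))"
      using rep_faithful[OF _ _ rep_comp[OF _ _ _ MB f] rep_comp[OF _ _ _ f MC, folded sg]] by simp
    then have "\<exists>H :: nat \<Rightarrow> nat \<Rightarrow> 'k poly. xx * MB 1 1 = xx * MC 1 1 + xx * (xx * (xx * H 1 0))"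
      by (auto dest!: entry[of _ _ _ _ 1 1] simp: mat_simps)
    then obtain H :: "nat \<Rightarrow> nat \<Rightarrow> 'k poly" where "xx * MB 1 1 = xx * MC 1 1 + xx * (xx * (xx * H 1 0))" by blast
    then have "xx * MB 1 1 = xx * (MC 1 1 + xx^2 * H 1 0)"
      by (simp add: algebra_simps power2_eq_square)
    then show ?thesis using nz by auto
  qed
  \<comment> \<open>\<open>ME\<close> commutes with the differential, whose block on R_2[1] has the
    single entry -x^2; cancelling it equates the diagonal entries of the block.\<close>
  have p: "ME 0 0 = ME 1 1"
  proof -
    have "mm 4 (df (bs (RS 2))) ME 0 1 = mm 4 ME (df (bs (RS 2))) 0 1"
      using repD(2)[OF ME] unfolding chainmat_def by simp
    then show ?thesis using nz by (simp add: mat_simps)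
  qed
  \<comment> \<open>Entry (0,1) is the component along y. The summand with \<open>ME 0 3\<close>
    comes from the part R_2 -> R_2[1] of \<phi>E composed with x^0, whose entry in degree -1 is
    x.\<close>
  have 3: "\<exists>t. MC 1 1 = ME 0 0 + xx * ME 0 3 + xx^2 * t"
  proof -
    have "mhtp (Pn 3) (bs (RS 2)) (mm 2 (ml [[0, 1], [0, 0], [1, 0], [0, xx]]) MC) (mm 4 ME (ml [[0, 1], [0, 0], [1, 0], [0, xx]]))"
      using rep_faithful[OF _ _ rep_comp[OF _ _ _ MC h'] rep_comp[OF _ _ _ h' ME, folded sh']] by simp
    then have "\<exists>H :: nat \<Rightarrow> nat \<Rightarrow> 'k poly. MC 1 1 = ME 0 0 + xx * ME 0 3 + xx^2 * (- H 1 1 + xx * H 0 0)"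
      by (auto dest!: entry[of _ _ _ _ 0 1] simp: mat_simps)
    then obtain H :: "nat \<Rightarrow> nat \<Rightarrow> 'k poly" where "MC 1 1 = ME 0 0 + xx * ME 0 3 + xx^2 * (- H 1 1 + xx * H 0 0)" by blast
    then show ?thesis by blast
  qed
  have 4: "\<exists>t. ME 1 1 = MA 1 1 + xx^2 * t"
  proof -
    have "mhtp (bs (RS 2)) (bshift (Pn 3)) (mm 4 (ml [[- xx, 0, 0, 1], [0, - 1, 0, 0]]) ME) (mm 2 MA (ml [[- xx, 0, 0, 1], [0, - 1, 0, 0]]))"
      using rep_faithful[OF _ _ rep_comp[OF _ _ _ ME h''] rep_comp[OF _ _ _ h'' rep_shift[OF _ _ MA], folded sh'']] by simp
    then have "\<exists>H :: nat \<Rightarrow> nat \<Rightarrow> 'k poly. - ME 1 1 = - MA 1 1 - xx^2 * H 1 0"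
      by (auto dest!: entry[of _ _ _ _ 1 1] simp: mat_simps)
    then obtain H :: "nat \<Rightarrow> nat \<Rightarrow> 'k poly" where "- ME 1 1 = - MA 1 1 - xx^2 * H 1 0" by blast
    then have "- ME 1 1 = - (MA 1 1 + xx^2 * H 1 0)" by simp
    then have "ME 1 1 = MA 1 1 + xx^2 * H 1 0" by (simp only: neg_equal_iff_equal)
    then show ?thesis by blast
  qed
  \<comment> \<open>Here the two octahedra differ: the entry y of \<open>kt\<close> contributes
    \<open>MD 3 3\<close>, the scalar of \<phi>D on R_1, while on the side of k only
    \<open>ME 0 3\<close> remains modulo x.\<close>
  have 5: "\<exists>t. MD 3 3 = ME 0 3 + xx * t"
  proof -
    have "mhtp (bs (RS 1)) (bs (RS 2)) (mm 4 (ml [[xx, 0, 0, 1], [0, 1, 0, 0], [0, 0, xx, 0], [0, 0, 0, 1]]) MD)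
        (mm 4 ME (ml [[xx, 0, 0, 0], [0, 1, 0, 0], [0, 0, xx, 0], [0, 0, 0, 1]]))"
      using rep_faithful[OF _ _ rep_comp[OF _ _ _ MD kt] rep_comp[OF _ _ _ k ME, folded sk]] by simp
    then have "\<exists>H :: nat \<Rightarrow> nat \<Rightarrow> 'k poly. xx * MD 0 3 + MD 3 3 = ME 0 3 + (- (xx^2) * H 1 3 + xx * H 0 2)"
      by (auto dest!: entry[of _ _ _ _ 0 3] simp: mat_simps)
    then obtain H :: "nat \<Rightarrow> nat \<Rightarrow> 'k poly" where "xx * MD 0 3 + MD 3 3 = ME 0 3 + (- (xx^2) * H 1 3 + xx * H 0 2)" by blast
    then have "MD 3 3 = ME 0 3 + xx * (- xx * H 1 3 + H 0 2 - MD 0 3)"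
      by (simp add: algebra_simps power2_eq_square)
    then show ?thesis by blast
  qed
  have q: "MD 2 2 = MD 3 3"
  proof -
    have "mm 4 (df (bs (RS 1))) MD 2 3 = mm 4 MD (df (bs (RS 1))) 2 3"
      using repD(2)[OF MD] unfolding chainmat_def by simp
    then show ?thesis using nz by (simp add: mat_simps)
  qed
  \<comment> \<open>On R_1 the homotopy term is a multiple of x, and the other products vanish for
    degree reasons, so the scalar of \<phi>D on R_1 has to be a unit modulo x.\<close>
  have 6: "\<exists>t. MI 2 2 * MD 2 2 = 1 + xx * t"
  proof -
    have "mhtp (bs (RS 1)) (bs (RS 1)) (mm 4 MI MD) imat"
      using rep_faithful[OF _ _ rep_comp[OF _ _ _ MD MI, unfolded psi(2)] rep_id] by simp
    then have "\<exists>H :: nat \<Rightarrow> nat \<Rightarrow> 'k poly. MI 2 0 * MD 0 2 + MI 2 1 * MD 1 2 + MI 2 2 * MD 2 2 + MI 2 3 * MD 3 2 = 1 + xx * H 3 2"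
      by (auto dest!: entry[of _ _ _ _ 2 2] simp: mat_simps)
    then obtain H :: "nat \<Rightarrow> nat \<Rightarrow> 'k poly" where "MI 2 0 * MD 0 2 + MI 2 1 * MD 1 2 + MI 2 2 * MD 2 2 + MI 2 3 * MD 3 2 = 1 + xx * H 3 2" by blast
    moreover have "dcond 0 (bs (RS 1)) (bs (RS 1)) MD"
      using repD(2)[OF MD] by (simp add: chainmat_def)
    then have "MD 0 2 = 0" "MD 1 2 = 0" "MD 3 2 = 0"
      by (simp_all add: dcond_def small_all)
    ultimately show ?thesis by auto
  qed
  obtain t1 t2 t3 t4 where t: "MA 1 1 = MB 1 1 + xx^2 * t1" "MB 1 1 = MC 1 1 + xx^2 * t2"
    "MC 1 1 = ME 0 0 + xx * ME 0 3 + xx^2 * t3" "ME 1 1 = MA 1 1 + xx^2 * t4"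
    using 1 2 3 4 by blast
  have "ME 0 0 = (((ME 0 0 + xx * ME 0 3 + xx^2 * t3) + xx^2 * t2) + xx^2 * t1) + xx^2 * t4"
    using t p by metis
  then have "xx * (ME 0 3 + xx * (t1 + t2 + t3 + t4)) = 0"
    by (simp add: algebra_simps power2_eq_square)
  then have "ME 0 3 + xx * (t1 + t2 + t3 + t4) = 0" using nz by simp
  then have "ME 0 3 = xx * (- (t1 + t2 + t3 + t4))"
    by (simp only: eq_neg_iff_add_eq_0 mult_minus_right)
  then have "xx dvd ME 0 3" by (rule dvdI)
  then have "xx dvd MD 2 2" using 5 q by auto
  then have "xx dvd MI 2 2 * MD 2 2" by simp
  then have "xx dvd (1 :: 'k poly)" using 6 by (metis dvd_add_left_iff dvd_triv_left)
  then show False by (simp add: xx_def dvd_iff_poly_eq_0)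
qed

end

theorem proposition2p2:
  fixes A B C D E F :: "'k::field poly cplx"
    and f g f' h' g'' h'' k k' kt kt' :: "'k poly dmor"
    and T Tt :: "'k poly octahedron"
  assumes "A = Rn 3" and "B = Rn 3" and "C = Rn 3"
    and "f = xmor 3 3 1" and "g = xmor 3 3 1"
    and "D = dsum (shift (Rn 1)) (Rn 1)"
    and "F = dsum (shift (Rn 1)) (Rn 1)"
    and "E = dsum (shift (Rn 2)) (Rn 2)"
    and "f' = dcol B (shift (Rn 1)) (Rn 1) (ymor 3 1) (xmor 3 1 0)"
    and "h' = dcol C (shift (Rn 2)) (Rn 2) (ymor 3 2) (xmor 3 2 0)"
    and "g'' = drow (shift (Rn 1)) (Rn 1) (shift B) (dneg ((xmor 1 3 2)\<langle>1\<rangle>)) (ymor 1 3)"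
    and "h'' = drow (shift (Rn 2)) (Rn 2) (shift A) (dneg ((xmor 2 3 1)\<langle>1\<rangle>)) (ymor 2 3)"
    and "k = dmat (shift (Rn 1)) (Rn 1) (shift (Rn 2)) (Rn 2)
               ((xmor 1 2 1)\<langle>1\<rangle>)                 (dzero (Rn 1) (shift (Rn 2)))
               (dzero (shift (Rn 1)) (Rn 2))     (xmor 1 2 1)"
    and "k' = dmat (shift (Rn 2)) (Rn 2) (shift (Rn 1)) (Rn 1)
               ((xmor 2 1 0)\<langle>1\<rangle>)                 (dzero (Rn 2) (shift (Rn 1)))
               (dzero (shift (Rn 2)) (Rn 1))     (xmor 2 1 0)"
    and "kt = dmat (shift (Rn 1)) (Rn 1) (shift (Rn 2)) (Rn 2)
               ((xmor 1 2 1)\<langle>1\<rangle>)                 (ymor 1 2)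
               (dzero (shift (Rn 1)) (Rn 2))     (xmor 1 2 1)"
    and "kt' = dmat (shift (Rn 2)) (Rn 2) (shift (Rn 1)) (Rn 1)
               ((xmor 2 1 0)\<langle>1\<rangle>)                 (dneg (ymor 2 1))
               (dzero (shift (Rn 2)) (Rn 1))     (xmor 2 1 0)"
    and "T = octahedron_of A f B g C D E F f' h' g'' h'' k k'"
    and "Tt = octahedron_of A f B g C D E F f' h' g'' h'' kt kt'"
  shows "octahedron_extends T A f B g C \<and> good_octahedron T \<and>
    octahedron_extends Tt A f B g C \<and> good_octahedron Tt \<and>
    \<not> octahedron_iso T Tt"
proof -
  note d = assms
  have f: "rep (RR 3) (RR 3) (ml [[xx, 0], [0, xx]]) f"
    unfolding d(4) by (rule rep_x1)
  have f': "rep (RR 3) (RS 1) (ml [[0, 1], [0, 0], [1, 0], [0, xx^2]]) f'"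
    unfolding d(9) d(2) by (rule rep_col_y_x(1))
  have h': "rep (RR 3) (RS 2) (ml [[0, 1], [0, 0], [1, 0], [0, xx]]) h'"
    unfolding d(10) d(3) by (rule rep_col_y_x(2))
  have g'': "rep (RS 1) (rshift (RR 3)) (ml [[- (xx^2), 0, 0, 1], [0, - 1, 0, 0]]) g''"
    unfolding d(11) d(2) by (rule rep_row_x_y(1))
  have h'': "rep (RS 2) (rshift (RR 3)) (ml [[- xx, 0, 0, 1], [0, - 1, 0, 0]]) h''"
    unfolding d(12) d(1) by (rule rep_row_x_y(2))
  have k: "rep (RS 1) (RS 2) (ml [[xx, 0, 0, 0], [0, 1, 0, 0], [0, 0, xx, 0], [0, 0, 0, 1]]) k"
    unfolding d(13) by (rule rep_k(1))
  have k': "rep (RS 2) (RS 1) (ml [[1, 0, 0, 0], [0, xx, 0, 0], [0, 0, 1, 0], [0, 0, 0, xx]]) k'"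
    unfolding d(14) by (rule rep_k(3))
  have kt: "rep (RS 1) (RS 2) (ml [[xx, 0, 0, 1], [0, 1, 0, 0], [0, 0, xx, 0], [0, 0, 0, 1]]) kt"
    unfolding d(15) by (rule rep_k(2))
  have kt': "rep (RS 2) (RS 1) (ml [[1, 0, 0, - 1], [0, xx, 0, 0], [0, 0, 1, 0], [0, 0, 0, xx]]) kt'"
    unfolding d(16) by (rule rep_k(4))
  have T: "T = octahedron_of (Rn 3) f (Rn 3) f (Rn 3) (dsum (shift (Rn 1)) (Rn 1)) (dsum (shift (Rn 2)) (Rn 2))
     (dsum (shift (Rn 1)) (Rn 1)) f' h' g'' h'' k k'"
    and Tt: "Tt = octahedron_of (Rn 3) f (Rn 3) f (Rn 3) (dsum (shift (Rn 1)) (Rn 1)) (dsum (shift (Rn 2)) (Rn 2))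
     (dsum (shift (Rn 1)) (Rn 1)) f' h' g'' h'' kt kt'"
    using d(17,18) by (simp_all only: d(1,2,3,6,7,8) d(4)[symmetric] d(5)[folded d(4)])
  \<comment> \<open>The first octahedron is the member e = 0 of the family, the second the member e
    = 1.\<close>
  have "good_octahedron T" "good_octahedron Tt"
    unfolding T Tt using good_octahedron_family[OF f f' h' g'' h'', of 0 k k'] k k'
      good_octahedron_family[OF f f' h' g'' h'' kt kt'] by simp_all
  moreover have "octahedron_extends T A f B g C" "octahedron_extends Tt A f B g C"
    by (simp_all add: d(17,18) octahedron_extends_def octahedron_of_def)
  moreover have "\<not> octahedron_iso T Tt"
  proof
    assume "octahedron_iso T Tt"
    then obtain \<phi>A \<phi>B \<phi>C \<phi>D \<phi>E where
      "diso (Rn 3) \<phi>A (Rn 3)" "diso (Rn 3) \<phi>B (Rn 3)" "diso (Rn 3) \<phi>C (Rn 3)"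
      and D: "diso (ob (RS 1)) \<phi>D (ob (RS 1))" and "diso (ob (RS 2)) \<phi>E (ob (RS 2))"
      and s: "f \<cdot> \<phi>A = \<phi>B \<cdot> f" "f \<cdot> \<phi>B = \<phi>C \<cdot> f" "h' \<cdot> \<phi>C = \<phi>E \<cdot> h'" "h'' \<cdot> \<phi>E = \<phi>A\<langle>1\<rangle> \<cdot> h''"
        "kt \<cdot> \<phi>D = \<phi>E \<cdot> k"
      unfolding octahedron_iso_def T Tt octahedron_of_def by auto
    then show False
      by (intro not_intertwined[OF f f' h' g'' h'' k kt _ _ _ D _ s]) (simp_all add: diso_def)
  qed
  ultimately show ?thesis by blast
qed

end
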